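(* Let $n\ge m\ge 1$ be integers, $\nu>\beta(m-1)$ real, let $\mathbf{T}\sim\mathcal{T}_{m\times n}^\beta(\nu,\mathbf{0},\mathbf{I}_m,\mathbf{I}_n)$ and let $\mathbf{F}=\mathbf{T}\mathbf{T}^{*}\in\mathfrak{P}_m^\beta$. Then the density of $\mathbf{F}$ is $$\frac{1}{\mathcal{B}_m^\beta[\beta\nu/2,\beta n/2]}\,|\mathbf{F}|^{\beta(n-m+1)/2-1}\,|\mathbf{I}_m+\mathbf{F}|^{-\beta(n+\nu)/2},\qquad \mathbf{F}\in\mathfrak{P}_m^\beta.$$
   Context: Let $\beta\in\{1,2,4\}$ and let $\mathfrak{F}$ be the real numbers ($\beta=1$), the complex numbers ($\beta=2$) or the quaternions ($\beta=4$). $\mathfrak{F}^{m\times n}$ is the set of $m\times n$ matrices over $\mathfrak{F}$, and $\mathbf{A}^{*}$ is the conjugate transpose. $\mathfrak{P}_p^\beta$ is the cone of $p\times p$ positive definite Hermitian ($\mathbf{A}=\mathbf{A}^*$) matrices over $\mathfrak{F}$; for $\mathbf{A}\in\mathfrak{P}_p^\beta$, $|\mathbf{A}|$ is the product of its $p$ (positive real) eigenvalues. Densities on $\mathfrak{F}^{m\times n}$ are with respect to Lebesgue measure in the $\beta mn$ real components of the entries. Densities on $\mathfrak{P}_p^\beta$ are with respect to the product of the Lebesgue measures of the $p$ real diagonal entries and of the $\beta$ real components of each entry above the diagonal. $\Gamma_m^\beta[a]=\pi^{m(m-1)\beta/4}\prod_{i=1}^m\Gamma(a-(i-1)\beta/2)$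 for $a>(m-1)\beta/2$, and $\mathcal{B}_m^\beta[b,a]=\Gamma_m^\beta[a]\Gamma_m^\beta[b]/\Gamma_m^\beta[a+b]$. $\mathbf{T}\sim\mathcal{T}_{m\times n}^\beta(\nu,\mathbf{0},\mathbf{I}_m,\mathbf{I}_n)$ means that $\mathbf{T}\in\mathfrak{F}^{m\times n}$ has density $$\frac{\Gamma_m^\beta[\beta(n+\nu)/2]}{\pi^{mn\beta/2}\,\Gamma_m^\beta[\beta\nu/2]}\;|\mathbf{I}_m+\mathbf{T}\mathbf{T}^{*}|^{-\beta(n+\nu)/2}.$$ The distribution of $\mathbf{F}$ is called the matricvariate beta type II distribution. *)

theory Defs
  imports "HOL-Probability.Probability"
begin

section \<open>The quaternions\<close>

datatype quat = Quat (qRe: real) (qI: real) (qJ: real) (qK: real)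

lemma quat_eq_iff: "x = y \<longleftrightarrow> qRe x = qRe y \<and> qI x = qI y \<and> qJ x = qJ y \<and> qK x = qK y"
  by (cases x; cases y) auto

instantiation quat :: ring_1
begin

definition zero_quat where "0 = Quat 0 0 0 0"
definition one_quat where "1 = Quat 1 0 0 0"
definition plus_quat where
  "x + y = Quat (qRe x + qRe y) (qI x + qI y) (qJ x + qJ y) (qK x + qK y)"
definition uminus_quat where
  "- x = Quat (- qRe x) (- qI x) (- qJ x) (- qK x)"
definition minus_quat where
  "x - y = Quat (qRe x - qRe y) (qI x - qI y) (qJ x - qJ y) (qK x - qK y)"
definition times_quat where
  "x * y = Quat
     (qRe x * qRe y - qI x * qI y - qJ x * qJ y - qK x * qK y)
     (qRe x * qI y + qI x * qRe y + qJ x * qK y - qK x * qJ y)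
     (qRe x * qJ y - qI x * qK y + qJ x * qRe y + qK x * qI y)
     (qRe x * qK y + qI x * qJ y - qJ x * qI y + qK x * qRe y)"

instance
  by standard
    (simp_all add: quat_eq_iff zero_quat_def one_quat_def plus_quat_def uminus_quat_def
      minus_quat_def times_quat_def algebra_simps)

end

lemma quat_sel_simps [simp]:
  "qRe 0 = 0" "qI 0 = 0" "qJ 0 = 0" "qK 0 = 0"
  "qRe 1 = 1" "qI 1 = 0" "qJ 1 = 0" "qK 1 = 0"
  "qRe (x + y) = qRe x + qRe y" "qI (x + y) = qI x + qI y"
  "qJ (x + y) = qJ x + qJ y" "qK (x + y) = qK x + qK y"
  "qRe (- x) = - qRe x" "qI (- x) = - qI x" "qJ (- x) = - qJ x" "qK (- x) = - qK x"
  "qRe (x - y) = qRe x - qRe y" "qI (x - y) = qI x - qI y"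
  "qJ (x - y) = qJ x - qJ y" "qK (x - y) = qK x - qK y"
  "qRe (x * y) = qRe x * qRe y - qI x * qI y - qJ x * qJ y - qK x * qK y"
  "qI (x * y) = qRe x * qI y + qI x * qRe y + qJ x * qK y - qK x * qJ y"
  "qJ (x * y) = qRe x * qJ y - qI x * qK y + qJ x * qRe y + qK x * qI y"
  "qK (x * y) = qRe x * qK y + qI x * qJ y - qJ x * qI y + qK x * qRe y"
  by (simp_all add: zero_quat_def one_quat_def plus_quat_def uminus_quat_def
      minus_quat_def times_quat_def)

instantiation quat :: real_algebra_1
begin

definition scaleR_quat where
  "r *\<^sub>R x = Quat (r * qRe x) (r * qI x) (r * qJ x) (r * qK x)"

instance
  by standard (simp_all add: quat_eq_iff scaleR_quat_def algebra_simps)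

end

lemma quat_sel_scaleR [simp]:
  "qRe (r *\<^sub>R x) = r * qRe x" "qI (r *\<^sub>R x) = r * qI x"
  "qJ (r *\<^sub>R x) = r * qJ x" "qK (r *\<^sub>R x) = r * qK x"
  by (simp_all add: scaleR_quat_def)

instantiation quat :: real_inner
begin

definition inner_quat where
  "inner x y = qRe x * qRe y + qI x * qI y + qJ x * qJ y + qK x * qK y"
definition norm_quat where
  "norm (x :: quat) = sqrt (inner x x)"
definition sgn_quat where
  "sgn (x :: quat) = x /\<^sub>R norm x"
definition dist_quat where
  "dist x y = norm (x - y :: quat)"
definition uniformity_quat where
  "(uniformity :: (quat \<times> quat) filter) = (INF e\<in>{0 <..}. principal {(x, y). dist x y < e})"
definition open_quat where
  "open (U :: quat set) \<longleftrightarrow> (\<forall>x\<in>U. eventually (\<lambda>(x', y). x' = x \<longrightarrow> y \<in> U) uniformity)"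

instance
proof
  fix x :: quat
  show "0 \<le> inner x x"
    by (simp add: inner_quat_def)
  have "a * a + b * b + c * c + d * d = 0 \<longleftrightarrow> a = 0 \<and> b = 0 \<and> c = 0 \<and> d = 0" for a b c d :: real
    by (smt (verit) mult_eq_0_iff zero_le_square)
  then show "inner x x = 0 \<longleftrightarrow> x = 0"
    by (simp add: inner_quat_def quat_eq_iff)
qed (simp_all add: inner_quat_def norm_quat_def sgn_quat_def dist_quat_def
      uniformity_quat_def open_quat_def algebra_simps)

end

instantiation quat :: euclidean_space
begin

definition Basis_quat where
  "Basis = {Quat 1 0 0 0, Quat 0 1 0 0, Quat 0 0 1 0, Quat 0 0 0 1}"

instance
proof
  show "(Basis :: quat set) \<noteq> {}" "finite (Basis :: quat set)"
    by (simp_all add: Basis_quat_def)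
  fix u v x :: quat
  show "inner u v = (if u = v then 1 else 0)" if "u \<in> Basis" "v \<in> Basis"
    using that unfolding Basis_quat_def by (elim insertE emptyE) (simp_all add: inner_quat_def)
  show "(\<forall>u\<in>Basis. inner x u = 0) \<longleftrightarrow> x = 0"
    by (auto simp: Basis_quat_def inner_quat_def quat_eq_iff[of x 0])
qed

end

lemma DIM_quat [simp]: "DIM(quat) = 4"
  by (simp add: Basis_quat_def)

instantiation quat :: real_normed_div_algebra
begin

definition inverse_quat where
  "inverse x = Quat (qRe x) (- qI x) (- qJ x) (- qK x) /\<^sub>R inner x x"
definition divide_quat where
  "x div y = x * inverse (y :: quat)"

instance
proof
  fix x y :: quat
  have left: "inverse x * x = 1" and right: "x * inverse x = 1" if "x \<noteq> 0"
  proof -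
    have "inner x x \<noteq> 0" using that by simp
    moreover have
      "Quat (qRe x) (- qI x) (- qJ x) (- qK x) * x = inner x x *\<^sub>R 1"
      "x * Quat (qRe x) (- qI x) (- qJ x) (- qK x) = inner x x *\<^sub>R 1"
      by (simp_all add: quat_eq_iff inner_quat_def)
    ultimately show "inverse x * x = 1" "x * inverse x = 1"
      by (simp_all add: inverse_quat_def)
  qed
  show "x \<noteq> 0 \<Longrightarrow> inverse x * x = 1" by (fact left)
  show "x \<noteq> 0 \<Longrightarrow> x * inverse x = 1" by (fact right)
  show "inverse (0 :: quat) = 0"
    by (simp add: inverse_quat_def quat_eq_iff)
  show "x div y = x * inverse y" by (fact divide_quat_def)
  have "inner (x * y) (x * y) = inner x x * inner y y"
    unfolding inner_quat_def quat_sel_simps by algebra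
  then show "norm (x * y) = norm x * norm y"
    by (simp add: norm_quat_def real_sqrt_mult)
qed

end


section \<open>Real, complex and quaternion scalars\<close>

text \<open>
  The class only serves to write the definitions below once for the three scalar types;
  \<open>DIM('f)\<close> is the parameter \<open>\<beta>\<close>. Conjugation reverses products, as it must for quaternions.
\<close>

class conj_algebra = real_normed_div_algebra + euclidean_space +
  fixes hconj :: "'a \<Rightarrow> 'a"
  assumes hconj_add: "hconj (x + y) = hconj x + hconj y"
    and hconj_scaleR: "hconj (r *\<^sub>R x) = r *\<^sub>R hconj x"
    and hconj_mult: "hconj (x * y) = hconj y * hconj x"
    and hconj_hconj: "hconj (hconj x) = x"
    and mult_hconj: "x * hconj x = inner x x *\<^sub>R 1"

instantiation real :: conj_algebra
begin

definition hconj_real where "hconj (x :: real) = x"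

instance
  by standard (simp_all add: hconj_real_def)

end

instantiation complex :: conj_algebra
begin

definition hconj_complex where "hconj (x :: complex) = cnj x"

instance
  by standard (simp_all add: hconj_complex_def complex_eq_iff inner_complex_def)

end

instantiation quat :: conj_algebra
begin

definition hconj_quat where "hconj x = Quat (qRe x) (- qI x) (- qJ x) (- qK x)"

instance
  by standard
    (simp_all add: hconj_quat_def quat_eq_iff inner_quat_def of_real_def algebra_simps)

end


section \<open>Hermitian matrices\<close>

definition adj :: "'f::conj_algebra^'n^'m \<Rightarrow> 'f^'m^'n" where
  "adj A = (\<chi> i j. hconj (A $ j $ i))"

definition pos_def :: "('f::conj_algebra^'m^'m) set" where
  "pos_def = {A. adj A = A \<and>
     (\<forall>x. x \<noteq> 0 \<longrightarrow> (\<exists>r>0. (\<Sum>i\<in>UNIV. hconj (x $ i) * (A *v x) $ i) = of_real r))}"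

text \<open>
  All (right) eigenvalues of a Hermitian matrix are real, and its eigenspaces are right vector
  spaces over the scalars. The multiplicity of an eigenvalue is the dimension of the eigenspace
  over the scalars, i.e. its real dimension divided by \<open>DIM('f)\<close>.
\<close>

definition eigspace :: "'f::conj_algebra^'m^'m \<Rightarrow> real \<Rightarrow> ('f^'m) set" where
  "eigspace A l = {v. A *v v = l *\<^sub>R v}"

definition eigmult :: "'f::conj_algebra^'m^'m \<Rightarrow> real \<Rightarrow> nat" where
  "eigmult A l = dim (eigspace A l) div DIM('f)"

text \<open>
  The product of the eigenvalues of a Hermitian matrix, with multiplicity. It is meaningful for
  Hermitian matrices only.
\<close>

definition hdet :: "'f::conj_algebra^'m^'m \<Rightarrow> real" where
  "hdet A = (\<Prod>l\<in>{l. \<exists>v. v \<noteq> 0 \<and> v \<in> eigspace A l}. l ^ eigmult A l)"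

text \<open>
  Lebesgue measure on the Hermitian matrices, seen as a measure on all square matrices: the image
  of the product of the Lebesgue measures of the diagonal entries (in \<open>real\<close>) and of the entries
  above the diagonal (in \<open>'f\<close>).
\<close>

definition herm_of :: "('m \<Rightarrow> real) \<times> ('m \<times> 'm \<Rightarrow> 'f) \<Rightarrow> 'f::conj_algebra^'m::{finite,linorder}^'m::{finite,linorder}" where
  "herm_of = (\<lambda>(d, u). \<chi> i j. if i = j then of_real (d i)
     else if i < j then u (i, j) else hconj (u (j, i)))"

definition lborel_herm :: "('f::conj_algebra^'m::{finite,linorder}^'m::{finite,linorder}) measure" where
  "lborel_herm = distr
     ((\<Pi>\<^sub>M i\<in>(UNIV :: 'm set). (lborel :: real measure)) \<Otimes>\<^sub>M
      (\<Pi>\<^sub>M p\<in>{(i, j). i < (j :: 'm)}. (lborel :: 'f measure)))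
     borel herm_of"

lemma borel_measurable_vec_componentwise:
  fixes f :: "'a \<Rightarrow> 'b::euclidean_space^'n"
  assumes "\<And>i. (\<lambda>x. f x $ i) \<in> borel_measurable M"
  shows "f \<in> borel_measurable M"
proof (subst borel_measurable_euclidean_space, safe)
  fix b :: "'b^'n" assume "b \<in> Basis"
  then obtain i u where b: "b = axis i u" by (auto simp: Basis_vec_def)
  show "(\<lambda>x. f x \<bullet> b) \<in> borel_measurable M"
    using assms[of i] by (simp add: b inner_axis)
qed

lemma borel_measurable_hconj [measurable]: "(hconj :: 'f::conj_algebra \<Rightarrow> 'f) \<in> borel_measurable borel"
proof -
  have "linear (hconj :: 'f \<Rightarrow> 'f)"
    by (rule linearI) (simp_all add: hconj_add hconj_scaleR)
  then show ?thesis
    by (metis borel_measurable_continuous_onI linear_continuous_on linear_conv_bounded_linear)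
qed

text \<open>
  If \<open>herm_of\<close> were not measurable, \<open>distr\<close> in \<open>lborel_herm\<close> would degenerate to the null measure.
\<close>

lemma measurable_herm_of [measurable]:
  "(herm_of :: _ \<Rightarrow> 'f::conj_algebra^'m::{finite,linorder}^'m::{finite,linorder}) \<in> borel_measurable
     ((\<Pi>\<^sub>M i\<in>(UNIV :: 'm set). (lborel :: real measure)) \<Otimes>\<^sub>M
      (\<Pi>\<^sub>M p\<in>{(i, j). i < (j :: 'm)}. (lborel :: 'f measure)))"
proof (intro borel_measurable_vec_componentwise)
  fix i j :: 'm
  let ?M = "(\<Pi>\<^sub>M i\<in>(UNIV :: 'm set). (lborel :: real measure)) \<Otimes>\<^sub>M
      (\<Pi>\<^sub>M p\<in>{(i, j). i < (j :: 'm)}. (lborel :: 'f measure))"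
  have d: "(\<lambda>x. fst x i) \<in> borel_measurable ?M"
    by measurable
  have u: "(\<lambda>x. snd x (k, l)) \<in> borel_measurable ?M" if "k < l" for k l :: 'm
  proof -
    have "(\<lambda>y. y (k, l)) \<in> (\<Pi>\<^sub>M p\<in>{(i, j). i < (j :: 'm)}. (lborel :: 'f measure)) \<rightarrow>\<^sub>M lborel"
      by (rule measurable_component_singleton) (simp add: that)
    from measurable_compose[OF measurable_snd this] show ?thesis by simp
  qed
  consider "i = j" | "i < j" | "j < i" by (rule linorder_cases[of i j]) auto
  then show "(\<lambda>x. (herm_of x :: 'f^'m::{finite,linorder}^'m::{finite,linorder}) $ i $ j) \<in> borel_measurable ?M"
  proof cases
    case 1
    then show ?thesis
      using d by (simp add: herm_of_def case_prod_beta of_real_def)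
  next
    case 2
    then have "(\<lambda>x. (herm_of x :: 'f^'m::{finite,linorder}^'m::{finite,linorder}) $ i $ j) = (\<lambda>x. snd x (i, j))"
      by (auto simp: herm_of_def case_prod_beta)
    then show ?thesis
      using u[OF 2] by simp
  next
    case 3
    then have "i \<noteq> j" "\<not> i < j" by auto
    then have "(\<lambda>x. (herm_of x :: 'f^'m::{finite,linorder}^'m::{finite,linorder}) $ i $ j) = (\<lambda>x. hconj (snd x (j, i)))"
      by (simp add: herm_of_def case_prod_beta)
    then show ?thesis
      using measurable_compose[OF u[OF 3] borel_measurable_hconj] by simp
  qed
qed


section \<open>The distributions\<close>

definition mv_gamma :: "real \<Rightarrow> nat \<Rightarrow> real \<Rightarrow> real" where
  "mv_gamma \<beta> m a = pi powr (real m * (real m - 1) * \<beta> / 4) *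
     (\<Prod>i=1..m. Gamma (a - (real i - 1) * \<beta> / 2))"

definition mv_beta :: "real \<Rightarrow> nat \<Rightarrow> real \<Rightarrow> real \<Rightarrow> real" where
  "mv_beta \<beta> m b a = mv_gamma \<beta> m a * mv_gamma \<beta> m b / mv_gamma \<beta> m (a + b)"

definition mv_t_density :: "real \<Rightarrow> 'f::conj_algebra^'n^'m \<Rightarrow> real" where
  "mv_t_density \<nu> T = (let \<beta> = real DIM('f); m = CARD('m); n = CARD('n) in
     mv_gamma \<beta> m (\<beta> * (real n + \<nu>) / 2) /
       (pi powr (real m * real n * \<beta> / 2) * mv_gamma \<beta> m (\<beta> * \<nu> / 2)) *
     hdet (mat 1 + T ** adj T) powr (- \<beta> * (real n + \<nu>) / 2))"

definition mv_t_distributed :: "'a measure \<Rightarrow> real \<Rightarrow> ('a \<Rightarrow> 'f::conj_algebra^'n^'m) \<Rightarrow> bool" where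
  "mv_t_distributed M \<nu> T \<longleftrightarrow> distributed M lborel T (\<lambda>t. ennreal (mv_t_density \<nu> t))"

text \<open>
  Densities on the cone are extended by \<open>0\<close> to all matrices.
\<close>

definition mv_beta2_density :: "nat \<Rightarrow> real \<Rightarrow> 'f::conj_algebra^'m^'m \<Rightarrow> real" where
  "mv_beta2_density n \<nu> F = (let \<beta> = real DIM('f); m = CARD('m) in
     if F \<in> pos_def then
       1 / mv_beta \<beta> m (\<beta> * \<nu> / 2) (\<beta> * real n / 2) *
         hdet F powr (\<beta> * (real n - real m + 1) / 2 - 1) *
         hdet (mat 1 + F) powr (- \<beta> * (real n + \<nu>) / 2)
     else 0)"

end

theory Submission
  imports Defs "HOL-Real_Asymp.Real_Asymp"
begin

text \<open>
  The heart of the matter is the image of Lebesgue measure on the \<open>m \<times> n\<close> matrices under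
  \<open>T \<mapsto> T T*\<close>; it has density \<open>c |F|^(\<beta>(n-m+1)/2-1)\<close>, and the theorem follows because the density
  of \<open>T\<close> is a function of \<open>T T*\<close>. This is proved by induction on the set of rows. A rotation of the
  columns turns the new row \<open>v\<close> into \<open>|v| e\<^sub>j\<close>. If \<open>a\<close> is column \<open>j\<close> of the remaining rows and
  \<open>T'\<close> is the rest, then \<open>T T*\<close> consists of \<open>\<rho> = |v|^2\<close>, the vector \<open>b = |v| a\<close> and the block
  \<open>T' T'* + b b* / \<rho>\<close>. The induction hypothesis for \<open>T'\<close>, a scaling in \<open>a\<close>, a translation in the
  block and \<open>|F| = \<rho> |T' T'*|\<close> (a Schur complement) give the density; all powers of \<open>\<rho>\<close> cancel.

  Determinants are never expanded: \<open>|A|^\<beta>\<close> is the factor by which the real-linear map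
  \<open>x \<mapsto> A x\<close> scales Lebesgue measure, which also covers the quaternions.
\<close>

section \<open>Lebesgue measure on coordinate subspaces\<close>

text \<open>Types of matrices cannot shrink along the induction, so it runs over sets
  \<open>S\<close> of rows and \<open>J\<close> of columns: matrices keep their full size and vanish
  outside \<open>S\<close> and \<open>J\<close>. Integration therefore takes place on subspaces,
  against \<open>lspan B\<close>, which depends on the coordinate vectors \<open>B\<close> and not
  only on their span. This is how it can match \<open>lborel_herm\<close>, whose coordinate vectors
  are not orthonormal. Jacobians reduce to translations, scalings, shears and exchange of
  orthonormal bases; the last comes from the uniqueness of translation invariant measures,
  normalised by the unit ball.

  \<open>hdet\<close> is defined by eigenvalues, which behave badly under products of matrices. As
  the volume factor determines \<open>hdet\<close> on the cone, a factorisation of the linear map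
  into shears and scalings is enough to evaluate it.

  Each row contributes \<open>pi powr (d/2) / Gamma (d/2)\<close>, where \<open>d\<close> is the
  real dimension of a row on the columns still present. The product over d = \<beta> n, \<beta>
  (n-1), ... is a power of pi divided by \<open>mv_gamma\<close> at \<beta> n / 2, and it turns the
  constant of the t density into the reciprocal of \<open>mv_beta\<close>.\<close>

definition lspan :: "'a::euclidean_space set \<Rightarrow> 'a measure" where
  "lspan B = distr (\<Pi>\<^sub>M b\<in>B. lborel) borel (\<lambda>f. \<Sum>b\<in>B. f b *\<^sub>R b)"

lemma sets_lspan [simp, measurable_cong]: "sets (lspan B) = sets borel"
  and space_lspan [simp]: "space (lspan B) = UNIV"
  by (simp_all add: lspan_def)

lemma lspan_Basis: "lspan Basis = lborel"
  unfolding lspan_def by (rule lborel_eq[symmetric])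

interpretation lborels: product_sigma_finite "\<lambda>_. lborel :: real measure"
  by standard

lemma measurable_lspan_comb [measurable]:
  "(\<lambda>f. \<Sum>b\<in>B. f b *\<^sub>R (b :: 'a::euclidean_space)) \<in> borel_measurable (\<Pi>\<^sub>M b\<in>B. (lborel :: real measure))"
proof (rule borel_measurable_sum)
  fix b assume "b \<in> B"
  then have "(\<lambda>f. f b) \<in> (\<Pi>\<^sub>M b\<in>B. (lborel :: real measure)) \<rightarrow>\<^sub>M lborel"
    by (rule measurable_component_singleton)
  then have "(\<lambda>f. f b) \<in> borel_measurable (\<Pi>\<^sub>M b\<in>B. (lborel :: real measure))"
    by simp
  then show "(\<lambda>f. f b *\<^sub>R b) \<in> borel_measurable (\<Pi>\<^sub>M b\<in>B. (lborel :: real measure))"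
    by (rule borel_measurable_scaleR) simp
qed

lemma nn_integral_lspan:
  assumes "h \<in> borel_measurable borel"
  shows "(\<integral>\<^sup>+x. h x \<partial>lspan B) = (\<integral>\<^sup>+f. h (\<Sum>b\<in>B. f b *\<^sub>R b) \<partial>(\<Pi>\<^sub>M b\<in>B. lborel))"
  unfolding lspan_def by (rule nn_integral_distr) (use assms in measurable)

text \<open>\<open>lspan B\<close> is carried by \<open>span B\<close>. The support conditions on
  matrices (vanishing rows, columns or blocks) enter later integrals through this rule.\<close>

lemma nn_integral_lspan_cong:
  assumes "f \<in> borel_measurable borel" "g \<in> borel_measurable borel" "\<And>x. x \<in> span B \<Longrightarrow> f x = g x"
  shows "(\<integral>\<^sup>+x. f x \<partial>lspan B) = (\<integral>\<^sup>+x. g x \<partial>lspan B)"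
  unfolding nn_integral_lspan[OF assms(1)] nn_integral_lspan[OF assms(2)]
  by (intro nn_integral_cong assms(3) span_sum span_scale span_base)

lemma borel_measurable_nn_integral_lspan [measurable (raw)]:
  assumes "finite B" and [measurable]: "case_prod h \<in> borel_measurable (N \<Otimes>\<^sub>M borel)"
  shows "(\<lambda>z. \<integral>\<^sup>+y. h z y \<partial>lspan B) \<in> borel_measurable N"
proof -
  interpret finite_product_sigma_finite "\<lambda>_. lborel :: real measure" B by standard fact
  have "(\<lambda>z. \<integral>\<^sup>+y. h z y \<partial>lspan B) \<in> borel_measurable N
      \<longleftrightarrow> (\<lambda>z. \<integral>\<^sup>+f. h z (\<Sum>b\<in>B. f b *\<^sub>R b) \<partial>(\<Pi>\<^sub>M b\<in>B. lborel)) \<in> borel_measurable N"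
    by (intro measurable_cong nn_integral_lspan) simp
  also have "\<dots>"
    by measurable
  finally show ?thesis .
qed

lemma nn_integral_lspan_swap:
  assumes fin: "finite A" "finite B"
    and [measurable]: "case_prod h \<in> borel_measurable (borel \<Otimes>\<^sub>M borel)"
  shows "(\<integral>\<^sup>+x. \<integral>\<^sup>+y. h x y \<partial>lspan B \<partial>lspan A) = (\<integral>\<^sup>+y. \<integral>\<^sup>+x. h x y \<partial>lspan A \<partial>lspan B)"
proof -
  interpret A: finite_product_sigma_finite "\<lambda>_. lborel :: real measure" A by standard fact
  interpret B: finite_product_sigma_finite "\<lambda>_. lborel :: real measure" B by standard fact
  interpret pair_sigma_finite "\<Pi>\<^sub>M b\<in>A. lborel :: real measure" "\<Pi>\<^sub>M b\<in>B. lborel :: real measure"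
    by standard
  note [measurable] = fin
  have "(\<integral>\<^sup>+x. \<integral>\<^sup>+y. h x y \<partial>lspan B \<partial>lspan A) = (\<integral>\<^sup>+f. \<integral>\<^sup>+g. h (\<Sum>b\<in>A. f b *\<^sub>R b) (\<Sum>b\<in>B. g b *\<^sub>R b)
     \<partial>(\<Pi>\<^sub>M b\<in>B. lborel) \<partial>(\<Pi>\<^sub>M b\<in>A. lborel))"
    by (subst nn_integral_lspan) (simp_all add: nn_integral_lspan fin)
  also have "\<dots> = (\<integral>\<^sup>+g. \<integral>\<^sup>+f. h (\<Sum>b\<in>A. f b *\<^sub>R b) (\<Sum>b\<in>B. g b *\<^sub>R b)
     \<partial>(\<Pi>\<^sub>M b\<in>A. lborel) \<partial>(\<Pi>\<^sub>M b\<in>B. lborel))"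
    by (rule Fubini'[symmetric]) measurable
  also have "\<dots> = (\<integral>\<^sup>+y. \<integral>\<^sup>+x. h x y \<partial>lspan A \<partial>lspan B)"
    by (subst (2) nn_integral_lspan) (simp_all add: nn_integral_lspan fin)
  finally show ?thesis .
qed

lemma nn_integral_lspan_Un:
  assumes fin: "finite A" "finite B" and disj: "A \<inter> B = {}"
    and [measurable]: "h \<in> borel_measurable borel"
  shows "(\<integral>\<^sup>+x. h x \<partial>lspan (A \<union> B)) = (\<integral>\<^sup>+x. \<integral>\<^sup>+y. h (x + y) \<partial>lspan B \<partial>lspan A)"
proof -
  have "(\<integral>\<^sup>+x. h x \<partial>lspan (A \<union> B)) = (\<integral>\<^sup>+x. \<integral>\<^sup>+y. h (\<Sum>b\<in>A \<union> B. merge A B (x, y) b *\<^sub>R b)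
      \<partial>(\<Pi>\<^sub>M b\<in>B. lborel) \<partial>(\<Pi>\<^sub>M b\<in>A. lborel))"
    by (subst nn_integral_lspan) (simp_all add: lborels.product_nn_integral_fold fin disj)
  also have "\<dots> = (\<integral>\<^sup>+f. \<integral>\<^sup>+g. h ((\<Sum>b\<in>A. f b *\<^sub>R b) + (\<Sum>b\<in>B. g b *\<^sub>R b))
     \<partial>(\<Pi>\<^sub>M b\<in>B. lborel) \<partial>(\<Pi>\<^sub>M b\<in>A. lborel))"
    by (simp add: sum.union_disjoint fin disj)
  also have "\<dots> = (\<integral>\<^sup>+f. \<integral>\<^sup>+y. h ((\<Sum>b\<in>A. f b *\<^sub>R b) + y) \<partial>lspan B \<partial>(\<Pi>\<^sub>M b\<in>A. lborel))"
    by (simp add: nn_integral_lspan)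
  also have "\<dots> = (\<integral>\<^sup>+x. \<integral>\<^sup>+y. h (x + y) \<partial>lspan B \<partial>lspan A)"
    using fin by (intro nn_integral_lspan[symmetric]) measurable
  finally show ?thesis .
qed

lemma nn_integral_lspan_empty:
  assumes "h \<in> borel_measurable borel"
  shows "(\<integral>\<^sup>+x. h x \<partial>lspan {}) = h 0"
  unfolding nn_integral_lspan[OF assms] by (simp add: PiM_empty)

lemma nn_integral_lspan_singleton:
  assumes "h \<in> borel_measurable borel"
  shows "(\<integral>\<^sup>+x. h x \<partial>lspan {b}) = (\<integral>\<^sup>+r. h (r *\<^sub>R b) \<partial>lborel)"
  unfolding nn_integral_lspan[OF assms] using assms
  by (simp add: lborels.product_nn_integral_singleton[where f="\<lambda>r. h (r *\<^sub>R b)"])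

lemma nn_integral_lspan_insert:
  assumes "finite B" "b \<notin> B" and [measurable]: "h \<in> borel_measurable borel"
  shows "(\<integral>\<^sup>+x. h x \<partial>lspan (insert b B)) = (\<integral>\<^sup>+r. \<integral>\<^sup>+x. h (r *\<^sub>R b + x) \<partial>lspan B \<partial>lborel)"
  using nn_integral_lspan_Un[of "{b}" B h] assms
  by (simp add: nn_integral_lspan_singleton borel_measurable_nn_integral_lspan)

lemma borel_measurable_linear:
  fixes f :: "'a::euclidean_space \<Rightarrow> 'b::euclidean_space"
  shows "linear f \<Longrightarrow> f \<in> borel_measurable borel"
  by (simp add: borel_measurable_continuous_onI linear_continuous_on linear_conv_bounded_linear)

lemma nn_integral_lspan_image:
  fixes f :: "'a::euclidean_space \<Rightarrow> 'b::euclidean_space"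
  assumes "finite B" "linear f" "inj_on f B" and "h \<in> borel_measurable borel"
  shows "(\<integral>\<^sup>+x. h x \<partial>lspan (f ` B)) = (\<integral>\<^sup>+x. h (f x) \<partial>lspan B)"
  using assms(1,3,4)
proof (induction B arbitrary: h)
  case empty
  then show ?case using borel_measurable_linear[OF \<open>linear f\<close>]
    by (simp add: nn_integral_lspan_empty linear_0[OF \<open>linear f\<close>])
next
  case (insert b B)
  note [measurable] = insert.prems(2) borel_measurable_linear[OF \<open>linear f\<close>]
  have "(\<integral>\<^sup>+x. h x \<partial>lspan (f ` insert b B)) = (\<integral>\<^sup>+r. \<integral>\<^sup>+x. h (r *\<^sub>R f b + x) \<partial>lspan (f ` B) \<partial>lborel)"
    using insert by (simp add: nn_integral_lspan_insert)
  also have "\<dots> = (\<integral>\<^sup>+r. \<integral>\<^sup>+x. h (r *\<^sub>R f b + f x) \<partial>lspan B \<partial>lborel)"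
    using insert by (subst insert.IH) auto
  also have "\<dots> = (\<integral>\<^sup>+x. h (f x) \<partial>lspan (insert b B))"
    using insert by (simp add: nn_integral_lspan_insert linear_add[OF \<open>linear f\<close>] linear_scale[OF \<open>linear f\<close>])
  finally show ?case .
qed

lemma nn_integral_lspan_translate:
  assumes "finite B" "v \<in> span B" and "h \<in> borel_measurable borel"
  shows "(\<integral>\<^sup>+x. h (x + v) \<partial>lspan B) = (\<integral>\<^sup>+x. h x \<partial>lspan B)"
  using assms
proof (induction B arbitrary: h v)
  case empty
  then show ?case by simp
next
  case (insert b B)
  note [measurable] = insert.prems(2)
  from insert.prems(1) obtain c where c: "v - c *\<^sub>R b \<in> span B"
    by (auto simp: span_breakdown_eq)
  define w where "w = v - c *\<^sub>R b"
  have v: "v = c *\<^sub>R b + w" by (simp add: w_def)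
  have "(\<integral>\<^sup>+x. h (x + v) \<partial>lspan (insert b B)) =
     (\<integral>\<^sup>+r. \<integral>\<^sup>+x. h (((c + r) *\<^sub>R b + x) + w) \<partial>lspan B \<partial>lborel)"
    using insert by (simp add: nn_integral_lspan_insert v algebra_simps)
  also have "\<dots> = (\<integral>\<^sup>+r. \<integral>\<^sup>+x. h ((c + r) *\<^sub>R b + x) \<partial>lspan B \<partial>lborel)"
    using insert.IH[of w "\<lambda>x. h ((c + r) *\<^sub>R b + x)" for r] c by (simp add: w_def add.assoc)
  also have "\<dots> = (\<integral>\<^sup>+r. \<integral>\<^sup>+x. h (r *\<^sub>R b + x) \<partial>lspan B \<partial>lborel)"
    using nn_integral_real_affine[of "\<lambda>r. \<integral>\<^sup>+x. h (r *\<^sub>R b + x) \<partial>lspan B" 1 c] insert.hyps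
    by (simp add: borel_measurable_nn_integral_lspan)
  also have "\<dots> = (\<integral>\<^sup>+x. h x \<partial>lspan (insert b B))"
    using insert by (simp add: nn_integral_lspan_insert)
  finally show ?case .
qed

text \<open>The free summand \<open>z\<close> makes the induction over \<open>B\<close> work.\<close>

lemma nn_integral_lspan_diag_aux:
  assumes "finite B" "linear f" and "\<And>b. b \<in> B \<Longrightarrow> l b > 0 \<and> f b = l b *\<^sub>R b"
    and "h \<in> borel_measurable borel"
  shows "ennreal (\<Prod>b\<in>B. l b) * (\<integral>\<^sup>+x. h (f x + z) \<partial>lspan B) = (\<integral>\<^sup>+x. h (x + z) \<partial>lspan B)"
  using assms(1,3,4)
proof (induction B arbitrary: h z)
  case empty
  then show ?case using borel_measurable_linear[OF \<open>linear f\<close>]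
    by (simp add: nn_integral_lspan_empty linear_0[OF \<open>linear f\<close>])
next
  case (insert b B)
  note [measurable] = insert.prems(2) borel_measurable_linear[OF \<open>linear f\<close>]
  have l: "l b > 0" "f b = l b *\<^sub>R b" "\<And>b. b \<in> B \<Longrightarrow> l b > 0" using insert.prems by auto
  note [measurable] = insert.hyps(1)
  have "ennreal (\<Prod>b\<in>insert b B. l b) * (\<integral>\<^sup>+x. h (f x + z) \<partial>lspan (insert b B)) =
     ennreal (l b) * (\<integral>\<^sup>+r. ennreal (\<Prod>b\<in>B. l b) * (\<integral>\<^sup>+x. h (f x + (((l b * r) *\<^sub>R b) + z)) \<partial>lspan B) \<partial>lborel)"
    using insert.hyps l by (simp add: nn_integral_lspan_insert linear_add[OF \<open>linear f\<close>] linear_scale[OF \<open>linear f\<close>]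
      ennreal_mult prod_nonneg less_imp_le nn_integral_cmult algebra_simps)
  also have "\<dots> = ennreal (l b) * (\<integral>\<^sup>+r. \<integral>\<^sup>+x. h (x + (((l b * r) *\<^sub>R b) + z)) \<partial>lspan B \<partial>lborel)"
    using insert.prems by (subst insert.IH) auto
  also have "\<dots> = (\<integral>\<^sup>+r. \<integral>\<^sup>+x. h (x + ((r *\<^sub>R b) + z)) \<partial>lspan B \<partial>lborel)"
    using nn_integral_real_affine[of "\<lambda>r. \<integral>\<^sup>+x. h (x + ((r *\<^sub>R b) + z)) \<partial>lspan B" "l b" 0] l
    by simp
  also have "\<dots> = (\<integral>\<^sup>+x. h (x + z) \<partial>lspan (insert b B))"
    using insert.hyps by (simp add: nn_integral_lspan_insert algebra_simps)
  finally show ?case .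
qed

lemma nn_integral_lspan_diag:
  assumes "finite B" "linear f" and "\<And>b. b \<in> B \<Longrightarrow> l b > 0 \<and> f b = l b *\<^sub>R b"
    and "h \<in> borel_measurable borel"
  shows "ennreal (\<Prod>b\<in>B. l b) * (\<integral>\<^sup>+x. h (f x) \<partial>lspan B) = (\<integral>\<^sup>+x. h x \<partial>lspan B)"
  using nn_integral_lspan_diag_aux[OF assms, of 0] by simp

lemma nn_integral_lspan_scaleR:
  fixes B :: "'a::euclidean_space set"
  assumes "finite B" "c > 0" and "h \<in> borel_measurable borel"
  shows "ennreal (c ^ card B) * (\<integral>\<^sup>+x. h (c *\<^sub>R x) \<partial>lspan B) = (\<integral>\<^sup>+x. h x \<partial>lspan B)"
proof -
  have "linear (\<lambda>x::'a. c *\<^sub>R x)"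
    by (rule linearI) (simp_all add: algebra_simps)
  from nn_integral_lspan_diag[OF assms(1) this, of "\<lambda>_. c" h] assms show ?thesis
    by simp
qed

text \<open>The classical proof that a Haar measure is unique up to a factor. Both measures are
  invariant under the common span; Fubini alternates with translations by the variable that is held
  fixed until \<open>h\<close> and \<open>g\<close> have changed places. The reflection in
  \<open>h (- x)\<close> is what remains of \<open>h (x - y)\<close> after \<open>y\<close> is
  translated by \<open>x\<close>.\<close>

lemma nn_integral_lspan_unique:
  assumes fin: "finite A" "finite B" and span: "span A = span B"
    and [measurable]: "h \<in> borel_measurable borel" "g \<in> borel_measurable borel"
  shows "(\<integral>\<^sup>+x. h x \<partial>lspan A) * (\<integral>\<^sup>+x. g x \<partial>lspan B) = (\<integral>\<^sup>+x. h (- x) \<partial>lspan B) * (\<integral>\<^sup>+x. g x \<partial>lspan A)"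
proof -
  note [measurable] = fin
  have "(\<integral>\<^sup>+x. h x \<partial>lspan A) * (\<integral>\<^sup>+x. g x \<partial>lspan B) = (\<integral>\<^sup>+x. h x * (\<integral>\<^sup>+y. g y \<partial>lspan B) \<partial>lspan A)"
    by (simp add: nn_integral_multc)
  also have "\<dots> = (\<integral>\<^sup>+x. h x * (\<integral>\<^sup>+y. g (y + x) \<partial>lspan B) \<partial>lspan A)"
    by (rule nn_integral_lspan_cong) (measurable, simp add: nn_integral_lspan_translate fin span)
  also have "\<dots> = (\<integral>\<^sup>+x. \<integral>\<^sup>+y. h x * g (y + x) \<partial>lspan B \<partial>lspan A)"
    by (simp add: nn_integral_cmult)
  also have "\<dots> = (\<integral>\<^sup>+y. \<integral>\<^sup>+x. h x * g (y + x) \<partial>lspan A \<partial>lspan B)"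
    by (rule nn_integral_lspan_swap) (use fin in measurable)
  also have "\<dots> = (\<integral>\<^sup>+y. \<integral>\<^sup>+x. h (x - y) * g x \<partial>lspan A \<partial>lspan B)"
  proof (rule nn_integral_lspan_cong)
    fix y assume "y \<in> span B"
    then show "(\<integral>\<^sup>+x. h x * g (y + x) \<partial>lspan A) = (\<integral>\<^sup>+x. h (x - y) * g x \<partial>lspan A)"
      using nn_integral_lspan_translate[of A y "\<lambda>x. h (x - y) * g x"] by (simp add: span fin add.commute)
  qed measurable
  also have "\<dots> = (\<integral>\<^sup>+x. \<integral>\<^sup>+y. h (x - y) * g x \<partial>lspan B \<partial>lspan A)"
    by (rule nn_integral_lspan_swap) (use fin in measurable)
  also have "\<dots> = (\<integral>\<^sup>+x. \<integral>\<^sup>+y. h (- y) * g x \<partial>lspan B \<partial>lspan A)"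
  proof (rule nn_integral_lspan_cong)
    fix x assume "x \<in> span A"
    then show "(\<integral>\<^sup>+y. h (x - y) * g x \<partial>lspan B) = (\<integral>\<^sup>+y. h (- y) * g x \<partial>lspan B)"
      using nn_integral_lspan_translate[of B x "\<lambda>y. h (x - y) * g x"] by (simp add: span fin)
  qed measurable
  also have "\<dots> = (\<integral>\<^sup>+x. h (- x) \<partial>lspan B) * (\<integral>\<^sup>+x. g x \<partial>lspan A)"
    by (simp add: nn_integral_multc nn_integral_cmult)
  finally show ?thesis .
qed

section \<open>Orthonormal coordinates, isometries and the law of the squared norm\<close>

definition orthonormal :: "'a::euclidean_space set \<Rightarrow> bool" where
  "orthonormal B \<longleftrightarrow> finite B \<and> (\<forall>a\<in>B. \<forall>b\<in>B. a \<bullet> b = (if a = b then 1 else 0))"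

lemma orthonormal_finite [simp]: "orthonormal B \<Longrightarrow> finite B"
  by (simp add: orthonormal_def)

lemma orthonormalD: "orthonormal B \<Longrightarrow> a \<in> B \<Longrightarrow> b \<in> B \<Longrightarrow> a \<bullet> b = (if a = b then 1 else 0)"
  unfolding orthonormal_def by blast

lemma orthonormal_inner_sum:
  assumes "orthonormal B" "b \<in> B"
  shows "(\<Sum>a\<in>B. f a *\<^sub>R a) \<bullet> b = f b"
proof -
  have "(\<Sum>a\<in>B. f a *\<^sub>R a) \<bullet> b = (\<Sum>a\<in>B. if a = b then f a else 0)"
    unfolding inner_sum_left by (intro sum.cong) (simp_all add: orthonormalD[OF assms(1) _ assms(2)])
  then show ?thesis using assms by simp
qed

lemma orthonormal_norm_sum:
  assumes "orthonormal B"
  shows "norm (\<Sum>a\<in>B. f a *\<^sub>R a) = sqrt (\<Sum>a\<in>B. (f a)\<^sup>2)"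
  by (simp add: norm_eq_sqrt_inner inner_sum_right orthonormal_inner_sum[OF assms] power2_eq_square)

lemma orthonormal_independent:
  assumes "orthonormal B"
  shows "independent B"
proof (rule pairwise_orthogonal_independent)
  show "pairwise orthogonal B" "0 \<notin> B"
    using assms unfolding orthonormal_def pairwise_def orthogonal_def by (metis, metis inner_zero_left zero_neq_one)
qed

lemma orthonormal_expand:
  assumes "orthonormal B" "x \<in> span B"
  shows "x = (\<Sum>b\<in>B. (x \<bullet> b) *\<^sub>R b)"
proof -
  obtain u where u: "x = (\<Sum>b\<in>B. u b *\<^sub>R b)"
    using assms by (auto simp: span_finite)
  then have "(\<Sum>b\<in>B. (x \<bullet> b) *\<^sub>R b) = (\<Sum>b\<in>B. u b *\<^sub>R b)"
    by (intro sum.cong) (simp_all add: orthonormal_inner_sum[OF assms(1)])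
  then show ?thesis using u by simp
qed

lemma emeasure_lspan_cball:
  fixes B :: "'a::euclidean_space set"
  assumes "orthonormal B" "r > 0"
  shows "emeasure (lspan B) (cball 0 r) = ennreal (unit_ball_vol (card B) * r ^ card B)"
proof -
  have "emeasure (lspan B) (cball 0 r) =
    emeasure (Pi\<^sub>M B (\<lambda>_. lborel)) ({f. sqrt (\<Sum>i\<in>B. (f i)\<^sup>2) \<le> r} \<inter> space (Pi\<^sub>M B (\<lambda>_. lborel)))"
    unfolding lspan_def
    by (subst emeasure_distr)
      (simp_all add: vimage_def orthonormal_norm_sum[OF assms(1)] dist_norm)
  then show ?thesis
    using emeasure_cball_aux[of B r] assms by simp
qed

text \<open>By uniqueness the two measures are proportional. The unit ball, which is symmetric under
  reflection, has the same finite nonzero volume in all orthonormal coordinates of a given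
  dimension, so the factor is 1.\<close>

lemma nn_integral_lspan_orthonormal:
  assumes on: "orthonormal A" "orthonormal B" and span: "span A = span B"
    and g [measurable]: "g \<in> borel_measurable borel"
  shows "(\<integral>\<^sup>+x. g x \<partial>lspan A) = (\<integral>\<^sup>+x. g x \<partial>lspan B)"
proof -
  have card: "card A = card B"
    using on[THEN orthonormal_independent] span by (metis dim_eq_card)
  define c where "c = ennreal (unit_ball_vol (card B))"
  have c: "(\<integral>\<^sup>+x. indicator (cball 0 1) x \<partial>lspan A) = c" "(\<integral>\<^sup>+x. indicator (cball 0 1) (- x) \<partial>lspan B) = c"
  proof -
    have "indicator (cball 0 1) (- x) = (indicator (cball 0 1) x :: ennreal)" for x :: 'a
      by (simp add: indicator_def)
    then show "(\<integral>\<^sup>+x. indicator (cball 0 1) x \<partial>lspan A) = c" "(\<integral>\<^sup>+x. indicator (cball 0 1) (- x) \<partial>lspan B) = c"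
      using emeasure_lspan_cball[OF on(1), of 1] emeasure_lspan_cball[OF on(2), of 1]
      by (simp_all add: c_def card)
  qed
  have "c * (\<integral>\<^sup>+x. g x \<partial>lspan B) = c * (\<integral>\<^sup>+x. g x \<partial>lspan A)"
    using nn_integral_lspan_unique[of A B "indicator (cball 0 1)" g] on span unfolding c
    by (simp add: borel_measurable_indicator)
  moreover have "c \<noteq> 0" "c \<noteq> top"
    using unit_ball_vol_pos[of "card B"] by (auto simp: c_def simp del: unit_ball_vol_pos)
  ultimately show ?thesis by (simp add: ennreal_mult_cancel_left)
qed

text \<open>The image of \<open>B\<close> is another orthonormal set with the same span, by a count
  of dimensions. Transport of coordinates and independence of the orthonormal set then
  combine.\<close>

lemma nn_integral_lspan_isometry:
  assumes on: "orthonormal B" and f: "linear f" "\<And>x y. x \<in> span B \<Longrightarrow> y \<in> span B \<Longrightarrow> f x \<bullet> f y = x \<bullet> y"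
    and fB: "f ` B \<subseteq> span B" and g: "g \<in> borel_measurable borel"
  shows "(\<integral>\<^sup>+x. g (f x) \<partial>lspan B) = (\<integral>\<^sup>+x. g x \<partial>lspan B)"
proof -
  have inner: "f a \<bullet> f b = (if a = b then 1 else 0)" if "a \<in> B" "b \<in> B" for a b
  proof -
    have "f a \<bullet> f b = a \<bullet> b"
      by (intro f(2) span_base that)
    also have "\<dots> = (if a = b then 1 else 0)"
      by (rule orthonormalD[OF on that])
    finally show ?thesis .
  qed
  have inj: "inj_on f B"
  proof (rule inj_onI, rule ccontr)
    fix a b assume "a \<in> B" "b \<in> B" "f a = f b" "a \<noteq> b"
    then show False using inner[of a b] inner[of a a] by simp
  qed
  have on': "orthonormal (f ` B)"
    unfolding orthonormal_def
  proof (intro conjI ballI)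
    show "finite (f ` B)" using on by simp
    fix x y assume "x \<in> f ` B" "y \<in> f ` B"
    then obtain a b where ab: "a \<in> B" "b \<in> B" "x = f a" "y = f b" by blast
    then show "x \<bullet> y = (if x = y then 1 else 0)"
      using inner[OF ab(1,2)] inj_on_eq_iff[OF inj ab(1,2)] by simp
  qed
  have "span (f ` B) = span B"
  proof (rule subspace_dim_equal)
    show "span (f ` B) \<subseteq> span B" using fB by (simp add: span_minimal)
    show "dim (span B) \<le> dim (span (f ` B))"
      using on[THEN orthonormal_independent] on'[THEN orthonormal_independent] inj
      by (simp add: dim_eq_card_independent card_image)
  qed auto
  then show ?thesis
    using nn_integral_lspan_orthonormal[OF on' on _ g] nn_integral_lspan_image[OF _ f(1) inj g] on by simp
qed

text \<open>Polar coordinates with the direction integrated out. As measures in \<open>r\<close>,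
  both sides are determined by their values on half-lines; on the left these are volumes of balls of
  radius \<open>sqrt r\<close>. The derivative of \<open>unit_ball_vol k * r powr (k/2)\<close>
  yields the density and its constant.\<close>

lemma nn_integral_lspan_norm_sq:
  fixes B :: "'a::euclidean_space set"
  assumes on: "orthonormal B" and ne: "card B > 0" and [measurable]: "h \<in> borel_measurable borel"
  defines "k \<equiv> real (card B)"
  shows "(\<integral>\<^sup>+x. h ((norm x)\<^sup>2) \<partial>lspan B) =
     (\<integral>\<^sup>+r. ennreal (pi powr (k/2) / Gamma (k/2)) * (ennreal (indicator {0<..} r * r powr (k/2 - 1)) * h r) \<partial>lborel)"
proof -
  define c where "c = pi powr (k/2) / Gamma (k/2)"
  have k: "k > 0" using ne by (simp add: k_def)
  have c0: "c > 0" using k by (simp add: c_def)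
  define N where "N = distr (lspan B) borel (\<lambda>x. (norm x)\<^sup>2)"
  define D where "D = density lborel (\<lambda>r. ennreal (c * (indicator {0<..} r * r powr (k/2 - 1))))"
  have N: "emeasure N {..r} = ennreal (unit_ball_vol k * r powr (k/2))" if "r > 0" for r
  proof -
    have sq: "(norm x)\<^sup>2 \<le> r \<longleftrightarrow> norm x \<le> sqrt r" for x :: 'a
      by (subst real_sqrt_le_iff[symmetric]) simp
    have "emeasure N {..r} = emeasure (lspan B) (cball 0 (sqrt r))"
      unfolding N_def using that
      by (subst emeasure_distr) (simp_all add: vimage_def cball_def dist_norm sq)
    also have "\<dots> = ennreal (unit_ball_vol k * (sqrt r) ^ card B)"
      using emeasure_lspan_cball[OF on] that by (simp add: k_def)
    also have "(sqrt r) ^ card B = r powr (k / 2)"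
      using that by (simp add: k_def powr_half_sqrt[symmetric] powr_realpow[symmetric] powr_powr)
    finally show ?thesis .
  qed
  have D: "emeasure D {..r} = ennreal (unit_ball_vol k * r powr (k/2))" if "r > 0" for r
  proof -
    have "emeasure D {..r} = (\<integral>\<^sup>+x. ennreal (c * (indicator {0<..} x * x powr (k/2 - 1))) * indicator {..r} x \<partial>lborel)"
      unfolding D_def by (subst emeasure_density) auto
    also have "\<dots> = (\<integral>\<^sup>+x. ennreal (c * x powr (k/2 - 1) * indicator {0..r} x) \<partial>lborel)"
      by (rule nn_integral_cong) (auto simp: indicator_def)
    also have "\<dots> = ennreal (c * (r powr (k/2) / (k/2)))"
    proof -
      have "((\<lambda>x. x powr (k/2 - 1)) has_integral (r powr (k/2 - 1 + 1) / (k/2 - 1 + 1))) {0..r}"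
        using k that by (intro has_integral_powr_from_0) auto
      from has_integral_mult_right[OF this, of c]
      have "((\<lambda>x. c * x powr (k/2 - 1)) has_integral (c * (r powr (k/2) / (k/2)))) {0..r}"
        by simp
      from nn_integral_has_integral_lebesgue[OF _ this] c0 show ?thesis
        by (simp add: ennreal_indicator ennreal_mult' mult_ac)
    qed
    also have "c * (r powr (k/2) / (k/2)) = unit_ball_vol k * r powr (k/2)"
    proof -
      have G: "Gamma (k/2 + 1) = k/2 * Gamma (k/2)"
        using k by (intro Gamma_plus1) (auto elim: nonpos_Ints_cases)
      have "Gamma (k/2) > 0" using k by simp
      then show ?thesis
        unfolding c_def unit_ball_vol_def G using k by (simp add: field_simps)
    qed
    finally show ?thesis .
  qed
  have ND: "N = D"
  proof (rule measure_eqI_generator_eq[where \<Omega>=UNIV and E="range (\<lambda>r::real. {..r})" and A="\<lambda>n. {..real n + 1}"])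
    show "Int_stable (range (\<lambda>r::real. {..r}))"
      unfolding Int_stable_def
    proof (intro ballI, elim rangeE)
      fix a b :: "real set" and x y assume "a = {..x}" "b = {..y}"
      then have "a \<inter> b = {..min x y}" by auto
      then show "a \<inter> b \<in> range (\<lambda>r::real. {..r})" by blast
    qed
    \<comment> \<open>The ball formula covers only positive radii. A half-line ending at
      \<open>r \<le> 0\<close> lies inside \<open>{..e}\<close> for all \<open>e > 0\<close>, whose
      measure tends to 0 because \<open>k > 0\<close>.\<close>
    have neg: "emeasure N {..r} = 0" "emeasure D {..r} = 0" if "r \<le> 0" for r
    proof -
      have lim: "((\<lambda>e. ennreal (unit_ball_vol k * e powr (k/2))) \<longlongrightarrow> ennreal 0) (at_right 0)"
      proof (rule tendsto_ennrealI)
        have "((\<lambda>e. e powr (k/2)) \<longlongrightarrow> 0) (at_right 0)"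
          using k by real_asymp
        from tendsto_mult_right_zero[OF this] show "((\<lambda>e. unit_ball_vol k * e powr (k/2)) \<longlongrightarrow> 0) (at_right 0)" .
      qed
      have "emeasure N {..r} \<le> ennreal 0"
      proof (rule tendsto_lowerbound[OF lim])
        show "\<forall>\<^sub>F e in at_right 0. emeasure N {..r} \<le> ennreal (unit_ball_vol k * e powr (k/2))"
        proof (rule eventually_at_right_less[THEN eventually_mono])
          fix e :: real assume "0 < e"
          then show "emeasure N {..r} \<le> ennreal (unit_ball_vol k * e powr (k/2))"
            unfolding N[symmetric, OF \<open>0 < e\<close>] using that by (intro emeasure_mono) (auto simp: N_def)
        qed
      qed auto
      moreover have "emeasure D {..r} \<le> ennreal 0"
      proof (rule tendsto_lowerbound[OF lim])
        show "\<forall>\<^sub>F e in at_right 0. emeasure D {..r} \<le> ennreal (unit_ball_vol k * e powr (k/2))"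
        proof (rule eventually_at_right_less[THEN eventually_mono])
          fix e :: real assume "0 < e"
          then show "emeasure D {..r} \<le> ennreal (unit_ball_vol k * e powr (k/2))"
            unfolding D[symmetric, OF \<open>0 < e\<close>] using that by (intro emeasure_mono) (auto simp: D_def)
        qed
      qed auto
      ultimately show "emeasure N {..r} = 0" "emeasure D {..r} = 0" by auto
    qed
    show "emeasure N X = emeasure D X" if "X \<in> range (\<lambda>r::real. {..r})" for X
    proof -
      from that obtain r where X: "X = {..r}" by blast
      show ?thesis
        unfolding X using N[of r] D[of r] neg[of r] by (cases "r > 0") simp_all
    qed
    show "sets N = sigma_sets UNIV (range (\<lambda>r::real. {..r}))" "sets D = sigma_sets UNIV (range (\<lambda>r::real. {..r}))"
    proof -
      have "sets (borel :: real measure) = sigma_sets UNIV (range (\<lambda>r::real. {..r}))"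
        by (subst borel_eq_atMost) (rule sets_measure_of, simp)
      then show "sets N = sigma_sets UNIV (range (\<lambda>r::real. {..r}))" "sets D = sigma_sets UNIV (range (\<lambda>r::real. {..r}))"
        by (simp_all add: N_def D_def)
    qed
    show "(\<Union>n. {..real n + 1}) = UNIV"
    proof (intro equalityI subsetI UNIV_I UN_I)
      fix x :: real
      show "x \<in> {..real (nat \<lceil>x\<rceil>) + 1}" by simp linarith
    qed
    \<comment> \<open>The shift by 1 in the exhausting sequence keeps the endpoint positive even for
      \<open>n = 0\<close>, where the ball formula applies.\<close>
    show "emeasure N {..real n + 1} \<noteq> \<infinity>" for n
      using N[of "real n + 1"] by simp
  qed auto
  have "(\<integral>\<^sup>+x. h ((norm x)\<^sup>2) \<partial>lspan B) = (\<integral>\<^sup>+r. h r \<partial>N)"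
    unfolding N_def by (subst nn_integral_distr) auto
  also have "\<dots> = (\<integral>\<^sup>+r. ennreal (c * (indicator {0<..} r * r powr (k/2 - 1))) * h r \<partial>lborel)"
    unfolding ND D_def by (subst nn_integral_density) auto
  also have "\<dots> = (\<integral>\<^sup>+r. ennreal c * (ennreal (indicator {0<..} r * r powr (k/2 - 1)) * h r) \<partial>lborel)"
    using c0 by (intro nn_integral_cong) (simp add: ennreal_mult' mult.assoc)
  finally show ?thesis
    unfolding c_def .
qed

section \<open>Spectral theorem and determinant\<close>

lemma linear_hconj: "linear (hconj :: 'f::conj_algebra \<Rightarrow> 'f)"
  by (rule linearI) (simp_all add: hconj_add hconj_scaleR)

lemmas hconj_zero [simp] = linear_0[OF linear_hconj]
lemmas hconj_sum = linear_sum[OF linear_hconj]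
lemmas hconj_diff = linear_diff[OF linear_hconj]

lemma hconj_one [simp]: "hconj (1 :: 'f::conj_algebra) = 1"
  using mult_hconj[of "1 :: 'f"] by (simp add: dot_square_norm)

lemma hconj_of_real [simp]: "hconj (of_real r :: 'f::conj_algebra) = of_real r"
  by (simp add: of_real_def hconj_scaleR)

lemma inner_hconj_self: "hconj x \<bullet> hconj x = x \<bullet> (x :: 'f::conj_algebra)"
proof (cases "x = 0")
  case False
  have "norm x * norm (hconj x) = norm x * norm x"
    using arg_cong[OF mult_hconj[of x], of norm] by (simp add: norm_mult dot_square_norm power2_eq_square)
  then show ?thesis using False by (simp add: dot_square_norm)
qed simp

lemma hconj_mult_self: "hconj x * x = (x \<bullet> x) *\<^sub>R (1 :: 'f::conj_algebra)"
  using mult_hconj[of "hconj x"] by (simp add: hconj_hconj inner_hconj_self)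

text \<open>Polarisation of \<open>mult_hconj\<close>. It expresses the inner product through the
  algebra, so that identities between inner products can be proved by comparing real multiples of 1
  in a noncommutative ring.\<close>

lemma inner_hconj_polar:
  fixes x y :: "'f::conj_algebra"
  shows "(2 * (x \<bullet> y)) *\<^sub>R 1 = x * hconj y + y * hconj x"
proof -
  have "(x + y) * hconj (x + y) = (x \<bullet> x + 2 * (x \<bullet> y) + y \<bullet> y) *\<^sub>R 1"
    by (simp add: mult_hconj inner_add inner_commute[of y x])
  moreover have "(x + y) * hconj (x + y) = x * hconj x + x * hconj y + (y * hconj x + y * hconj y)"
    by (simp add: hconj_add distrib_left distrib_right)
  ultimately show ?thesis
    by (simp add: mult_hconj scaleR_add_left algebra_simps)
qed

lemma inner_hconj_hconj: "hconj x \<bullet> hconj y = x \<bullet> (y :: 'f::conj_algebra)"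
proof -
  have "hconj (x + y) \<bullet> hconj (x + y) = (x + y) \<bullet> (x + y)" by (rule inner_hconj_self)
  then show ?thesis
    by (simp add: hconj_add inner_add inner_hconj_self inner_commute)
qed

lemma inner_mult_right_hconj:
  fixes a b d :: "'f::conj_algebra"
  shows "(a * d) \<bullet> b = a \<bullet> (b * hconj d)"
proof -
  have "(2 * ((a * d) \<bullet> b)) *\<^sub>R (1 :: 'f) = (2 * (a \<bullet> (b * hconj d))) *\<^sub>R 1"
    unfolding inner_hconj_polar by (simp add: hconj_mult hconj_hconj mult.assoc)
  then show ?thesis by simp
qed

lemma inner_mult_left_hconj:
  fixes a b d :: "'f::conj_algebra"
  shows "(d * a) \<bullet> b = a \<bullet> (hconj d * b)"
proof -
  have "(d * a) \<bullet> b = (hconj a * hconj d) \<bullet> hconj b"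
    by (metis hconj_mult inner_hconj_hconj)
  also have "\<dots> = hconj a \<bullet> (hconj b * d)"
    by (simp add: inner_mult_right_hconj hconj_hconj)
  also have "\<dots> = a \<bullet> (hconj d * b)"
    by (metis hconj_hconj hconj_mult inner_hconj_hconj)
  finally show ?thesis .
qed

text \<open>With \<open>r = norm x\<close> the hypothesis gives \<open>x * x = r * r\<close>. As
  \<open>r\<close> is central, this factors into \<open>(x - r) * (x + r) = 0\<close>, and a
  division algebra has no zero divisors.\<close>

lemma hconj_fixed_real:
  fixes x :: "'f::conj_algebra"
  assumes "hconj x = x"
  shows "x \<in> \<real>"
proof -
  define r where "r = norm x"
  have "x * x = of_real (r * r)"
    using mult_hconj[of x] assms by (simp add: of_real_def dot_square_norm power2_eq_square r_def)
  then have "(x - of_real r) * (x + of_real r) = 0"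
    by (simp add: algebra_simps) (metis mult.commute mult_scaleR_left mult_scaleR_right mult_1 mult_1_right of_real_def)
  then have "x = of_real r \<or> x = of_real (- r)"
    by (auto simp: eq_neg_iff_add_eq_0)
  then show ?thesis by (auto simp del: of_real_minus)
qed

lemma inner_vec_eq: "x \<bullet> y = (\<Sum>i\<in>UNIV. x $ i \<bullet> y $ i)"
  by (simp add: inner_vec_def)

lemma linear_mult_vec: "linear (\<lambda>x. A *v x)" for A :: "'f::conj_algebra^'n^'m"
  by (rule linearI) (simp_all add: vec_eq_iff matrix_vector_mult_def algebra_simps sum.distrib scaleR_sum_right)

lemma inner_adj:
  fixes A :: "'f::conj_algebra^'n^'m"
  shows "(A *v x) \<bullet> y = x \<bullet> (adj A *v y)"
proof -
  have "(A *v x) \<bullet> y = (\<Sum>i\<in>UNIV. \<Sum>j\<in>UNIV. (A $ i $ j * x $ j) \<bullet> y $ i)"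
    by (simp add: inner_vec_eq matrix_vector_mult_def inner_sum_left)
  also have "\<dots> = (\<Sum>j\<in>UNIV. \<Sum>i\<in>UNIV. (A $ i $ j * x $ j) \<bullet> y $ i)"
    by (rule sum.swap)
  also have "\<dots> = x \<bullet> (adj A *v y)"
    by (simp add: inner_vec_eq matrix_vector_mult_def inner_sum_right adj_def inner_mult_left_hconj)
  finally show ?thesis .
qed

text \<open>The scalar on the left equals its own conjugate, hence its real part, and by
  polarisation the real part is the real inner product. Positive definiteness over the scalars
  thereby becomes positivity of a real quadratic form, and real linear algebra applies.\<close>

lemma hermitian_form_real:
  fixes A :: "'f::conj_algebra^'m^'m"
  assumes "adj A = A"
  shows "(\<Sum>i\<in>UNIV. hconj (x $ i) * (A *v x) $ i) = of_real (x \<bullet> (A *v x))"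
proof -
  define y where "y = A *v x"
  define q where "q = (\<Sum>i\<in>UNIV. hconj (x $ i) * y $ i)"
  have A: "hconj (A $ i $ j) = A $ j $ i" for i j
    using arg_cong[OF assms, of "\<lambda>B. B $ j $ i"] by (simp add: adj_def)
  have hq: "hconj q = (\<Sum>i\<in>UNIV. hconj (y $ i) * x $ i)"
    by (simp add: q_def hconj_sum hconj_mult hconj_hconj)
  also have "\<dots> = (\<Sum>i\<in>UNIV. \<Sum>j\<in>UNIV. hconj (x $ j) * (A $ j $ i * x $ i))"
    by (simp add: y_def matrix_vector_mult_def hconj_sum hconj_mult A sum_distrib_right mult.assoc)
  also have "\<dots> = q"
    by (subst sum.swap) (simp add: q_def y_def matrix_vector_mult_def sum_distrib_left)
  finally have "q = hconj q" by simp
  have "(2 * (x \<bullet> y)) *\<^sub>R (1 :: 'f) = (\<Sum>i\<in>UNIV. (2 * (hconj (x $ i) \<bullet> hconj (y $ i))) *\<^sub>R 1)"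
    by (simp add: inner_vec_eq inner_hconj_hconj sum_distrib_left scaleR_sum_left)
  also have "\<dots> = q + hconj q"
    unfolding inner_hconj_polar hconj_hconj hq by (simp add: q_def sum.distrib)
  finally have "(2 :: real) *\<^sub>R of_real (x \<bullet> y) = (2 :: real) *\<^sub>R q"
    using \<open>q = hconj q\<close> by (simp add: of_real_def scaleR_2)
  then show ?thesis by (simp add: q_def y_def)
qed

lemma pos_def_iff:
  "A \<in> pos_def \<longleftrightarrow> adj A = A \<and> (\<forall>x. x \<noteq> 0 \<longrightarrow> x \<bullet> (A *v x) > 0)"
  by (auto simp: pos_def_def hermitian_form_real)

section \<open>Spectral theorem in the real inner product and scalar multiplicities\<close>

text \<open>A maximiser of the quadratic form on the unit sphere of \<open>S\<close> is an
  eigenvector, and its orthogonal complement in \<open>S\<close> is invariant and of smaller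
  dimension. The statement concerns real-linear maps, so that one proof serves all three kinds of
  scalars, and an invariant subspace, so that the induction closes.\<close>

lemma selfadjoint_spectral:
  fixes f :: "'a::euclidean_space \<Rightarrow> 'a"
  assumes f: "linear f" "\<And>x y. f x \<bullet> y = x \<bullet> f y"
    and "subspace S" "\<And>x. x \<in> S \<Longrightarrow> f x \<in> S"
  shows "\<exists>B l. orthonormal B \<and> span B = S \<and> (\<forall>b\<in>B. f b = l b *\<^sub>R b)"
  using assms(3,4)
proof (induction "dim S" arbitrary: S rule: less_induct)
  case (less S)
  note sub = less.prems(1) and inv = less.prems(2)
  show ?case
  proof (cases "S = {0}")
    case True
    then show ?thesis by (intro exI[of _ "{}"]) (simp add: orthonormal_def)
  next
    case False
    then obtain z where z: "z \<in> S" "z \<noteq> 0"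
      using subspace_0[OF sub] by blast
    define K where "K = sphere 0 1 \<inter> S"
    have "compact K"
      unfolding K_def by (intro compact_Int_closed compact_sphere closed_subspace sub)
    moreover have "(1 / norm z) *\<^sub>R z \<in> K"
      using z by (auto simp: K_def intro: subspace_scale[OF sub])
    moreover have "continuous_on K (\<lambda>x. f x \<bullet> x)"
      by (intro continuous_intros linear_continuous_on) (use f in \<open>simp add: linear_conv_bounded_linear\<close>)
    ultimately obtain x where x: "x \<in> K" and max: "\<And>y. y \<in> K \<Longrightarrow> f y \<bullet> y \<le> f x \<bullet> x"
      using continuous_attains_sup[of K "\<lambda>x. f x \<bullet> x"] by blast
    have xS: "x \<in> S" and nx: "x \<bullet> x = 1"
      using x by (auto simp: K_def dot_square_norm)
    define l where "l = f x \<bullet> x"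
    have bound: "f y \<bullet> y \<le> l * (y \<bullet> y)" if "y \<in> S" for y
    proof (cases "y = 0")
      case False
      have "(1 / norm y) *\<^sub>R y \<in> K"
        using that False by (auto simp: K_def intro: subspace_scale[OF sub])
      from max[OF this] have "(f y \<bullet> y) / (norm y)\<^sup>2 \<le> l"
        by (simp add: l_def linear_scale[OF f(1)] power2_eq_square)
      then show ?thesis using False by (simp add: field_simps dot_square_norm)
    qed (simp add: linear_0[OF f(1)])
    define w where "w = f x - l *\<^sub>R x"
    have wS: "w \<in> S"
      using xS inv by (simp add: w_def subspace_diff subspace_scale sub)
    have fx: "f x = l *\<^sub>R x"
    proof -
      define C where "C = l * (w \<bullet> w) - f w \<bullet> w"
      \<comment> \<open>First variation at the maximiser in the direction of the residual
        \<open>w\<close>. The linear gain \<open>2 * t * (w \<bullet> w)\<close> cannot exceed a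
        term quadratic in \<open>t\<close>, which for small \<open>t\<close> forces
        \<open>w = 0\<close>.\<close>
      have "2 * (w \<bullet> w) \<le> t * C" if "t > 0" for t
      proof -
        have "f (x + t *\<^sub>R w) \<bullet> (x + t *\<^sub>R w) \<le> l * ((x + t *\<^sub>R w) \<bullet> (x + t *\<^sub>R w))"
          by (intro bound subspace_add subspace_scale sub xS wS)
        moreover have "f w \<bullet> x = f x \<bullet> w"
          using f(2)[of w x] by (simp add: inner_commute)
        moreover have "f x \<bullet> w = w \<bullet> w + l * (x \<bullet> w)"
        proof -
          have "f x = w + l *\<^sub>R x" by (simp add: w_def)
          then show ?thesis by (simp add: inner_add_left)
        qed
        ultimately have "t * (2 * (w \<bullet> w)) \<le> t * (t * C)"
          using nx by (simp add: C_def linear_add[OF f(1)] linear_scale[OF f(1)] inner_add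
              inner_commute[of w x] algebra_simps flip: l_def)
        then show ?thesis using that by simp
      qed note key = this
      have "w \<bullet> w \<le> 0"
      proof (rule ccontr)
        assume w: "\<not> w \<bullet> w \<le> 0"
        then have "C > 0" using key[of 1] by simp
        moreover from this have "(w \<bullet> w) / C > 0" using w by (intro divide_pos_pos) linarith+
        ultimately show False using key[of "(w \<bullet> w) / C"] w by simp
      qed
      then have "w = 0" by (metis inner_gt_zero_iff not_less)
      then show ?thesis by (simp add: w_def)
    qed
    define S' where "S' = {y \<in> S. x \<bullet> y = 0}"
    have sub': "subspace S'"
      using sub unfolding subspace_def S'_def by (auto simp: inner_add)
    have "x \<notin> S'" using nx by (simp add: S'_def)
    moreover have "S' \<subseteq> S" by (auto simp: S'_def)
    ultimately have "S' \<subset> S" using xS by blast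
    then have "dim S' < dim S"
      by (intro dim_psubset) (simp add: span_eq_iff[THEN iffD2] sub sub')
    moreover have "f y \<in> S'" if "y \<in> S'" for y
    proof -
      have "x \<bullet> f y = f x \<bullet> y" using f(2) by simp
      then show ?thesis using that fx inv by (simp add: S'_def)
    qed
    ultimately obtain B l' where B: "orthonormal B" "span B = S'" "\<forall>b\<in>B. f b = l' b *\<^sub>R b"
      using less.hyps[of S'] sub' by blast
    have BS: "b \<in> S'" if "b \<in> B" for b using B(2) that span_base by blast
    have xB: "x \<notin> B" using BS[of x] nx by (auto simp: S'_def)
    have "orthonormal (insert x B)"
      unfolding orthonormal_def
    proof (intro conjI ballI)
      show "finite (insert x B)" using B by simp
      fix a b assume ab: "a \<in> insert x B" "b \<in> insert x B"
      consider "a = x" "b = x" | "a = x" "b \<in> B" | "a \<in> B" "b = x" | "a \<in> B" "b \<in> B"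
        using ab by blast
      then show "a \<bullet> b = (if a = b then 1 else 0)"
      proof cases
        case 2 then show ?thesis using BS[of b] xB by (auto simp: S'_def)
      next
        case 3 then show ?thesis using BS[of a] xB by (auto simp: S'_def inner_commute)
      qed (simp add: nx, rule orthonormalD[OF B(1)])
    qed
    moreover have "span (insert x B) = S"
    proof (rule equalityI)
      show "span (insert x B) \<subseteq> S"
        using xS BS sub by (intro span_minimal) (auto simp: S'_def)
      show "S \<subseteq> span (insert x B)"
      proof
        fix y assume y: "y \<in> S"
        then have "y - (x \<bullet> y) *\<^sub>R x \<in> S'"
          using xS nx by (auto simp: S'_def inner_diff_right intro!: subspace_diff subspace_scale sub)
        then show "y \<in> span (insert x B)"
          using B(2) by (auto simp: span_breakdown_eq)
      qed
    qed
    moreover have "\<forall>b\<in>insert x B. f b = (l'(x := l)) b *\<^sub>R b"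
      using fx B(3) xB by auto
    ultimately show ?thesis by blast
  qed
qed

text \<open>This makes the truncated division in \<open>eigmult\<close> exact. A line
  \<open>v * c\<close> has real dimension \<open>DIM('f)\<close>; its orthogonal complement is again
  closed under right multiplication, because the adjoint of right multiplication by \<open>c\<close>
  is right multiplication by \<open>hconj c\<close>. Such lines can be split off one after the
  other.\<close>

lemma dim_right_subspace_dvd:
  fixes S :: "('f::conj_algebra^'n) set"
  assumes "subspace S" "\<And>x c. x \<in> S \<Longrightarrow> (\<chi> i. x $ i * c) \<in> S"
  shows "DIM('f) dvd dim S"
  using assms
proof (induction "dim S" arbitrary: S rule: less_induct)
  case (less S)
  note sub = less.prems(1) and cl = less.prems(2)
  show ?case
  proof (cases "S = {0}")
    case False
    then obtain v where v: "v \<in> S" "v \<noteq> 0"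
      using subspace_0[OF sub] by blast
    then obtain k where k: "v $ k \<noteq> 0" by (auto simp: vec_eq_iff)
    define g where "g = (\<lambda>c::'f. (\<chi> i. v $ i * c))"
    have lin: "linear g"
      by (rule linearI) (simp_all add: g_def vec_eq_iff algebra_simps)
    have inj: "inj g"
      using k by (auto simp: inj_def g_def vec_eq_iff)
    define W where "W = range g"
    have W: "subspace W" "W \<subseteq> S" "dim W = DIM('f)"
      using dim_image_eq[OF lin, of UNIV] inj cl[OF v(1)] lin
      by (auto simp: W_def g_def intro: linear_subspace_image subspace_UNIV)
    define S' where "S' = {y \<in> S. \<forall>x\<in>W. orthogonal x y}"
    have dim: "dim S' + dim W = dim S"
      unfolding S'_def using dim_subspace_orthogonal_to_vectors[OF W(1) sub W(2)] .
    have sub': "subspace S'"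
      using sub unfolding subspace_def S'_def by (auto simp: orthogonal_def inner_add)
    have cl': "(\<chi> i. y $ i * c) \<in> S'" if "y \<in> S'" for y c
    proof -
      have "g d \<bullet> (\<chi> i. y $ i * c) = g (d * hconj c) \<bullet> y" for d
        by (simp add: g_def inner_vec_eq mult.assoc[symmetric] inner_mult_right_hconj hconj_hconj)
      then show ?thesis
        using that cl by (auto simp: S'_def orthogonal_def W_def)
    qed
    have "DIM('f) dvd dim S'"
    proof (rule less.hyps)
      show "dim S' < dim S" using dim W(3) DIM_positive[where 'a='f] by linarith
    qed (fact sub', fact cl')
    then show ?thesis
      using dim W(3) by (metis dvd_add dvd_refl)
  qed simp
qed

text \<open>A real orthonormal eigenbasis lists each eigenvalue \<open>DIM('f)\<close> times as
  often as its multiplicity over the scalars; hence the exponent.\<close>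

lemma hdet_power_DIM:
  fixes A :: "'f::conj_algebra^'m^'m"
  assumes B: "orthonormal B" "span B = UNIV" "\<And>b. b \<in> B \<Longrightarrow> A *v b = l b *\<^sub>R b"
  shows "hdet A ^ DIM('f) = (\<Prod>b\<in>B. l b)"
proof -
  note lin = linear_mult_vec[of A]
  have fin: "finite B" using B by simp
  have eig: "eigspace A r = span {b \<in> B. l b = r}" for r
  proof (intro equalityI subsetI)
    fix x assume "x \<in> span {b \<in> B. l b = r}"
    then show "x \<in> eigspace A r"
    proof (rule span_induct)
      show "subspace (Collect (\<lambda>x. x \<in> eigspace A r))"
        by (auto simp: subspace_def eigspace_def linear_0[OF lin] linear_add[OF lin]
            linear_scale[OF lin] algebra_simps)
    qed (auto simp: eigspace_def B)
  next
    fix x assume x: "x \<in> eigspace A r"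
    have xe: "x = (\<Sum>b\<in>B. (x \<bullet> b) *\<^sub>R b)"
      using orthonormal_expand[OF B(1)] B(2) by simp
    have coef: "x \<bullet> b = 0" if b: "b \<in> B" "l b \<noteq> r" for b
    proof -
      have "A *v x = (\<Sum>b\<in>B. ((x \<bullet> b) * l b) *\<^sub>R b)"
        by (subst xe) (simp add: linear_sum[OF lin] linear_scale[OF lin] B(3))
      then have "(A *v x) \<bullet> b = (x \<bullet> b) * l b"
        by (simp add: orthonormal_inner_sum[OF B(1) b(1)])
      moreover have "(A *v x) \<bullet> b = r * (x \<bullet> b)"
        using x by (simp add: eigspace_def)
      ultimately show ?thesis using b(2) by simp
    qed
    have "(\<Sum>b\<in>B. (x \<bullet> b) *\<^sub>R b) = (\<Sum>b\<in>{b \<in> B. l b = r}. (x \<bullet> b) *\<^sub>R b)"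
      by (rule sum.mono_neutral_right) (use fin coef in auto)
    then show "x \<in> span {b \<in> B. l b = r}"
      using xe by (metis (no_types, lifting) span_base span_scale span_sum)
  qed
  have ind: "independent {b \<in> B. l b = r}" for r
    by (rule independent_mono[OF orthonormal_independent[OF B(1)]]) auto
  have dim: "dim (eigspace A r) = card {b \<in> B. l b = r}" for r
    unfolding eig dim_span by (rule dim_eq_card_independent[OF ind])
  have "DIM('f) dvd dim (eigspace A r)" for r
  proof (rule dim_right_subspace_dvd)
    show "subspace (eigspace A r)" by (simp add: eig)
    fix x c assume "x \<in> eigspace A r"
    then show "(\<chi> i. x $ i * c) \<in> eigspace A r"
      by (simp add: eigspace_def vec_eq_iff matrix_vector_mult_def flip: mult.assoc sum_distrib_right)
  qed
  then have mult: "eigmult A r * DIM('f) = card {b \<in> B. l b = r}" for r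
    unfolding eigmult_def dim by (simp add: dim)
  have "{r. \<exists>v. v \<noteq> 0 \<and> v \<in> eigspace A r} = l ` B"
  proof (intro equalityI subsetI; clarsimp)
    fix r v assume "v \<noteq> 0" "v \<in> eigspace A r"
    then have "{b \<in> B. l b = r} \<noteq> {}" unfolding eig by (metis span_empty singletonD)
    then show "r \<in> l ` B" by blast
  next
    fix b assume b: "b \<in> B"
    have "b \<bullet> b = 1" using orthonormalD[OF B(1) b b] by simp
    then have "b \<noteq> 0" by auto
    moreover have "b \<in> eigspace A (l b)" using B(3)[OF b] by (simp add: eigspace_def)
    ultimately show "\<exists>v. v \<noteq> 0 \<and> v \<in> eigspace A (l b)" by blast
  qed
  then have "hdet A ^ DIM('f) = (\<Prod>r\<in>l ` B. r ^ card {b \<in> B. l b = r})"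
    by (simp add: hdet_def prod_power_distrib power_mult[symmetric] mult)
  also have "\<dots> = (\<Prod>r\<in>l ` B. \<Prod>b\<in>{b \<in> B. l b = r}. l b)"
    by (intro prod.cong) auto
  also have "\<dots> = (\<Prod>b\<in>B. l b)"
    by (rule prod.image_gen[symmetric, OF fin])
  finally show ?thesis .
qed

lemma pos_def_eigenbasis:
  fixes A :: "'f::conj_algebra^'m^'m"
  assumes "A \<in> pos_def"
  obtains B l where "orthonormal B" "span B = UNIV" "\<And>b. b \<in> B \<Longrightarrow> A *v b = l b *\<^sub>R b" "\<And>b. b \<in> B \<Longrightarrow> l b > 0"
proof -
  have adj: "adj A = A" using assms by (simp add: pos_def_iff)
  obtain B l where B: "orthonormal B" "span B = UNIV" "\<forall>b\<in>B. A *v b = l b *\<^sub>R b"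
    using selfadjoint_spectral[OF linear_mult_vec[of A], of UNIV] inner_adj[of A] adj by auto
  have "l b > 0" if b: "b \<in> B" for b
  proof -
    have bb: "b \<bullet> b = 1" using orthonormalD[OF B(1) b b] by simp
    then have "b \<noteq> 0" by auto
    then have "b \<bullet> (A *v b) > 0" using assms by (simp add: pos_def_iff)
    then show ?thesis using B(3) b bb by simp
  qed
  with B that show ?thesis by blast
qed

lemma hdet_pos:
  fixes A :: "'f::conj_algebra^'m^'m"
  assumes "A \<in> pos_def"
  shows "hdet A > 0"
proof -
  obtain B l where B: "orthonormal B" "span B = UNIV" "\<And>b. b \<in> B \<Longrightarrow> A *v b = l b *\<^sub>R b" "\<And>b. b \<in> B \<Longrightarrow> l b > 0"
    using pos_def_eigenbasis[OF assms] by metis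
  have "\<exists>v. v \<noteq> 0 \<and> v \<in> eigspace A r \<Longrightarrow> r > 0" for r
  proof -
    assume "\<exists>v. v \<noteq> 0 \<and> v \<in> eigspace A r"
    then obtain v where v: "v \<noteq> 0" "A *v v = r *\<^sub>R v" by (auto simp: eigspace_def)
    then have "v \<bullet> (A *v v) > 0" using assms unfolding pos_def_iff by blast
    then show "r > 0" using v inner_ge_zero[of v] by (auto simp: zero_less_mult_iff simp del: inner_ge_zero)
  qed
  then show ?thesis
    unfolding hdet_def by (intro prod_pos) simp
qed

section \<open>The determinant as a volume factor\<close>

text \<open>Lebesgue measure may be taken in the coordinates of an orthonormal eigenbasis, where
  \<open>A\<close> only scales each coordinate.\<close>

lemma nn_integral_pos_def_mult:
  fixes A :: "'f::conj_algebra^'m^'m"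
  assumes "A \<in> pos_def" and h: "h \<in> borel_measurable borel"
  shows "ennreal (hdet A ^ DIM('f)) * (\<integral>\<^sup>+x. h (A *v x) \<partial>lborel) = (\<integral>\<^sup>+x. h x \<partial>lborel)"
proof -
  obtain B l where B: "orthonormal B" "span B = UNIV" "\<And>b. b \<in> B \<Longrightarrow> A *v b = l b *\<^sub>R b" "\<And>b. b \<in> B \<Longrightarrow> l b > 0"
    using pos_def_eigenbasis[OF assms(1)] by metis
  have on: "orthonormal (Basis :: ('f^'m) set)"
    by (simp add: orthonormal_def inner_Basis)
  have lb: "(\<integral>\<^sup>+x. g x \<partial>lborel) = (\<integral>\<^sup>+x. g x \<partial>lspan B)" if "g \<in> borel_measurable borel" for g :: "'f^'m \<Rightarrow> ennreal"
    using nn_integral_lspan_orthonormal[OF on B(1) _ that] B(2) by (simp add: lspan_Basis)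
  have "(\<lambda>x. h (A *v x)) \<in> borel_measurable borel"
    by (rule measurable_compose[OF borel_measurable_linear[OF linear_mult_vec] h])
  then show ?thesis
    using nn_integral_lspan_diag[OF _ linear_mult_vec[of A], of B l h] B h
    by (simp add: lb hdet_power_DIM[OF B(1-3)])
qed

text \<open>The converse: the volume factor determines \<open>hdet\<close>. Testing on the unit ball
  gives two equations with the same integral \<open>I\<close>, which is neither 0 nor infinite and
  cancels; positivity allows the root of order \<open>DIM('f)\<close>. Determinants are evaluated
  below by finding the volume factor in another way.\<close>

lemma hdet_eqI:
  fixes A :: "'f::conj_algebra^'m^'m"
  assumes A: "A \<in> pos_def" and c: "c > 0"
    and sc: "\<And>h. h \<in> borel_measurable borel \<Longrightarrow> ennreal (c ^ DIM('f)) * (\<integral>\<^sup>+x. h (A *v x) \<partial>lborel) = (\<integral>\<^sup>+x. h x \<partial>lborel)"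
  shows "hdet A = c"
proof -
  define h where "h = (indicator (cball 0 1) :: 'f^'m \<Rightarrow> ennreal)"
  have h: "h \<in> borel_measurable borel" by (simp add: h_def borel_measurable_indicator)
  define V where "V = (\<integral>\<^sup>+x. h x \<partial>lborel)"
  define I where "I = (\<integral>\<^sup>+x. h (A *v x) \<partial>lborel)"
  have V: "V = ennreal (unit_ball_vol (DIM('f^'m)))"
    using emeasure_cball[of 1 "0 :: 'f^'m"] by (simp add: V_def h_def)
  then have V0: "V \<noteq> 0" "V \<noteq> top"
    using unit_ball_vol_pos[of "DIM('f^'m)"] by (auto simp del: unit_ball_vol_pos)
  have 1: "ennreal (hdet A ^ DIM('f)) * I = V"
    using nn_integral_pos_def_mult[OF A h] by (simp add: I_def V_def)
  have 2: "ennreal (c ^ DIM('f)) * I = V"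
    using sc[OF h] by (simp add: I_def V_def)
  have "I \<noteq> 0" "I \<noteq> top"
    using 2 V0 c by (auto simp: ennreal_mult_top)
  then have "ennreal (hdet A ^ DIM('f)) = ennreal (c ^ DIM('f))"
    using 1 2 by (metis ennreal_mult_cancel_left mult.commute)
  then have "hdet A ^ DIM('f) = c ^ DIM('f)"
    using hdet_pos[OF A] c by (simp add: ennreal_inj)
  then show ?thesis
    using hdet_pos[OF A] c DIM_positive[where 'a='f]
    by (metis less_imp_le power_eq_imp_eq_base)
qed

lemma adj_mat_1 [simp]: "adj (mat 1) = (mat 1 :: 'f::conj_algebra^'m^'m)"
  by (simp add: adj_def mat_def vec_eq_iff)

lemma pos_def_mat_1: "(mat 1 :: 'f::conj_algebra^'m^'m) \<in> pos_def"
  by (simp add: pos_def_iff)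

lemma hdet_mat_1: "hdet (mat 1 :: 'f::conj_algebra^'m^'m) = 1"
  by (rule hdet_eqI[OF pos_def_mat_1]) simp_all

section \<open>Measurability of the cone and of the determinant\<close>

lemma linear_adj: "linear (adj :: 'f::conj_algebra^'n^'m \<Rightarrow> _)"
  by (rule linearI) (simp_all add: adj_def vec_eq_iff hconj_add hconj_scaleR)

text \<open>On the compact unit sphere a positive quadratic form is bounded below by some
  \<open>1 / Suc n\<close>. So the cone is a countable union of sets cut out by non-strict
  inequalities, which are closed although they involve uncountably many vectors.\<close>

lemma pos_def_borel [measurable]: "(pos_def :: ('f::conj_algebra^'m^'m) set) \<in> sets borel"
proof -
  have cont: "continuous_on UNIV (\<lambda>A::'f^'m^'m. x \<bullet> (A *v x))" for x
  proof -
    have "linear (\<lambda>A::'f^'m^'m. x \<bullet> (A *v x))"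
      by (rule linearI) (simp_all add: inner_vec_eq matrix_vector_mult_def algebra_simps inner_add
        inner_sum_right sum.distrib sum_distrib_left)
    then show ?thesis by (simp add: linear_continuous_on linear_conv_bounded_linear)
  qed
  define F where "F n = {A::'f^'m^'m. adj A = A} \<inter> (\<Inter>x\<in>sphere 0 1. {A. 1 / real (Suc n) \<le> x \<bullet> (A *v x)})" for n :: nat
  have "closed (F n)" for n
    unfolding F_def
    by (intro closed_Int closed_INT ballI closed_Collect_eq closed_Collect_le continuous_on_const cont continuous_on_id
      linear_continuous_on[OF linear_adj[unfolded linear_conv_bounded_linear]])
  moreover have "pos_def = (\<Union>n. F n)"
  proof (intro equalityI subsetI)
    fix A :: "'f^'m^'m" assume A: "A \<in> pos_def"
    have "continuous_on (sphere 0 1) (\<lambda>x. x \<bullet> (A *v x))"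
      using linear_mult_vec[of A] by (intro continuous_intros linear_continuous_on) (simp add: linear_conv_bounded_linear)
    moreover have "sphere 0 1 \<noteq> ({} :: ('f^'m) set)" by simp
    ultimately obtain x where x: "x \<in> sphere 0 1" "\<And>y. y \<in> sphere 0 1 \<Longrightarrow> x \<bullet> (A *v x) \<le> y \<bullet> (A *v y)"
      using continuous_attains_inf[OF compact_sphere] by blast
    have "x \<noteq> 0" using x(1) by auto
    then have "x \<bullet> (A *v x) > 0" using A unfolding pos_def_iff by blast
    then obtain n where "1 / real (Suc n) < x \<bullet> (A *v x)"
      using reals_Archimedean[of "x \<bullet> (A *v x)"] by (auto simp: inverse_eq_divide)
    then have "A \<in> F n" using A x(2) by (force simp: F_def pos_def_iff)
    then show "A \<in> (\<Union>n. F n)" by blast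
  next
    fix A :: "'f^'m^'m" assume "A \<in> (\<Union>n. F n)"
    then obtain n where n: "A \<in> F n" by blast
    have "x \<bullet> (A *v x) > 0" if "x \<noteq> 0" for x
    proof -
      define y where "y = (1 / norm x) *\<^sub>R x"
      have "y \<in> sphere 0 1" using that by (simp add: y_def)
      with n have "1 / real (Suc n) \<le> y \<bullet> (A *v y)" by (simp add: F_def)
      then have "0 < y \<bullet> (A *v y)" by (rule less_le_trans[rotated]) simp
      also have "y \<bullet> (A *v y) = (x \<bullet> (A *v x)) / (norm x)\<^sup>2"
        by (simp add: y_def linear_scale[OF linear_mult_vec] power2_eq_square)
      finally show ?thesis using that by (simp add: zero_less_divide_iff)
    qed
    then show "A \<in> pos_def" using n by (simp add: pos_def_iff F_def)
  qed
  ultimately show ?thesis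
    using sets.countable_UN[of F UNIV borel] by (simp add: borel_closed image_subset_iff)
qed

lemma continuous_on_mult_vec:
  "continuous_on UNIV (\<lambda>p. (fst p :: 'f::conj_algebra^'n^'m) *v snd p)"
  unfolding matrix_vector_mult_def by (intro continuous_intros continuous_on_vec_lambda)

text \<open>Eigenspaces do not vary in an evidently measurable way. The determinant is instead
  recovered from the volume \<open>G A\<close> of the preimage of the unit ball, which is a
  parametrised integral and so measurable in \<open>A\<close>.\<close>

lemma borel_measurable_hdet:
  "(\<lambda>A :: 'f::conj_algebra^'m^'m. if A \<in> pos_def then hdet A else 0) \<in> borel_measurable borel"
proof -
  define G where "G A = (\<integral>\<^sup>+x. indicator (cball 0 1) (A *v x) \<partial>lborel)" for A :: "'f^'m^'m"
  have [measurable]: "(\<lambda>p. (fst p :: 'f^'m^'m) *v snd p) \<in> borel_measurable (borel \<Otimes>\<^sub>M borel)"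
    using borel_measurable_continuous_onI[OF continuous_on_mult_vec] by (simp add: borel_prod)
  then have m: "(\<lambda>p. (fst p :: 'f^'m^'m) *v snd p) \<in> borel_measurable (borel \<Otimes>\<^sub>M lborel)"
    by (subst measurable_cong_sets[OF sets_pair_measure_cong[OF refl sets_lborel] refl])
  have G [measurable]: "G \<in> borel_measurable borel"
    unfolding G_def
  proof (rule sigma_finite_measure.borel_measurable_nn_integral[OF sigma_finite_lborel])
    show "(\<lambda>(A :: 'f^'m^'m, x). indicator (cball 0 1) (A *v x) :: ennreal) \<in> borel_measurable (borel \<Otimes>\<^sub>M (lborel :: ('f^'m) measure))"
    proof -
      have "(indicator (cball 0 1) :: 'f^'m \<Rightarrow> ennreal) \<in> borel_measurable borel"
        by (intro borel_measurable_indicator) simp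
      from measurable_compose[OF m this] show ?thesis by (simp add: case_prod_beta)
    qed
  qed
  define V where "V = unit_ball_vol (DIM('f^'m))"
  have "(if A \<in> pos_def then hdet A else 0) = (if A \<in> pos_def then root DIM('f) (V / enn2real (G A)) else 0)" for A :: "'f^'m^'m"
  proof (cases "A \<in> pos_def")
    case True
    have V0: "V > 0" by (simp add: V_def)
    have eq: "ennreal (hdet A ^ DIM('f)) * G A = ennreal V"
      using nn_integral_pos_def_mult[OF True, of "indicator (cball 0 1)"] emeasure_cball[of 1 "0 :: 'f^'m"]
      by (simp add: G_def V_def borel_measurable_indicator)
    have h0: "hdet A ^ DIM('f) > 0" using hdet_pos[OF True] by simp
    have "hdet A ^ DIM('f) * enn2real (G A) = V"
      using arg_cong[OF eq, of enn2real] h0 V0 by (simp add: enn2real_mult)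
    then have "hdet A ^ DIM('f) = V / enn2real (G A)"
      using V0 by (metis less_irrefl mult_zero_right nonzero_eq_divide_eq)
    then have "root DIM('f) (hdet A ^ DIM('f)) = root DIM('f) (V / enn2real (G A))" by simp
    then show ?thesis using hdet_pos[OF True] True by (simp add: real_root_power_cancel)
  qed simp
  then show ?thesis by (simp cong: measurable_cong)
qed

section \<open>Schur complements and rotations\<close>

definition coord_basis :: "'m::finite set \<Rightarrow> ('a::euclidean_space^'m) set" where
  "coord_basis S = (\<Union>i\<in>S. axis i ` Basis)"

lemma coord_basis_UNIV: "coord_basis UNIV = Basis"
  by (auto simp: coord_basis_def Basis_vec_def)

lemma coord_basis_subset: "coord_basis S \<subseteq> Basis"
  by (auto simp: coord_basis_def Basis_vec_def)

lemma orthonormal_Basis: "orthonormal Basis"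
  by (simp add: orthonormal_def inner_Basis)

lemma orthonormal_subset: "orthonormal B \<Longrightarrow> A \<subseteq> B \<Longrightarrow> orthonormal A"
  unfolding orthonormal_def by (meson finite_subset subsetD)

lemma orthonormal_coord_basis: "orthonormal (coord_basis S)"
  by (rule orthonormal_subset[OF orthonormal_Basis coord_basis_subset])

lemma finite_coord_basis [simp]: "finite (coord_basis S)"
  using orthonormal_coord_basis by (rule orthonormal_finite)

lemma coord_basis_Un: "coord_basis (S \<union> T) = coord_basis S \<union> coord_basis T"
  by (auto simp: coord_basis_def)

lemma coord_basis_disjoint:
  fixes S T :: "'m::finite set"
  assumes "S \<inter> T = {}"
  shows "(coord_basis S :: ('a::euclidean_space^'m) set) \<inter> coord_basis T = {}"
proof -
  have False if "i \<in> S" "j \<in> T" "b \<in> Basis" "c \<in> Basis" "axis i b = axis j c" for i j and b c :: 'a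
  proof -
    have "i \<noteq> j" using that assms by auto
    then have "b = 0" using arg_cong[OF that(5), of "\<lambda>x. x $ i"] by (simp add: axis_def)
    then show False using that by simp
  qed
  then show ?thesis unfolding coord_basis_def by blast
qed

lemma card_coord_basis: "card (coord_basis S :: ('a::euclidean_space^'m) set) = card S * DIM('a)"
proof -
  have fin: "finite S" by simp
  then show ?thesis
  proof (induction S rule: finite_induct)
    case (insert i S)
    have "inj_on (axis i) (Basis :: 'a set)"
      by (rule inj_onI) (auto simp: axis_eq_axis)
    then have "card (coord_basis {i} :: ('a^'m) set) = DIM('a)"
      by (simp add: coord_basis_def card_image)
    then show ?case
      using insert coord_basis_Un[of "{i}" S, where 'a='a] coord_basis_disjoint[of "{i}" S, where 'a='a]
      by (simp add: card_Un_disjoint)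
  qed (simp add: coord_basis_def)
qed

lemma span_coord_basis: "span (coord_basis S) = {x :: 'a::euclidean_space^'m. \<forall>i. i \<notin> S \<longrightarrow> x $ i = 0}"
proof (intro equalityI span_minimal subsetI)
  show "subspace {x :: 'a^'m. \<forall>i. i \<notin> S \<longrightarrow> x $ i = 0}"
    by (auto simp: subspace_def)
  show "x \<in> {x :: 'a^'m. \<forall>i. i \<notin> S \<longrightarrow> x $ i = 0}" if "x \<in> coord_basis S" for x
    using that by (auto simp: coord_basis_def axis_def)
  fix x :: "'a^'m" assume x: "x \<in> {x. \<forall>i. i \<notin> S \<longrightarrow> x $ i = 0}"
  have "x \<bullet> b = 0" if "b \<in> Basis - coord_basis S" for b
    using that x by (auto simp: coord_basis_def Basis_vec_def inner_axis)
  then have "(\<Sum>b\<in>Basis. (x \<bullet> b) *\<^sub>R b) = (\<Sum>b\<in>coord_basis S. (x \<bullet> b) *\<^sub>R b)"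
    by (intro sum.mono_neutral_right) (use coord_basis_subset[of S] in auto)
  then have "x = (\<Sum>b\<in>coord_basis S. (x \<bullet> b) *\<^sub>R b)"
    by (simp add: euclidean_representation)
  then show "x \<in> span (coord_basis S)"
    by (metis (no_types, lifting) span_base span_scale span_sum)
qed

text \<open>Change of variables for a block triangular map. For fixed \<open>z\<close> the shear
  \<open>w z\<close> is a translation inside \<open>span B\<close> and costs nothing; the two
  scalings supply the factor.\<close>

lemma nn_integral_lspan_block:
  assumes fin: "finite A" "finite B" and disj: "A \<inter> B = {}" and ac: "a > 0" "c > 0"
    and [measurable]: "f \<in> borel_measurable borel" "w \<in> borel_measurable borel"
    and w: "\<And>z. z \<in> span A \<Longrightarrow> w z \<in> span B"
    and f: "\<And>z y. z \<in> span A \<Longrightarrow> y \<in> span B \<Longrightarrow> f (z + y) = a *\<^sub>R z + c *\<^sub>R y + w z"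
    and [measurable]: "h \<in> borel_measurable borel"
  shows "ennreal (a ^ card A * c ^ card B) * (\<integral>\<^sup>+x. h (f x) \<partial>lspan (A \<union> B)) = (\<integral>\<^sup>+x. h x \<partial>lspan (A \<union> B))"
proof -
  note [measurable] = fin
  have inner: "ennreal (c ^ card B) * (\<integral>\<^sup>+y. h (f (z + y)) \<partial>lspan B) = (\<integral>\<^sup>+y. h (a *\<^sub>R z + y) \<partial>lspan B)"
    if z: "z \<in> span A" for z
  proof -
    have "(\<integral>\<^sup>+y. h (f (z + y)) \<partial>lspan B) = (\<integral>\<^sup>+y. h (a *\<^sub>R z + c *\<^sub>R y + w z) \<partial>lspan B)"
      by (rule nn_integral_lspan_cong) (measurable, simp add: f z)
    then have "ennreal (c ^ card B) * (\<integral>\<^sup>+y. h (f (z + y)) \<partial>lspan B) = (\<integral>\<^sup>+y. h (a *\<^sub>R z + (y + w z)) \<partial>lspan B)"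
      using nn_integral_lspan_scaleR[OF fin(2) ac(2), of "\<lambda>y. h (a *\<^sub>R z + y + w z)"]
      by (simp add: add.assoc)
    also have "\<dots> = (\<integral>\<^sup>+y. h (a *\<^sub>R z + y) \<partial>lspan B)"
      by (rule nn_integral_lspan_translate) (use fin w z in measurable)
    finally show ?thesis .
  qed
  have "ennreal (a ^ card A * c ^ card B) * (\<integral>\<^sup>+x. h (f x) \<partial>lspan (A \<union> B)) =
     ennreal (a ^ card A) * (\<integral>\<^sup>+z. ennreal (c ^ card B) * (\<integral>\<^sup>+y. h (f (z + y)) \<partial>lspan B) \<partial>lspan A)"
    using ac fin disj by (simp add: nn_integral_lspan_Un ennreal_mult nn_integral_cmult mult.assoc)
  also have "(\<integral>\<^sup>+z. ennreal (c ^ card B) * (\<integral>\<^sup>+y. h (f (z + y)) \<partial>lspan B) \<partial>lspan A) =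
     (\<integral>\<^sup>+z. \<integral>\<^sup>+y. h (a *\<^sub>R z + y) \<partial>lspan B \<partial>lspan A)"
    by (rule nn_integral_lspan_cong) (measurable, rule inner)
  also have "ennreal (a ^ card A) * \<dots> = (\<integral>\<^sup>+z. \<integral>\<^sup>+y. h (z + y) \<partial>lspan B \<partial>lspan A)"
    by (rule nn_integral_lspan_scaleR) (use fin ac in measurable)
  also have "\<dots> = (\<integral>\<^sup>+x. h x \<partial>lspan (A \<union> B))"
    using fin disj by (simp add: nn_integral_lspan_Un)
  finally show ?thesis .
qed

lemma card_coord_basis_singleton: "card (coord_basis {k} :: ('f::euclidean_space^'m) set) = DIM('f)"
  by (simp add: card_coord_basis)

lemma coord_basis_compl:
  "coord_basis {k} \<union> coord_basis (- {k}) = Basis" "coord_basis (- {k}) \<union> coord_basis {k} = Basis"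
proof -
  show "coord_basis {k} \<union> coord_basis (- {k}) = Basis"
    by (simp flip: coord_basis_Un coord_basis_UNIV)
  then show "coord_basis (- {k}) \<union> coord_basis {k} = Basis"
    by (simp add: Un_commute)
qed

section \<open>Elimination of one pivot\<close>

text \<open>\<open>Z\<close> is the Schur complement of the pivot \<open>\<rho>\<close> in the
  matrix \<open>Y\<close> defined below, kept at full size by a 1 at the place of the pivot. In this
  way both matrices have the same type and act on the same space.\<close>

locale schur =
  fixes k :: "'m::finite" and b :: "'f::conj_algebra^'m" and \<rho> :: real and Z :: "'f^'m^'m"
  assumes bk: "b $ k = 0" and \<rho>: "\<rho> > 0"
    and Zk: "\<And>i. Z $ i $ k = (if i = k then 1 else 0)" "\<And>j. Z $ k $ j = (if j = k then 1 else 0)"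
begin

definition Y :: "'f^'m^'m" where
  "Y = (\<chi> i j. if i = k then (if j = k then of_real \<rho> else hconj (b $ j))
     else if j = k then b $ i else Z $ i $ j + (1 / \<rho>) *\<^sub>R (b $ i * hconj (b $ j)))"

text \<open>\<open>Y = L Z L*\<close>, where \<open>L\<close> differs from the identity only in column \<open>k\<close>.\<close>

definition L :: "'f^'m \<Rightarrow> 'f^'m" where
  "L y = (\<chi> i. if i = k then sqrt \<rho> *\<^sub>R y $ k else y $ i + (1 / sqrt \<rho>) *\<^sub>R (b $ i * y $ k))"

text \<open>The adjoint of \<open>L\<close> for the real inner product. The summand
  \<open>j = k\<close> vanishes because \<open>b $ k = 0\<close>.\<close>

definition L' :: "'f^'m \<Rightarrow> 'f^'m" where
  "L' x = (\<chi> i. if i = k then sqrt \<rho> *\<^sub>R x $ k + (1 / sqrt \<rho>) *\<^sub>R (\<Sum>j\<in>UNIV. hconj (b $ j) * x $ j) else x $ i)"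

lemma linear_L: "linear L"
  by (rule linearI) (simp_all add: L_def vec_eq_iff algebra_simps)

lemma linear_L': "linear L'"
  by (rule linearI) (simp_all add: L'_def vec_eq_iff algebra_simps sum.distrib scaleR_sum_right)

lemma inner_L: "L y \<bullet> x = y \<bullet> L' x"
proof -
  have "L y \<bullet> x = (\<Sum>i\<in>UNIV. (if i = k then sqrt \<rho> * (y $ k \<bullet> x $ k) else y $ i \<bullet> x $ i)) +
      (1 / sqrt \<rho>) * (\<Sum>i\<in>UNIV. (b $ i * y $ k) \<bullet> x $ i)"
    unfolding inner_vec_eq sum_distrib_left sum.distrib[symmetric]
    by (intro sum.cong) (simp_all add: L_def bk inner_add_left)
  also have "(\<Sum>i\<in>UNIV. (b $ i * y $ k) \<bullet> x $ i) = y $ k \<bullet> (\<Sum>j\<in>UNIV. hconj (b $ j) * x $ j)"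
    by (simp add: inner_mult_left_hconj inner_sum_right)
  also have "(\<Sum>i\<in>UNIV. (if i = k then sqrt \<rho> * (y $ k \<bullet> x $ k) else y $ i \<bullet> x $ i)) +
      (1 / sqrt \<rho>) * (y $ k \<bullet> (\<Sum>j\<in>UNIV. hconj (b $ j) * x $ j)) = y \<bullet> L' x"
    by (simp add: inner_vec_eq sum.remove[of UNIV k] L'_def inner_add_right)
  finally show ?thesis .
qed

lemma Y_mult: "Y *v x = L (Z *v L' x)"
proof -
  define s where "s = (\<Sum>j\<in>UNIV. hconj (b $ j) * x $ j)"
  have s: "s = (\<Sum>j\<in>UNIV - {k}. hconj (b $ j) * x $ j)"
    unfolding s_def by (subst sum.remove[of UNIV k]) (simp_all add: bk)
  have Zk': "(Z *v L' x) $ k = sqrt \<rho> *\<^sub>R x $ k + (1 / sqrt \<rho>) *\<^sub>R s"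
    by (simp add: matrix_vector_mult_def Zk if_distrib[of "\<lambda>c. c * _"] cong: if_cong)
      (simp add: L'_def s_def)
  have Zi: "(Z *v L' x) $ i = (\<Sum>j\<in>UNIV - {k}. Z $ i $ j * x $ j)" if "i \<noteq> k" for i
    using that unfolding matrix_vector_mult_def
    by (simp add: sum.remove[of UNIV k] Zk L'_def)
  have "(Y *v x) $ i = L (Z *v L' x) $ i" for i
  proof (cases "i = k")
    case True
    have "(Y *v x) $ k = of_real \<rho> * x $ k + s"
      unfolding matrix_vector_mult_def s by (simp add: Y_def sum.remove[of UNIV k])
    moreover have "L (Z *v L' x) $ k = sqrt \<rho> *\<^sub>R (sqrt \<rho> *\<^sub>R x $ k + (1 / sqrt \<rho>) *\<^sub>R s)"
      by (simp add: L_def Zk')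
    ultimately show ?thesis
      using \<rho> True by (simp add: scaleR_add_right scaleR_conv_of_real[symmetric])
  next
    case False
    have "(Y *v x) $ i = b $ i * x $ k + ((\<Sum>j\<in>UNIV - {k}. Z $ i $ j * x $ j) + (1 / \<rho>) *\<^sub>R (b $ i * s))"
      using False unfolding matrix_vector_mult_def s
      by (simp add: Y_def sum.remove[of UNIV k] distrib_right sum.distrib sum_distrib_left scaleR_sum_right mult.assoc)
    moreover have "L (Z *v L' x) $ i = (\<Sum>j\<in>UNIV - {k}. Z $ i $ j * x $ j)
        + (1 / sqrt \<rho>) *\<^sub>R (b $ i * (sqrt \<rho> *\<^sub>R x $ k + (1 / sqrt \<rho>) *\<^sub>R s))"
      using False by (simp add: L_def Zk' Zi)
    ultimately show ?thesis
      using \<rho> by (simp add: scaleR_add_right distrib_left)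
  qed
  then show ?thesis by (simp add: vec_eq_iff)
qed

lemma inj_L': "L' x = 0 \<Longrightarrow> x = 0"
proof -
  assume 0: "L' x = 0"
  have *: "x $ i = 0" if "i \<noteq> k" for i
    using arg_cong[OF 0, of "\<lambda>y. y $ i"] that by (simp add: L'_def)
  have "(\<Sum>j\<in>UNIV. hconj (b $ j) * x $ j) = 0"
    by (rule sum.neutral) (use * bk in \<open>metis hconj_zero mult_zero_left mult_zero_right\<close>)
  then have "x $ k = 0"
    using arg_cong[OF 0, of "\<lambda>y. y $ k"] \<rho> by (simp add: L'_def)
  with * show "x = 0" by (metis vec_eq_iff zero_index)
qed

lemma surj_L': "surj L'"
proof -
  have "inj L'"
    using inj_L' by (simp add: linear_injective_0[OF linear_L'])
  then show ?thesis
    using linear_injective_imp_surjective[OF linear_L'] by simp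
qed

lemma adj_Y: "adj Y = Y \<longleftrightarrow> adj Z = Z"
proof
  assume A: "adj Y = Y"
  have "hconj (Z $ j $ i) = Z $ i $ j" for i j
  proof (cases "i = k \<or> j = k")
    case False
    then show ?thesis
      using arg_cong[OF A, of "\<lambda>B. B $ i $ j"]
      by (simp add: adj_def Y_def hconj_add hconj_scaleR hconj_mult hconj_hconj)
  qed (auto simp: Zk)
  then show "adj Z = Z" by (simp add: adj_def vec_eq_iff)
next
  assume A: "adj Z = Z"
  have "hconj (Z $ j $ i) = Z $ i $ j" for i j
    using arg_cong[OF A, of "\<lambda>B. B $ i $ j"] by (simp add: adj_def)
  then show "adj Y = Y"
    by (simp add: adj_def vec_eq_iff Y_def hconj_add hconj_scaleR hconj_mult hconj_hconj)
qed

text \<open>\<open>Y\<close> and \<open>Z\<close> are congruent: the quadratic form of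
  \<open>Y\<close> is that of \<open>Z\<close> after the bijective substitution
  \<open>L'\<close>.\<close>

lemma pos_def_Y: "Y \<in> pos_def \<longleftrightarrow> Z \<in> pos_def"
proof -
  have form: "x \<bullet> (Y *v x) = L' x \<bullet> (Z *v L' x)" for x
    using inner_L[of "Z *v L' x" x] by (simp add: Y_mult inner_commute)
  have "(\<forall>x. x \<noteq> 0 \<longrightarrow> x \<bullet> (Y *v x) > 0) \<longleftrightarrow> (\<forall>y. y \<noteq> 0 \<longrightarrow> y \<bullet> (Z *v y) > 0)"
    unfolding form by (metis inj_L' linear_0[OF linear_L'] surjD[OF surj_L'])
  then show ?thesis by (simp add: pos_def_iff adj_Y)
qed

lemma nn_integral_L:
  assumes "h \<in> borel_measurable borel"
  shows "ennreal (sqrt \<rho> ^ DIM('f)) * (\<integral>\<^sup>+x. h (L x) \<partial>lborel) = (\<integral>\<^sup>+x. h x \<partial>lborel)"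
proof -
  define w where "w y = (1 / sqrt \<rho>) *\<^sub>R (\<chi> i. b $ i * y $ k)" for y :: "'f^'m"
  have "linear w"
    by (rule linearI) (simp_all add: w_def vec_eq_iff algebra_simps)
  have "ennreal (sqrt \<rho> ^ card (coord_basis {k} :: ('f^'m) set) * 1 ^ card (coord_basis (- {k}) :: ('f^'m) set)) *
      (\<integral>\<^sup>+x. h (L x) \<partial>lspan (coord_basis {k} \<union> coord_basis (- {k}))) =
      (\<integral>\<^sup>+x. h x \<partial>lspan (coord_basis {k} \<union> coord_basis (- {k})))"
  proof (rule nn_integral_lspan_block)
    show "L \<in> borel_measurable borel" "w \<in> borel_measurable borel"
      by (simp_all add: borel_measurable_linear linear_L \<open>linear w\<close>)
    show "w z \<in> span (coord_basis (- {k}))" for z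
      by (simp add: w_def span_coord_basis bk)
    show "L (z + y) = sqrt \<rho> *\<^sub>R z + 1 *\<^sub>R y + w z"
      if "z \<in> span (coord_basis {k})" "y \<in> span (coord_basis (- {k}))" for z y
      using that by (auto simp: L_def w_def span_coord_basis vec_eq_iff bk)
  qed (use \<rho> assms in \<open>simp_all add: coord_basis_disjoint\<close>)
  then show ?thesis
    by (simp add: coord_basis_compl card_coord_basis_singleton lspan_Basis)
qed

text \<open>\<open>L\<close> feeds coordinate \<open>k\<close> into the others, while
  \<open>L'\<close> feeds the others into coordinate \<open>k\<close>. It is triangular for the
  opposite order of the two blocks, with the same factor.\<close>

lemma nn_integral_L':
  assumes "h \<in> borel_measurable borel"
  shows "ennreal (sqrt \<rho> ^ DIM('f)) * (\<integral>\<^sup>+x. h (L' x) \<partial>lborel) = (\<integral>\<^sup>+x. h x \<partial>lborel)"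
proof -
  define w where "w x = (1 / sqrt \<rho>) *\<^sub>R axis k (\<Sum>j\<in>UNIV. hconj (b $ j) * x $ j)" for x :: "'f^'m"
  have "linear w"
    by (rule linearI) (simp_all add: w_def vec_eq_iff axis_def algebra_simps sum.distrib scaleR_sum_right)
  have "ennreal (1 ^ card (coord_basis (- {k}) :: ('f^'m) set) * sqrt \<rho> ^ card (coord_basis {k} :: ('f^'m) set)) *
      (\<integral>\<^sup>+x. h (L' x) \<partial>lspan (coord_basis (- {k}) \<union> coord_basis {k})) =
      (\<integral>\<^sup>+x. h x \<partial>lspan (coord_basis (- {k}) \<union> coord_basis {k}))"
  proof (rule nn_integral_lspan_block)
    show "L' \<in> borel_measurable borel" "w \<in> borel_measurable borel"
      by (simp_all add: borel_measurable_linear linear_L' \<open>linear w\<close>)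
    show "w z \<in> span (coord_basis {k})" for z
      by (simp add: w_def span_coord_basis axis_def)
    show "L' (z + y) = 1 *\<^sub>R z + sqrt \<rho> *\<^sub>R y + w z"
      if "z \<in> span (coord_basis (- {k}))" "y \<in> span (coord_basis {k})" for z y
    proof -
      have "hconj (b $ j) * (z $ j + y $ j) = hconj (b $ j) * z $ j" for j
        using that bk by (cases "j = k") (auto simp: span_coord_basis)
      then have "(\<Sum>j\<in>UNIV. hconj (b $ j) * (z $ j + y $ j)) = (\<Sum>j\<in>UNIV. hconj (b $ j) * z $ j)"
        by (simp only:)
      then show ?thesis
        using that by (auto simp: L'_def w_def span_coord_basis vec_eq_iff axis_def)
    qed
  qed (use \<rho> assms in \<open>simp_all add: coord_basis_disjoint\<close>)
  then show ?thesis
    by (simp add: coord_basis_compl card_coord_basis_singleton lspan_Basis)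
qed

text \<open>Volume factors multiply along the factorisation of \<open>Y\<close>: \<open>L\<close>
  and \<open>L'\<close> contribute \<open>sqrt \<rho> ^ DIM('f)\<close> each, and \<open>Z\<close>
  its own determinant.\<close>

lemma hdet_Y:
  assumes Z: "Z \<in> pos_def"
  shows "hdet Y = \<rho> * hdet Z"
proof (rule hdet_eqI)
  show "Y \<in> pos_def" using Z by (simp add: pos_def_Y)
  show "0 < \<rho> * hdet Z" using \<rho> hdet_pos[OF Z] by simp
  fix h :: "'f^'m \<Rightarrow> ennreal" assume h: "h \<in> borel_measurable borel"
  have 1: "(\<lambda>x. h (L x)) \<in> borel_measurable borel"
    by (rule measurable_compose[OF borel_measurable_linear[OF linear_L] h])
  have 2: "(\<lambda>x. h (L (Z *v x))) \<in> borel_measurable borel"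
    by (rule measurable_compose[OF borel_measurable_linear[OF linear_mult_vec] 1])
  have "(\<rho> * hdet Z) ^ DIM('f) = (sqrt \<rho> ^ DIM('f)) * hdet Z ^ DIM('f) * (sqrt \<rho> ^ DIM('f))"
    using \<rho> by (simp add: mult.commute mult.left_commute flip: power_mult_distrib)
  then have "ennreal ((\<rho> * hdet Z) ^ DIM('f)) * (\<integral>\<^sup>+x. h (Y *v x) \<partial>lborel) =
     ennreal (sqrt \<rho> ^ DIM('f)) * (ennreal (hdet Z ^ DIM('f)) * (ennreal (sqrt \<rho> ^ DIM('f)) * (\<integral>\<^sup>+x. h (L (Z *v L' x)) \<partial>lborel)))"
    using \<rho> hdet_pos[OF Z] by (simp add: Y_mult ennreal_mult mult.assoc)
  also have "\<dots> = ennreal (sqrt \<rho> ^ DIM('f)) * (ennreal (hdet Z ^ DIM('f)) * (\<integral>\<^sup>+x. h (L (Z *v x)) \<partial>lborel))"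
    using nn_integral_L'[OF 2] by simp
  also have "\<dots> = ennreal (sqrt \<rho> ^ DIM('f)) * (\<integral>\<^sup>+x. h (L x) \<partial>lborel)"
    using nn_integral_pos_def_mult[OF Z 1] by simp
  also have "\<dots> = (\<integral>\<^sup>+x. h x \<partial>lborel)"
    by (rule nn_integral_L[OF h])
  finally show "ennreal ((\<rho> * hdet Z) ^ DIM('f)) * (\<integral>\<^sup>+x. h (Y *v x) \<partial>lborel) = (\<integral>\<^sup>+x. h x \<partial>lborel)" .
qed

end

section \<open>Sesquilinear form on rows and rotations\<close>

text \<open>The entries of \<open>T ** adj T\<close> are the values of this form on the rows of
  \<open>T\<close>. It is linear for multiplication from the left, and it is invariant under unit
  factors from the right, which is the side on which columns are rotated.\<close>

definition hform :: "'f::conj_algebra^'n \<Rightarrow> 'f^'n \<Rightarrow> 'f" where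
  "hform x y = (\<Sum>j\<in>UNIV. x $ j * hconj (y $ j))"

lemma hform_add_left: "hform (x + y) z = hform x z + hform y z"
  and hform_add_right: "hform z (x + y) = hform z x + hform z y"
  and hform_diff_left: "hform (x - y) z = hform x z - hform y z"
  and hform_diff_right: "hform z (x - y) = hform z x - hform z y"
  and hform_scaleR_left: "hform (r *\<^sub>R x) z = r *\<^sub>R hform x z"
  and hform_scaleR_right: "hform z (r *\<^sub>R x) = r *\<^sub>R hform z x"
  by (simp_all add: hform_def hconj_add hconj_diff hconj_scaleR algebra_simps sum.distrib sum_subtractf scaleR_sum_right)

lemma hform_zero [simp]: "hform 0 x = 0" "hform x 0 = 0"
  by (simp_all add: hform_def)

lemma hconj_hform: "hconj (hform x y) = hform y x"
  by (simp add: hform_def hconj_sum hconj_mult hconj_hconj)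

lemma hform_self: "hform x x = of_real (x \<bullet> x)"
  by (simp add: hform_def inner_vec_eq mult_hconj of_real_def scaleR_sum_left)

lemma hform_axis_right: "hform x (axis j a) = x $ j * hconj a"
  by (simp add: hform_def axis_def if_distrib[of hconj] if_distrib[of "\<lambda>c. _ * c"] cong: if_cong)

lemma hform_mult_left: "hform (\<chi> j. a * x $ j) y = a * hform x y"
  by (simp add: hform_def sum_distrib_left mult.assoc)

lemma hform_mult_right: "hform x (\<chi> j. a * y $ j) = hform x y * hconj a"
  by (simp add: hform_def sum_distrib_right mult.assoc hconj_mult)

text \<open>The real inner product is the real part of the form, so maps preserving the form are
  isometries.\<close>

lemma hform_inner:
  assumes "hform x y = hform x' y'"
  shows "x \<bullet> y = x' \<bullet> y'"
proof -
  have "(2 * (u \<bullet> v)) *\<^sub>R 1 = hform u v + hform v u" for u v :: "'a^'n"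
    by (simp add: inner_vec_eq hform_def sum_distrib_left scaleR_sum_left inner_hconj_polar sum.distrib)
  moreover have "hform y x = hform y' x'"
    using assms hconj_hform by metis
  ultimately have "(2 * (x \<bullet> y)) *\<^sub>R (1 :: 'a) = (2 * (x' \<bullet> y')) *\<^sub>R 1"
    using assms by metis
  then show ?thesis by simp
qed

text \<open>A Householder reflection followed by a unit factor in coordinate \<open>k\<close>.\<close>

lemma hform_rotation:
  fixes v :: "'f::conj_algebra^'n"
  assumes k: "k \<in> J" and supp: "\<And>j. j \<notin> J \<Longrightarrow> v $ j = 0"
  obtains R where "linear R" "\<And>x y. hform (R x) (R y) = hform x y" "R v = norm v *\<^sub>R axis k 1"
    "\<And>x j. (\<And>j. j \<notin> J \<Longrightarrow> x $ j = 0) \<Longrightarrow> j \<notin> J \<Longrightarrow> R x $ j = 0"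
proof (cases "v = 0")
  case True
  then show thesis by (intro that[of "\<lambda>x. x"]) (auto simp: linear_id[unfolded id_def])
next
  case v: False
  \<comment> \<open>\<open>\<alpha>\<close> has the length of \<open>v\<close> and the phase of
    \<open>v $ k\<close>, which makes \<open>hform v (axis k \<alpha>)\<close> real. A reflection
    over noncommuting scalars sends \<open>v\<close> to \<open>axis k \<alpha>\<close> only under
    such a condition. If \<open>v $ k = 0\<close>, any phase will do.\<close>
  define \<alpha> where "\<alpha> = (if v $ k = 0 then of_real (norm v) else (norm v / norm (v $ k)) *\<^sub>R v $ k)"
  define p where "p = norm v * norm (v $ k)"
  define w where "w = v - axis k \<alpha>"
  define s where "s = v \<bullet> v - p"
  \<comment> \<open>If \<open>v\<close> already equals \<open>axis k \<alpha>\<close>, then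
    \<open>w = 0\<close>, division by zero gives \<open>c = 0\<close>, and \<open>R1\<close> is the
    identity; the identities below include this case.\<close>
  define c where "c = 2 / (w \<bullet> w)"
  have norm_\<alpha>: "norm \<alpha> = norm v" by (simp add: \<alpha>_def)
  have \<alpha>\<alpha>: "\<alpha> * hconj \<alpha> = of_real (v \<bullet> v)" "hconj \<alpha> * \<alpha> = of_real (v \<bullet> v)"
    using norm_\<alpha> by (simp_all add: mult_hconj hconj_mult_self of_real_def dot_square_norm)
  have p1: "v $ k * hconj \<alpha> = of_real p"
    by (simp add: \<alpha>_def p_def hconj_scaleR mult_hconj of_real_def dot_square_norm power2_eq_square)
  then have p2: "\<alpha> * hconj (v $ k) = of_real p"
    by (metis hconj_hconj hconj_mult hconj_of_real)
  have vw: "hform v w = of_real s"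
    by (simp add: w_def hform_diff_right hform_self hform_axis_right p1 s_def)
  have "hform w w = of_real (2 * s)"
  proof -
    have "hform w (axis k \<alpha>) = of_real p - of_real (v \<bullet> v)"
      by (simp add: hform_axis_right w_def left_diff_distrib p1 \<alpha>\<alpha>)
    moreover have "hform w v = of_real s"
      using vw by (metis hconj_hform hconj_of_real)
    ultimately have "hform w w = of_real (s - (p - v \<bullet> v))"
      by (subst (2) w_def) (simp add: hform_diff_right)
    also have "s - (p - v \<bullet> v) = 2 * s" by (simp add: s_def)
    finally show ?thesis .
  qed
  then have ww: "w \<bullet> w = 2 * s"
    by (simp only: hform_self of_real_eq_iff)
  define R1 where "R1 x = x - c *\<^sub>R (\<chi> j. hform x w * w $ j)" for x
  \<comment> \<open>Chosen so that \<open>\<alpha> * u\<close> is the real number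
    \<open>norm v\<close>.\<close>
  define u where "u = (1 / norm v) *\<^sub>R hconj \<alpha>"
  define R2 where "R2 x = (\<chi> j. if j = k then x $ j * u else x $ j)" for x :: "'f^'n"
  have uu: "u * hconj u = 1"
    unfolding u_def hconj_scaleR hconj_hconj mult_scaleR_left mult_scaleR_right \<alpha>\<alpha>
    using v by (simp add: of_real_def dot_square_norm power2_eq_square)
  have lin1: "linear R1"
    by (rule linearI) (simp_all add: R1_def vec_eq_iff algebra_simps hform_add_left hform_scaleR_left)
  have lin2: "linear R2"
    by (rule linearI) (simp_all add: R2_def vec_eq_iff algebra_simps)
  have form1: "hform (R1 x) (R1 y) = hform x y" for x y
  proof -
    define q where "q = hform x w * hform w y"
    have "hform x (\<chi> j. hform y w * w $ j) = q" "hform (\<chi> j. hform x w * w $ j) y = q"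
      by (simp_all add: hform_mult_left hform_mult_right hconj_hform q_def)
    moreover have "hform (\<chi> j. hform x w * w $ j) (\<chi> j. hform y w * w $ j) = (w \<bullet> w) *\<^sub>R q"
      unfolding hform_mult_left hform_mult_right hconj_hform hform_self q_def
      by (simp add: of_real_def)
    ultimately have "hform (R1 x) (R1 y) = hform x y - c *\<^sub>R q - (c *\<^sub>R q - (c * c * (w \<bullet> w)) *\<^sub>R q)"
      by (simp add: R1_def hform_diff_left hform_diff_right hform_scaleR_left hform_scaleR_right scaleR_diff_right)
    also have "c * c * (w \<bullet> w) = 2 * c" by (simp add: c_def)
    finally show ?thesis by (simp add: scaleR_2 flip: scaleR_scaleR)
  qed
  have form2: "hform (R2 x) (R2 y) = hform x y" for x y
    unfolding hform_def
  proof (rule sum.cong)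
    fix j
    have "x $ j * u * hconj (y $ j * u) = x $ j * (u * hconj u) * hconj (y $ j)"
      by (simp add: hconj_mult mult.assoc)
    then show "R2 x $ j * hconj (R2 y $ j) = x $ j * hconj (y $ j)"
      by (auto simp: R2_def uu)
  qed simp
  have R1v: "R1 v = axis k \<alpha>"
  proof -
    have "c *\<^sub>R (\<chi> j. hform v w * w $ j) = (c * s) *\<^sub>R w"
      by (simp add: vw vec_eq_iff of_real_def)
    also have "\<dots> = w"
    proof (cases "s = 0")
      case True
      then have "w \<bullet> w = 0" using ww by simp
      then show ?thesis by simp
    qed (simp add: c_def ww)
    finally show ?thesis by (simp add: R1_def w_def)
  qed
  have R2v: "R2 (axis k \<alpha>) = norm v *\<^sub>R axis k 1"
    using v by (simp add: R2_def vec_eq_iff axis_def u_def \<alpha>\<alpha> dot_square_norm power2_eq_square of_real_def)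
  show thesis
  proof (rule that[of "R2 \<circ> R1"])
    show "linear (R2 \<circ> R1)" by (rule linear_compose[OF lin1 lin2])
    show "hform ((R2 \<circ> R1) x) ((R2 \<circ> R1) y) = hform x y" for x y
      by (simp add: form1 form2)
    show "(R2 \<circ> R1) v = norm v *\<^sub>R axis k 1"
      by (simp add: R1v R2v)
    show "(R2 \<circ> R1) x $ j = 0" if x: "\<And>j. j \<notin> J \<Longrightarrow> x $ j = 0" and j: "j \<notin> J" for x j
    proof -
      have "j \<noteq> k" using j k by auto
      then have "w $ j = 0" using supp[OF j] by (simp add: w_def axis_def)
      then show ?thesis using x[OF j] \<open>j \<noteq> k\<close> by (simp add: R2_def R1_def)
    qed
  qed
qed

section \<open>The image of Lebesgue measure under the Gram map\<close>

lemma axis_component: "axis k a $ i = (if i = k then a else 0)"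
  by (simp add: axis_def)

definition sym_col :: "'m::finite \<Rightarrow> 'f::conj_algebra^'m \<Rightarrow> 'f^'m^'m" where
  "sym_col k a = (\<chi> i j. (if j = k then a $ i else 0) + (if i = k then hconj (a $ j) else 0))"

text \<open>The real coordinate vectors behind \<open>herm_of\<close>, restricted to the block
  \<open>S\<close>. Those above the diagonal have norm \<open>sqrt 2\<close>, as each fills two
  entries; \<open>lspan\<close> of this set is therefore not the Euclidean volume of the Hermitian
  matrices but the measure of the theorem.\<close>

definition herm_basis :: "'m::{finite,linorder} set \<Rightarrow> ('f::conj_algebra^'m::{finite,linorder}^'m::{finite,linorder}) set" where
  "herm_basis S = (\<lambda>i. axis i (axis i 1)) ` S \<union> (\<Union>k\<in>S. sym_col k ` coord_basis {i \<in> S. i < k})"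

lemma linear_sym_col: "linear (sym_col k)"
  by (rule linearI) (simp_all add: sym_col_def vec_eq_iff hconj_add hconj_scaleR algebra_simps)

lemma inj_on_sym_col: "inj_on (sym_col k) (coord_basis (- {k}))"
proof (rule inj_onI)
  fix a b assume ab: "a \<in> coord_basis (- {k})" "b \<in> coord_basis (- {k})" "sym_col k a = sym_col k b"
  then have k: "a $ k = 0" "b $ k = 0"
    using span_base[of _ "coord_basis (- {k})"] unfolding span_coord_basis by auto
  have "a $ i = b $ i" for i
    using k arg_cong[OF ab(3), of "\<lambda>X. X $ i $ k"] by (cases "i = k") (simp_all add: sym_col_def)
  then show "a = b" by (simp add: vec_eq_iff)
qed

lemma coord_basis_mono: "S \<subseteq> T \<Longrightarrow> coord_basis S \<subseteq> coord_basis T"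
  by (auto simp: coord_basis_def)

lemma finite_herm_basis [simp]: "finite (herm_basis S)"
  by (simp add: herm_basis_def)

text \<open>Since coordinates are taken above the diagonal, a new largest index adds one diagonal
  entry and one complete column. This dictates that the induction inserts indices in increasing
  order.\<close>

lemma herm_basis_insert:
  assumes "\<And>i. i \<in> S \<Longrightarrow> i < k"
  shows "herm_basis (insert k S) = herm_basis S \<union> ({axis k (axis k 1)} \<union> sym_col k ` coord_basis S)"
proof -
  have "{i \<in> insert k S. i < k} = S" using assms by auto
  moreover have "{i \<in> insert k S. i < j} = {i \<in> S. i < j}" if "j \<in> S" for j
    using assms[OF that] by auto
  ultimately show ?thesis by (auto simp: herm_basis_def)
qed

lemma span_herm_basis_supp:
  fixes S :: "'m::{finite,linorder} set" and X :: "(('f::conj_algebra, 'm) vec, 'm) vec"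
  assumes "X \<in> span (herm_basis S)" "i \<notin> S \<or> j \<notin> S"
  shows "X $ i $ j = 0"
proof -
  have "X \<in> {X. \<forall>i j. i \<notin> S \<or> j \<notin> S \<longrightarrow> X $ i $ j = 0}"
  proof (rule span_induct[OF assms(1)])
    show "subspace {X :: (('f, 'm) vec, 'm) vec. X \<in> {X. \<forall>i j. i \<notin> S \<or> j \<notin> S \<longrightarrow> X $ i $ j = 0}}"
      by (auto simp: subspace_def)
    fix X :: "(('f, 'm) vec, 'm) vec" assume "X \<in> herm_basis S"
    then show "X \<in> {X. \<forall>i j. i \<notin> S \<or> j \<notin> S \<longrightarrow> X $ i $ j = 0}"
      by (auto simp: herm_basis_def sym_col_def axis_component coord_basis_def)
  qed
  then show ?thesis using assms(2) by blast
qed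

lemma herm_basis_insert_disjoint:
  fixes S :: "'m::{finite,linorder} set"
  assumes k: "\<And>i. i \<in> S \<Longrightarrow> i < k"
  shows "(herm_basis S :: (('f::conj_algebra, 'm) vec, 'm) vec set) \<inter> ({axis k (axis k 1)} \<union> sym_col k ` coord_basis S) = {}"
    and "(axis k (axis k 1) :: (('f, 'm) vec, 'm) vec) \<notin> sym_col k ` coord_basis S"
proof -
  have kS: "k \<notin> S" using k by blast
  have supp: "X $ i $ k = 0" if "X \<in> herm_basis S" for X :: "(('f, 'm) vec, 'm) vec" and i
    using span_herm_basis_supp[OF span_base[OF that]] kS by blast
  have "axis k (axis k 1) \<notin> (herm_basis S :: ((('f, 'm) vec, 'm) vec) set)"
    using supp[of "axis k (axis k 1)" k] by (auto simp: axis_component)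
  moreover have "sym_col k a \<notin> herm_basis S" if aS: "a \<in> coord_basis S" for a :: "('f, 'm) vec"
  proof
    assume "sym_col k a \<in> herm_basis S"
    from supp[OF this] have "sym_col k a $ i $ k = 0" for i .
    moreover obtain i u where a: "a = axis i u" "i \<in> S" "u \<in> Basis"
      using aS by (auto simp: coord_basis_def)
    moreover have "i \<noteq> k" using a(2) kS by auto
    ultimately have "u = 0" by (auto simp: sym_col_def axis_component dest!: meta_spec[of _ i])
    then show False using a(3) by simp
  qed
  ultimately show "herm_basis S \<inter> ({axis k (axis k 1)} \<union> sym_col k ` coord_basis S) = ({} :: ((('f, 'm) vec, 'm) vec) set)"
    by auto
  have "(axis k (axis k 1) :: (('f, 'm) vec, 'm) vec) \<noteq> sym_col k a" if "a \<in> coord_basis S" for a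
  proof
    assume eq: "axis k (axis k 1) = sym_col k a"
    have "a $ k = 0" using that kS by (auto simp: coord_basis_def axis_component)
    then show False using arg_cong[OF eq, of "\<lambda>X. X $ k $ k"] by (simp add: sym_col_def axis_component)
  qed
  then show "(axis k (axis k 1) :: (('f, 'm) vec, 'm) vec) \<notin> sym_col k ` coord_basis S" by auto
qed

text \<open>Diagonal entries are real by \<open>hconj_fixed_real\<close>, and those above the
  diagonal determine those below. The purpose is to admit \<open>outer a\<close> as a translation
  for the measure on Hermitian blocks.\<close>

lemma hermitian_in_span:
  fixes X :: "(('f::conj_algebra, 'm::{finite,linorder}) vec, 'm) vec"
  assumes adj: "adj X = X" and supp: "\<And>i j. i \<notin> S \<or> j \<notin> S \<Longrightarrow> X $ i $ j = 0"
  shows "X \<in> span (herm_basis S)"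
proof -
  have adj': "hconj (X $ j $ i) = X $ i $ j" for i j
    using arg_cong[OF adj, of "\<lambda>B. B $ i $ j"] by (simp add: adj_def)
  define d where "d i = X $ i $ i \<bullet> 1" for i
  have d: "X $ i $ i = of_real (d i)" for i
  proof -
    obtain r where "X $ i $ i = of_real r"
      using hconj_fixed_real[OF adj'[of i i]] by (auto elim: Reals_cases)
    then show ?thesis by (simp add: d_def of_real_def dot_square_norm)
  qed
  define a where "a k = (\<chi> i. if i < k then X $ i $ k else 0)" for k
  define X' where "X' = (\<Sum>k\<in>S. d k *\<^sub>R axis k (axis k 1)) + (\<Sum>k\<in>S. sym_col k (a k))"
  have fin: "finite S" by simp
  have "X $ p $ q = X' $ p $ q" for p q
  proof -
    have 1: "(\<Sum>k\<in>S. d k *\<^sub>R axis k (axis k 1)) $ p $ q = (if p = q \<and> p \<in> S then of_real (d p) else (0 :: 'f))"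
    proof -
      have "(\<Sum>k\<in>S. d k *\<^sub>R axis k (axis k 1)) $ p $ q = (\<Sum>k\<in>S. if k = p then (if p = q then of_real (d p) else (0 :: 'f)) else 0)"
        unfolding sum_component by (intro sum.cong) (auto simp: axis_component of_real_def)
      then show ?thesis by (simp add: fin)
    qed
    have 2: "(\<Sum>k\<in>S. sym_col k (a k)) $ p $ q = (if q \<in> S then a q $ p else 0) + (if p \<in> S then hconj (a p $ q) else 0)"
    proof -
      have "(\<Sum>k\<in>S. sym_col k (a k)) $ p $ q = (\<Sum>k\<in>S. if k = q then a q $ p else 0) + (\<Sum>k\<in>S. if k = p then hconj (a p $ q) else 0)"
        unfolding sum_component sum.distrib[symmetric] by (intro sum.cong) (auto simp: sym_col_def)
      then show ?thesis by (simp add: fin)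
    qed
    show ?thesis
      unfolding X'_def vector_add_component 1 2
      using supp[of p q] d[of p] adj'[of p q, symmetric]
      by (cases p q rule: linorder_cases) (auto simp: a_def hconj_hconj)
  qed
  then have "X = X'" by (simp add: vec_eq_iff)
  moreover have "sym_col k (a k) \<in> span (herm_basis S)" if k: "k \<in> S" for k
  proof -
    have "a k \<in> span (coord_basis {i \<in> S. i < k})"
      using supp by (auto simp: span_coord_basis a_def)
    then have "sym_col k (a k) \<in> span (sym_col k ` coord_basis {i \<in> S. i < k})"
      by (simp add: linear_span_image[OF linear_sym_col])
    also have "\<dots> \<subseteq> span (herm_basis S)"
      using k by (intro span_mono) (auto simp: herm_basis_def)
    finally show ?thesis .
  qed
  moreover have "axis k (axis k 1) \<in> herm_basis S" if "k \<in> S" for k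
    using that by (simp add: herm_basis_def)
  ultimately show ?thesis
    unfolding X'_def by (metis (no_types, lifting) span_add span_sum span_scale span_base)
qed

section \<open>Coordinates of rectangular blocks\<close>

definition mat_basis :: "'m::finite set \<Rightarrow> 'n::finite set \<Rightarrow> ('f::euclidean_space^'n^'m) set" where
  "mat_basis S J = (\<Union>i\<in>S. axis i ` coord_basis J)"

lemma mat_basis_UNIV: "mat_basis UNIV UNIV = Basis"
  by (auto simp: mat_basis_def Basis_vec_def coord_basis_UNIV)

lemma mat_basis_subset: "mat_basis S J \<subseteq> Basis"
  using coord_basis_subset by (fastforce simp: mat_basis_def Basis_vec_def)

lemma orthonormal_mat_basis: "orthonormal (mat_basis S J)"
  by (rule orthonormal_subset[OF orthonormal_Basis mat_basis_subset])

lemma finite_mat_basis [simp]: "finite (mat_basis S J)"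
  using orthonormal_mat_basis by (rule orthonormal_finite)

lemma span_mat_basis:
  "span (mat_basis S J) = {T :: 'f::euclidean_space^'n^'m. \<forall>i j. i \<notin> S \<or> j \<notin> J \<longrightarrow> T $ i $ j = 0}"
proof (intro equalityI span_minimal subsetI)
  show "subspace {T :: 'f^'n^'m. \<forall>i j. i \<notin> S \<or> j \<notin> J \<longrightarrow> T $ i $ j = 0}"
    by (auto simp: subspace_def)
  show "x \<in> {T. \<forall>i j. i \<notin> S \<or> j \<notin> J \<longrightarrow> T $ i $ j = 0}" if "x \<in> mat_basis S J" for x :: "'f^'n^'m"
    using that by (auto simp: mat_basis_def coord_basis_def axis_component)
  fix x :: "'f^'n^'m" assume x: "x \<in> {T. \<forall>i j. i \<notin> S \<or> j \<notin> J \<longrightarrow> T $ i $ j = 0}"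
  have "x \<bullet> b = 0" if b: "b \<in> Basis - mat_basis S J" for b
  proof -
    obtain i j u where u: "b = axis i (axis j u)" "u \<in> Basis"
      using b by (auto simp: Basis_vec_def)
    then have "i \<notin> S \<or> j \<notin> J" using b by (auto simp: mat_basis_def coord_basis_def)
    then show ?thesis using x u by (auto simp: inner_axis)
  qed
  then have "(\<Sum>b\<in>Basis. (x \<bullet> b) *\<^sub>R b) = (\<Sum>b\<in>mat_basis S J. (x \<bullet> b) *\<^sub>R b)"
    by (intro sum.mono_neutral_right) (use mat_basis_subset[of S J] in auto)
  then have "x = (\<Sum>b\<in>mat_basis S J. (x \<bullet> b) *\<^sub>R b)"
    by (simp add: euclidean_representation)
  then show "x \<in> span (mat_basis S J)"
    by (metis (no_types, lifting) span_base span_scale span_sum)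
qed

lemma linear_axis: "linear (axis k)"
  by (rule linearI) (simp_all add: axis_component vec_eq_iff)

definition col_mat :: "'n::finite \<Rightarrow> 'f::euclidean_space^'m::finite \<Rightarrow> 'f^'n^'m" where
  "col_mat j a = (\<chi> i. axis j (a $ i))"

lemma linear_col_mat: "linear (col_mat j)"
  by (rule linearI) (simp_all add: col_mat_def axis_component vec_eq_iff)

lemma Basis_disjointI:
  assumes "A \<subseteq> Basis" "\<And>x. x \<in> A \<Longrightarrow> x \<in> span B \<Longrightarrow> x = 0"
  shows "A \<inter> B = {}"
  using assms span_base nonzero_Basis by blast

lemma nn_integral_mat_basis_row:
  fixes h :: "'f::euclidean_space^'n^'m \<Rightarrow> ennreal"
  assumes k: "k \<notin> S" and [measurable]: "h \<in> borel_measurable borel"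
  shows "(\<integral>\<^sup>+T. h T \<partial>lspan (mat_basis (insert k S) J)) =
    (\<integral>\<^sup>+v. \<integral>\<^sup>+T. h (axis k v + T) \<partial>lspan (mat_basis S J) \<partial>lspan (coord_basis J))"
proof -
  have eq: "mat_basis (insert k S) J = axis k ` coord_basis J \<union> (mat_basis S J :: ('f^'n^'m) set)"
    by (simp add: mat_basis_def)
  have disj: "axis k ` coord_basis J \<inter> (mat_basis S J :: ('f^'n^'m) set) = {}"
  proof (rule Basis_disjointI)
    show "axis k ` coord_basis J \<subseteq> (Basis :: ('f^'n^'m) set)"
      using mat_basis_subset[of "{k}" J, where 'a='f] by (simp add: mat_basis_def)
    fix x :: "'f^'n^'m" assume x: "x \<in> axis k ` coord_basis J" "x \<in> span (mat_basis S J)"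
    then obtain v where v: "x = axis k v" by blast
    have "x $ k = 0" using x(2) k by (simp add: span_mat_basis vec_eq_iff)
    then show "x = 0" by (simp add: v axis_component vec_eq_iff)
  qed
  have inj: "inj_on (axis k) (coord_basis J :: ('f^'n) set)"
    by (rule inj_onI) (auto simp: axis_eq_axis)
  have "(\<lambda>x. \<integral>\<^sup>+T. h (x + T) \<partial>lspan (mat_basis S J)) \<in> borel_measurable borel"
    by (rule borel_measurable_nn_integral_lspan) simp_all
  then show ?thesis
    unfolding eq by (simp add: nn_integral_lspan_Un[OF _ _ disj] nn_integral_lspan_image[OF _ linear_axis inj])
qed

lemma nn_integral_mat_basis_col:
  fixes h :: "'f::euclidean_space^'n^'m \<Rightarrow> ennreal"
  assumes j: "j \<in> J" and [measurable]: "h \<in> borel_measurable borel"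
  shows "(\<integral>\<^sup>+T. h T \<partial>lspan (mat_basis S J)) =
    (\<integral>\<^sup>+a. \<integral>\<^sup>+T. h (col_mat j a + T) \<partial>lspan (mat_basis S (J - {j})) \<partial>lspan (coord_basis S))"
proof -
  have col_axis: "col_mat j (axis i b) = axis i (axis j b)" for i and b :: 'f
    by (simp add: col_mat_def axis_component vec_eq_iff)
  have J: "J = insert j (J - {j})" using j by blast
  have img: "col_mat j ` coord_basis S = (mat_basis S {j} :: ('f^'n^'m) set)"
    by (simp add: coord_basis_def mat_basis_def col_axis image_UN image_image)
  have eq: "mat_basis S J = col_mat j ` coord_basis S \<union> (mat_basis S (J - {j}) :: ('f^'n^'m) set)"
  proof -
    have "coord_basis J = coord_basis {j} \<union> (coord_basis (J - {j}) :: ('f^'n) set)"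
      using J by (metis coord_basis_Un insert_is_Un)
    then show ?thesis unfolding img by (auto simp: mat_basis_def)
  qed
  have disj: "col_mat j ` coord_basis S \<inter> (mat_basis S (J - {j}) :: ('f^'n^'m) set) = {}"
  proof (rule Basis_disjointI)
    show "col_mat j ` coord_basis S \<subseteq> (Basis :: ('f^'n^'m) set)"
      unfolding img by (rule mat_basis_subset)
    fix x :: "'f^'n^'m" assume x: "x \<in> col_mat j ` coord_basis S" "x \<in> span (mat_basis S (J - {j}))"
    then obtain v where v: "x = col_mat j v" by blast
    have "x $ i $ j = 0" for i using x(2) by (simp add: span_mat_basis)
    then have "v $ i = 0" for i by (simp add: v col_mat_def)
    then show "x = 0" by (simp add: v col_mat_def axis_component vec_eq_iff)
  qed
  have inj: "inj_on (col_mat j) (coord_basis S :: ('f^'m) set)"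
    by (rule inj_onI) (auto simp: col_mat_def vec_eq_iff axis_component split: if_splits)
  have "(\<lambda>x. \<integral>\<^sup>+T. h (x + T) \<partial>lspan (mat_basis S (J - {j}))) \<in> borel_measurable borel"
    by (rule borel_measurable_nn_integral_lspan) simp_all
  then show ?thesis
    unfolding eq by (simp add: nn_integral_lspan_Un[OF _ _ disj] nn_integral_lspan_image[OF _ linear_col_mat inj])
qed

section \<open>Gram map, padding and powers of block determinants\<close>

definition gram :: "'f::conj_algebra^'n^'m \<Rightarrow> 'f^'m^'m" where
  "gram T = (\<chi> i j. hform (T $ i) (T $ j))"

lemma gram_eq: "gram T = T ** adj T"
  by (simp add: gram_def hform_def matrix_matrix_mult_def adj_def)

lemma continuous_on_hconj [continuous_intros]:
  fixes f :: "'a::topological_space \<Rightarrow> 'f::conj_algebra"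
  shows "continuous_on A f \<Longrightarrow> continuous_on A (\<lambda>x. hconj (f x))"
  using linear_hconj unfolding linear_conv_bounded_linear by (rule bounded_linear.continuous_on)

lemma borel_measurable_gram [measurable]: "(gram :: 'f::conj_algebra^'n^'m \<Rightarrow> _) \<in> borel_measurable borel"
  unfolding gram_def hform_def
  by (intro borel_measurable_continuous_onI continuous_intros continuous_on_vec_lambda)

definition outer :: "'f::conj_algebra^'m \<Rightarrow> 'f^'m^'m" where
  "outer a = (\<chi> i j. a $ i * hconj (a $ j))"

lemma borel_measurable_outer [measurable]: "(outer :: 'f::conj_algebra^'m \<Rightarrow> _) \<in> borel_measurable borel"
  unfolding outer_def
  by (intro borel_measurable_continuous_onI continuous_intros continuous_on_vec_lambda)

lemmas borel_measurable_sym_col [measurable] = borel_measurable_linear[OF linear_sym_col]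
lemmas borel_measurable_axis [measurable] = borel_measurable_linear[OF linear_axis]
lemmas borel_measurable_col_mat [measurable] = borel_measurable_linear[OF linear_col_mat]

text \<open>Padding makes a block positive definite at full size without changing its determinant.
  Both extremes are used: with \<open>pad UNIV = 0\<close> the full determinant appears, and with
  \<open>pad {} = mat 1\<close> the function \<open>block_power q {}\<close> is the factor |I + F|^q
  of the densities.\<close>

definition pad :: "'m::finite set \<Rightarrow> 'f::conj_algebra^'m^'m" where
  "pad S = (\<chi> i j. if i = j \<and> i \<notin> S then 1 else 0)"

text \<open>The power of the determinant of the block indexed by \<open>S\<close>, which is padded by an identity block.\<close>

definition block_power :: "real \<Rightarrow> 'm::finite set \<Rightarrow> 'f::conj_algebra^'m^'m \<Rightarrow> ennreal" where
  "block_power e S X = (if X + pad S \<in> pos_def then ennreal (hdet (X + pad S) powr e) else 0)"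

lemma borel_measurable_block_power [measurable]:
  "(block_power e S :: 'f::conj_algebra^'m^'m \<Rightarrow> _) \<in> borel_measurable borel"
proof -
  define g where "g = (\<lambda>A :: 'f^'m^'m. if A \<in> pos_def then hdet A else 0)"
  have [measurable]: "g \<in> borel_measurable borel"
    unfolding g_def by (rule borel_measurable_hdet)
  have "block_power e S X = (if X + pad S \<in> pos_def then ennreal (g (X + pad S) powr e) else 0)" for X :: "'f^'m^'m"
    by (simp add: block_power_def g_def)
  then show ?thesis
    by (simp cong: measurable_cong)
qed

text \<open>The 1 that \<open>pad S\<close> puts at position \<open>k\<close> is the placeholder for
  the pivot in the locale \<open>schur\<close>. Both sides vanish together by
  \<open>pos_def_Y\<close>; otherwise \<open>hdet_Y\<close> produces the factor
  \<open>\<rho>\<close>.\<close>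

lemma block_power_schur:
  fixes X :: "(('f::conj_algebra, 'm::{finite,linorder}) vec, 'm) vec"
  assumes k: "k \<notin> S" and \<rho>: "\<rho> > 0"
    and X: "X \<in> span (herm_basis S)" and b: "b \<in> span (coord_basis S)"
  shows "ennreal (\<rho> powr e) * block_power e S (X - (1 / \<rho>) *\<^sub>R outer b) =
    block_power e (insert k S) (X + sym_col k b + \<rho> *\<^sub>R axis k (axis k 1))"
proof -
  define Z where "Z = X - (1 / \<rho>) *\<^sub>R outer b + pad S"
  have b': "b $ i = 0" if "i \<notin> S" for i using b that by (simp add: span_coord_basis)
  note X' = span_herm_basis_supp[OF X]
  interpret schur k b \<rho> Z
    by unfold_locales (use k \<rho> b' X' in \<open>auto simp: Z_def pad_def outer_def\<close>)
  have "Y = X + sym_col k b + \<rho> *\<^sub>R axis k (axis k 1) + pad (insert k S)"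
    unfolding Y_def using k b' X' by (auto simp: Z_def vec_eq_iff pad_def outer_def sym_col_def axis_component of_real_def)
  then show ?thesis
    unfolding block_power_def Z_def[symmetric]
    using pos_def_Y hdet_Y \<rho> by (auto simp: powr_mult ennreal_mult hdet_pos less_imp_le)
qed

text \<open>A positive definite matrix has a positive diagonal. The integral over
  \<open>\<rho>\<close> may thus run over the whole line, as the coordinates of Hermitian matrices
  demand, although a squared norm is never negative.\<close>

lemma block_power_nonpos:
  fixes X :: "(('f::conj_algebra, 'm::{finite,linorder}) vec, 'm) vec"
  assumes k: "k \<notin> S" and \<rho>: "\<rho> \<le> 0"
    and X: "X \<in> span (herm_basis S)" and b: "b \<in> span (coord_basis S)"
  shows "block_power e (insert k S) (X + sym_col k b + \<rho> *\<^sub>R axis k (axis k 1)) = 0"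
proof -
  define Y where "Y = X + sym_col k b + \<rho> *\<^sub>R axis k (axis k 1) + pad (insert k S)"
  have "Y $ k $ k = \<rho> *\<^sub>R 1"
    using span_herm_basis_supp[OF X, of k k] b k
    by (simp add: Y_def sym_col_def span_coord_basis axis_component pad_def)
  then have "(Y *v axis k 1) $ k = \<rho> *\<^sub>R 1"
    by (simp add: matrix_vector_mult_def axis_component if_distrib[of "\<lambda>c. _ * c"] cong: if_cong)
  then have "axis k 1 \<bullet> (Y *v axis k 1) = \<rho>"
    by (simp add: inner_axis' dot_square_norm)
  moreover have "axis k (1::'f) \<noteq> 0" by simp
  ultimately have "Y \<notin> pos_def" using \<rho> unfolding pos_def_iff by (metis not_less)
  then show ?thesis by (simp add: block_power_def Y_def)
qed

section \<open>Induction over the rows\<close>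

text \<open>The product of the constants of \<open>nn_integral_lspan_norm_sq\<close>: when
  \<open>i\<close> columns are already removed, a row has real dimension
  \<open>\<beta> * (N - i)\<close>.\<close>

definition gram_const :: "real \<Rightarrow> nat \<Rightarrow> nat \<Rightarrow> real" where
  "gram_const \<beta> s N = (\<Prod>i<s. pi powr (\<beta> * (real N - real i) / 2) / Gamma (\<beta> * (real N - real i) / 2))"

lemma gram_const_Suc:
  assumes "N > 0"
  shows "gram_const \<beta> (Suc s) N = pi powr (\<beta> * N / 2) / Gamma (\<beta> * N / 2) * gram_const \<beta> s (N - 1)"
  using assms unfolding gram_const_def
  by (subst prod.lessThan_Suc_shift) (simp add: of_nat_diff algebra_simps)

text \<open>\<open>Q\<close> applies a single rotation to all rows, so \<open>gram\<close> does not
  notice it. The support clause of \<open>hform_rotation\<close> keeps \<open>Q\<close> inside the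
  columns \<open>J\<close>, hence it preserves the measure of the remaining rows.\<close>

lemma nn_integral_gram_row:
  fixes h :: "'f::conj_algebra^'m^'m \<Rightarrow> ennreal" and J :: "'n::finite set"
  assumes h [measurable]: "h \<in> borel_measurable borel" and j: "j \<in> J" and v: "v \<in> span (coord_basis J)"
  shows "(\<integral>\<^sup>+T. h (gram (axis k v + T)) \<partial>lspan (mat_basis S J :: ('f^'n^'m) set)) =
     (\<integral>\<^sup>+T. h (gram (axis k (norm v *\<^sub>R axis j 1) + T)) \<partial>lspan (mat_basis S J))"
proof -
  obtain R where R: "linear R" "\<And>x y. hform (R x) (R y) = hform x y" "R v = norm v *\<^sub>R axis j 1"
    "\<And>x i. (\<And>i. i \<notin> J \<Longrightarrow> x $ i = 0) \<Longrightarrow> i \<notin> J \<Longrightarrow> R x $ i = 0"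
    using hform_rotation[OF j, of v] v by (auto simp: span_coord_basis)
  define Q where "Q T = (\<chi> i. R (T $ i))" for T :: "'f^'n^'m"
  have lin: "linear Q"
    by (rule linearI) (simp_all add: Q_def vec_eq_iff linear_add[OF R(1)] linear_scale[OF R(1)])
  have gQ: "gram (Q T) = gram T" for T
    by (simp add: gram_def Q_def R(2))
  have Qax: "Q (axis k v) = axis k (norm v *\<^sub>R axis j 1)"
  proof -
    have "Q (axis k v) $ i = axis k (norm v *\<^sub>R axis j 1) $ i" for i
      by (simp add: Q_def axis_component linear_0[OF R(1)] R(3))
    then show ?thesis by (subst vec_eq_iff) blast
  qed
  have "gram (axis k v + T) = gram (axis k (norm v *\<^sub>R axis j 1) + Q T)" for T
    using gQ[of "axis k v + T"] by (simp add: linear_add[OF lin] Qax)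
  then have "(\<integral>\<^sup>+T. h (gram (axis k v + T)) \<partial>lspan (mat_basis S J :: ('f^'n^'m) set)) =
     (\<integral>\<^sup>+T. h (gram (axis k (norm v *\<^sub>R axis j 1) + Q T)) \<partial>lspan (mat_basis S J))"
    by simp
  also have "\<dots> = (\<integral>\<^sup>+T. h (gram (axis k (norm v *\<^sub>R axis j 1) + T)) \<partial>lspan (mat_basis S J))"
  proof (rule nn_integral_lspan_isometry[OF orthonormal_mat_basis lin])
    show "Q x \<bullet> Q y = x \<bullet> y" for x y
      unfolding inner_vec_eq[of "Q x"] inner_vec_eq[of x]
      by (simp add: Q_def hform_inner[OF R(2)])
    have "Q T \<in> span (mat_basis S J)" if "T \<in> span (mat_basis S J)" for T
      unfolding span_mat_basis
    proof (intro CollectI allI impI)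
      fix i l assume il: "i \<notin> S \<or> l \<notin> J"
      show "Q T $ i $ l = 0"
      proof (cases "i \<in> S")
        case True
        then show ?thesis using that il R(4)[of "T $ i" l] by (simp add: span_mat_basis Q_def)
      next
        case False
        then have "T $ i = 0" using that by (simp add: span_mat_basis vec_eq_iff)
        then show ?thesis by (simp add: Q_def linear_0[OF R(1)])
      qed
    qed
    then show "Q ` mat_basis S J \<subseteq> span (mat_basis S J)" by (auto intro: span_base)
  qed measurable
  finally show ?thesis .
qed

text \<open>Column \<open>j\<close> of \<open>T\<close> is zero, so \<open>axis j\<close> is
  orthogonal to all rows of \<open>T\<close>: the cross terms vanish and the contributions of column
  \<open>j\<close> and of \<open>T\<close> add.\<close>

lemma gram_split:
  fixes T :: "'f::conj_algebra^'n^'m"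
  assumes k: "k \<notin> S" and \<rho>: "\<rho> \<ge> 0" and a: "a \<in> span (coord_basis S)" and T: "T \<in> span (mat_basis S (J - {j}))"
  shows "gram (axis k (sqrt \<rho> *\<^sub>R axis j 1) + (col_mat j a + T)) =
    gram T + outer a + sym_col k (sqrt \<rho> *\<^sub>R a) + \<rho> *\<^sub>R axis k (axis k 1)"
proof -
  have ak: "a $ k = 0" using a k by (simp add: span_coord_basis)
  have Tk: "T $ k = 0" using T k by (simp add: span_mat_basis vec_eq_iff)
  have Tj: "T $ i $ j = 0" for i using T by (simp add: span_mat_basis)
  define W where "W = axis k (sqrt \<rho> *\<^sub>R axis j 1) + (col_mat j a + T)"
  have ax: "hform (axis j c) y = c * hconj (y $ j)" for c and y :: "'f^'n"
    by (metis hconj_hconj hconj_hform hconj_mult hform_axis_right)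
  have Wk: "W $ k = axis j (of_real (sqrt \<rho>))"
    by (simp add: W_def col_mat_def ak Tk axis_component vec_eq_iff of_real_def)
  have Wi: "W $ i = axis j (a $ i) + T $ i" if "i \<noteq> k" for i
    using that by (simp add: W_def col_mat_def axis_component vec_eq_iff)
  have "hform (W $ p) (W $ q) = (gram T + outer a + sym_col k (sqrt \<rho> *\<^sub>R a) + \<rho> *\<^sub>R axis k (axis k 1)) $ p $ q" for p q
  proof -
    have rr: "of_real (sqrt \<rho>) * of_real (sqrt \<rho>) = (of_real \<rho> :: 'f)"
      using \<rho> by (simp flip: of_real_mult)
    consider "p = k" "q = k" | "p = k" "q \<noteq> k" | "p \<noteq> k" "q = k" | "p \<noteq> k" "q \<noteq> k" by blast
    then show ?thesis
    proof cases
      case 1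
      then show ?thesis
        by (simp add: Wk ax gram_def Tk outer_def ak sym_col_def axis_component rr) (simp add: of_real_def)
    next
      case 2
      then show ?thesis
        by (simp add: Wk Wi ax Tj gram_def Tk outer_def ak sym_col_def axis_component hconj_add hconj_scaleR)
          (simp add: of_real_def)
    next
      case 3
      then show ?thesis
        by (simp add: Wk Wi hform_axis_right Tj gram_def Tk outer_def ak sym_col_def axis_component)
          (simp add: of_real_def)
    next
      case 4
      then show ?thesis
        by (simp add: Wi hform_add_left hform_add_right ax hform_axis_right Tj gram_def outer_def sym_col_def axis_component)
    qed
  qed
  then show ?thesis
    unfolding W_def[symmetric] by (simp add: gram_def vec_eq_iff)
qed

lemma outer_in_span:
  fixes a :: "('f::conj_algebra, 'm::{finite,linorder}) vec"
  assumes "a \<in> span (coord_basis S)"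
  shows "outer a \<in> span (herm_basis S)"
proof (rule hermitian_in_span)
  show "adj (outer a) = outer a"
    by (simp add: adj_def outer_def vec_eq_iff hconj_mult hconj_hconj)
  show "outer a $ i $ j = 0" if "i \<notin> S \<or> j \<notin> S" for i j
    using that assms by (auto simp: outer_def span_coord_basis)
qed

lemma nn_integral_herm_basis_insert:
  fixes h :: "(('f::conj_algebra, 'm::{finite,linorder}) vec, 'm) vec \<Rightarrow> ennreal"
  assumes k: "\<And>i. i \<in> S \<Longrightarrow> i < k" and [measurable]: "h \<in> borel_measurable borel"
  shows "(\<integral>\<^sup>+X. h X \<partial>lspan (herm_basis (insert k S))) =
    (\<integral>\<^sup>+\<rho>. \<integral>\<^sup>+b. \<integral>\<^sup>+X. h (X + sym_col k b + \<rho> *\<^sub>R axis k (axis k 1))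
      \<partial>lspan (herm_basis S) \<partial>lspan (coord_basis S) \<partial>lborel)"
proof -
  have S: "coord_basis S \<subseteq> coord_basis (- {k})"
    by (rule coord_basis_mono) (use k in auto)
  have inj: "inj_on (sym_col k) (coord_basis S :: (('f, 'm) vec) set)"
    by (rule inj_on_subset[OF inj_on_sym_col S])
  define E where "E = (axis k (axis k 1) :: (('f, 'm) vec, 'm) vec)"
  note disj = herm_basis_insert_disjoint[of S k, OF k, where 'f='f, folded E_def]
  have "(\<integral>\<^sup>+X. h X \<partial>lspan (herm_basis (insert k S))) =
     (\<integral>\<^sup>+X. h X \<partial>lspan (({E} \<union> sym_col k ` coord_basis S) \<union> herm_basis S))"
    by (simp add: herm_basis_insert[OF k] E_def Un_ac)
  also have "\<dots> = (\<integral>\<^sup>+Y. \<integral>\<^sup>+X. h (Y + X) \<partial>lspan (herm_basis S) \<partial>lspan (insert E (sym_col k ` coord_basis S)))"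
    using disj by (subst nn_integral_lspan_Un) auto
  also have "\<dots> = (\<integral>\<^sup>+\<rho>. \<integral>\<^sup>+Y. \<integral>\<^sup>+X. h ((\<rho> *\<^sub>R E + Y) + X) \<partial>lspan (herm_basis S) \<partial>lspan (sym_col k ` coord_basis S) \<partial>lborel)"
    using disj by (subst nn_integral_lspan_insert) (auto intro!: borel_measurable_nn_integral_lspan)
  also have "\<dots> = (\<integral>\<^sup>+\<rho>. \<integral>\<^sup>+b. \<integral>\<^sup>+X. h ((\<rho> *\<^sub>R E + sym_col k b) + X) \<partial>lspan (herm_basis S) \<partial>lspan (coord_basis S) \<partial>lborel)"
    by (subst nn_integral_lspan_image[OF _ linear_sym_col inj]) (auto intro!: borel_measurable_nn_integral_lspan)
  finally show ?thesis
    by (simp add: E_def add_ac)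
qed

text \<open>The premise \<open>IH\<close> quantifies over all integrands because it is applied to a
  shifted version of \<open>h\<close>, which depends on the column \<open>a\<close>.\<close>

lemma nn_integral_gram_step:
  fixes S :: "'m::{finite,linorder} set" and J :: "'n::finite set" and h :: "(('f::conj_algebra, 'm) vec, 'm) vec \<Rightarrow> ennreal"
  defines "\<beta> \<equiv> real DIM('f)"
  assumes k: "\<And>i. i \<in> S \<Longrightarrow> i < k" and j: "j \<in> J" and h [measurable]: "h \<in> borel_measurable borel"
    and e: "e = \<beta> * (real (card J) - real (card S)) / 2 - 1"
    and IH: "\<And>h'. h' \<in> borel_measurable borel \<Longrightarrow>
      (\<integral>\<^sup>+T. h' (gram T) \<partial>lspan (mat_basis S (J - {j}) :: ((('f, 'n) vec, 'm) vec) set)) =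
      C * (\<integral>\<^sup>+X. h' X * block_power e S X \<partial>lspan (herm_basis S))"
  shows "(\<integral>\<^sup>+T. h (gram T) \<partial>lspan (mat_basis (insert k S) J :: ((('f, 'n) vec, 'm) vec) set)) =
     ennreal (pi powr (\<beta> * card J / 2) / Gamma (\<beta> * card J / 2)) * (C *
     (\<integral>\<^sup>+X. h X * block_power e (insert k S) X \<partial>lspan (herm_basis (insert k S))))"
proof -
  have kS: "k \<notin> S" using k by blast
  define E where "E = (axis k (axis k 1) :: (('f, 'm) vec, 'm) vec)"
  define G where "G \<rho> = (\<integral>\<^sup>+T. h (gram (axis k (sqrt \<rho> *\<^sub>R axis j 1) + T)) \<partial>lspan (mat_basis S J :: ((('f, 'n) vec, 'm) vec) set))" for \<rho>
  define H where "H Y = h Y * block_power e (insert k S) Y" for Y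
  define \<Psi> where "\<Psi> \<rho> b = (\<integral>\<^sup>+X. H (X + sym_col k b + \<rho> *\<^sub>R E) \<partial>lspan (herm_basis S))" for \<rho> b
  have [measurable]: "H \<in> borel_measurable borel" unfolding H_def by measurable
  have [measurable]: "G \<in> borel_measurable borel"
    unfolding G_def by measurable
  have \<Psi>m [measurable]: "case_prod \<Psi> \<in> borel_measurable (borel \<Otimes>\<^sub>M borel)"
    unfolding \<Psi>_def by measurable
  have G: "ennreal (\<rho> powr (\<beta> * card J / 2 - 1)) * G \<rho> = C * (\<integral>\<^sup>+b. \<Psi> \<rho> b \<partial>lspan (coord_basis S))" if \<rho>: "\<rho> > 0" for \<rho>
  proof -
    define \<Phi> where "\<Phi> b = (\<integral>\<^sup>+X. h (X + sym_col k b + \<rho> *\<^sub>R E) * block_power e S (X - (1 / \<rho>) *\<^sub>R outer b) \<partial>lspan (herm_basis S))" for b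
    have [measurable]: "\<Phi> \<in> borel_measurable borel"
      unfolding \<Phi>_def by measurable
    have "G \<rho> = (\<integral>\<^sup>+a. \<integral>\<^sup>+T. h (gram (axis k (sqrt \<rho> *\<^sub>R axis j 1) + (col_mat j a + T)))
        \<partial>lspan (mat_basis S (J - {j})) \<partial>lspan (coord_basis S))"
      unfolding G_def by (rule nn_integral_mat_basis_col[OF j]) measurable
    also have "\<dots> = (\<integral>\<^sup>+a. C * \<Phi> (sqrt \<rho> *\<^sub>R a) \<partial>lspan (coord_basis S))"
    proof (rule nn_integral_lspan_cong)
      fix a :: "('f, 'm) vec" assume a: "a \<in> span (coord_basis S)"
      define D where "D = sym_col k (sqrt \<rho> *\<^sub>R a) + \<rho> *\<^sub>R E"
      have "(\<integral>\<^sup>+T. h (gram (axis k (sqrt \<rho> *\<^sub>R axis j 1) + (col_mat j a + T))) \<partial>lspan (mat_basis S (J - {j}) :: ((('f, 'n) vec, 'm) vec) set)) =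
        (\<integral>\<^sup>+T. h (gram T + outer a + D) \<partial>lspan (mat_basis S (J - {j}) :: ((('f, 'n) vec, 'm) vec) set))"
        by (rule nn_integral_lspan_cong) (measurable, use gram_split[OF kS less_imp_le[OF \<rho>] a, of _ J j] in \<open>simp add: D_def E_def add.assoc\<close>)
      also have "\<dots> = C * (\<integral>\<^sup>+X. h (X + outer a + D) * block_power e S X \<partial>lspan (herm_basis S))"
        by (rule IH) measurable
      \<comment> \<open>Translation by \<open>outer a\<close> moves the rank one term from
        \<open>h\<close> into the determinant, where it completes a Schur complement.\<close>
      also have "(\<integral>\<^sup>+X. h (X + outer a + D) * block_power e S X \<partial>lspan (herm_basis S)) =
          (\<integral>\<^sup>+X. h (X + D) * block_power e S (X - outer a) \<partial>lspan (herm_basis S))"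
        using nn_integral_lspan_translate[OF _ outer_in_span[OF a], of "\<lambda>X. h (X + D) * block_power e S (X - outer a)"]
        by simp
      also have "outer a = (1 / \<rho>) *\<^sub>R outer (sqrt \<rho> *\<^sub>R a)"
        using \<rho> by (simp add: outer_def vec_eq_iff hconj_scaleR)
      finally show "(\<integral>\<^sup>+T. h (gram (axis k (sqrt \<rho> *\<^sub>R axis j 1) + (col_mat j a + T))) \<partial>lspan (mat_basis S (J - {j}) :: ((('f, 'n) vec, 'm) vec) set)) =
          C * \<Phi> (sqrt \<rho> *\<^sub>R a)"
        by (simp add: \<Phi>_def D_def add.assoc)
    qed measurable
    also have "\<dots> = C * (\<integral>\<^sup>+a. \<Phi> (sqrt \<rho> *\<^sub>R a) \<partial>lspan (coord_basis S))"
      by (rule nn_integral_cmult) measurable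
    finally have Geq: "G \<rho> = C * (\<integral>\<^sup>+a. \<Phi> (sqrt \<rho> *\<^sub>R a) \<partial>lspan (coord_basis S))" .
    have scale: "ennreal (sqrt \<rho> ^ card (coord_basis S :: (('f, 'm) vec) set)) * (\<integral>\<^sup>+a. \<Phi> (sqrt \<rho> *\<^sub>R a) \<partial>lspan (coord_basis S)) =
        (\<integral>\<^sup>+b. \<Phi> b \<partial>lspan (coord_basis S))"
      by (rule nn_integral_lspan_scaleR) (use \<rho> in auto)
    have \<Phi>\<Psi>: "(\<integral>\<^sup>+b. ennreal (\<rho> powr e) * \<Phi> b \<partial>lspan (coord_basis S)) = (\<integral>\<^sup>+b. \<Psi> \<rho> b \<partial>lspan (coord_basis S))"
    proof (rule nn_integral_lspan_cong)
      fix b :: "('f, 'm) vec" assume b: "b \<in> span (coord_basis S)"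
      have "ennreal (\<rho> powr e) * \<Phi> b = (\<integral>\<^sup>+X. ennreal (\<rho> powr e) *
          (h (X + sym_col k b + \<rho> *\<^sub>R E) * block_power e S (X - (1 / \<rho>) *\<^sub>R outer b)) \<partial>lspan (herm_basis S))"
        unfolding \<Phi>_def by (rule nn_integral_cmult[symmetric]) measurable
      also have "\<dots> = \<Psi> \<rho> b"
        unfolding \<Psi>_def
      proof (rule nn_integral_lspan_cong)
        fix X :: "(('f, 'm) vec, 'm) vec" assume X: "X \<in> span (herm_basis S)"
        show "ennreal (\<rho> powr e) * (h (X + sym_col k b + \<rho> *\<^sub>R E) * block_power e S (X - (1 / \<rho>) *\<^sub>R outer b)) =
            H (X + sym_col k b + \<rho> *\<^sub>R E)"
          unfolding H_def E_def block_power_schur[OF kS \<rho> X b, of e, symmetric] by (simp add: mult_ac)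
      qed measurable
      finally show "ennreal (\<rho> powr e) * \<Phi> b = \<Psi> \<rho> b" .
    qed measurable
    have "sqrt \<rho> ^ card (coord_basis S :: (('f, 'm) vec) set) = \<rho> powr (\<beta> * card S / 2)"
      using \<rho> by (simp add: card_coord_basis \<beta>_def powr_half_sqrt[symmetric] powr_realpow[symmetric] powr_powr mult.commute)
    \<comment> \<open>Balance of the powers of \<open>\<rho>\<close>: the radial law supplies
      \<open>\<beta> * card J / 2 - 1\<close>, the substitution
      \<open>b = sqrt \<rho> *\<^sub>R a\<close> takes \<open>\<beta> * card S / 2\<close>, and the
      remaining \<open>e\<close> is exactly what \<open>block_power_schur\<close> absorbs into the
      larger determinant.\<close>
    moreover have "\<beta> * card J / 2 - 1 = \<beta> * card S / 2 + e"
      by (simp add: e field_simps)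
    ultimately have pw: "\<rho> powr (\<beta> * card J / 2 - 1) = sqrt \<rho> ^ card (coord_basis S :: (('f, 'm) vec) set) * \<rho> powr e"
      by (simp add: powr_add)
    have "ennreal (\<rho> powr (\<beta> * card J / 2 - 1)) * G \<rho> =
      C * (ennreal (\<rho> powr e) * (ennreal (sqrt \<rho> ^ card (coord_basis S :: (('f, 'm) vec) set)) * (\<integral>\<^sup>+a. \<Phi> (sqrt \<rho> *\<^sub>R a) \<partial>lspan (coord_basis S))))"
      unfolding pw Geq using \<rho> by (simp add: ennreal_mult mult_ac)
    also have "\<dots> = C * (\<integral>\<^sup>+b. ennreal (\<rho> powr e) * \<Phi> b \<partial>lspan (coord_basis S))"
      unfolding scale by (subst nn_integral_cmult) auto
    finally show ?thesis unfolding \<Phi>\<Psi> .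
  qed
  have \<Psi>0: "(\<integral>\<^sup>+b. \<Psi> \<rho> b \<partial>lspan (coord_basis S)) = 0" if \<rho>: "\<rho> \<le> 0" for \<rho>
  proof -
    have "(\<integral>\<^sup>+b. \<Psi> \<rho> b \<partial>lspan (coord_basis S)) = (\<integral>\<^sup>+b. 0 \<partial>lspan (coord_basis S :: (('f, 'm) vec) set))"
    proof (rule nn_integral_lspan_cong)
      fix b :: "('f, 'm) vec" assume b: "b \<in> span (coord_basis S)"
      have "\<Psi> \<rho> b = (\<integral>\<^sup>+X. 0 \<partial>lspan (herm_basis S :: ((('f, 'm) vec, 'm) vec) set))"
        unfolding \<Psi>_def
        by (rule nn_integral_lspan_cong) (measurable, use block_power_nonpos[OF kS \<rho> _ b, of _ e] in \<open>simp add: H_def E_def\<close>)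
      then show "\<Psi> \<rho> b = 0" by simp
    qed measurable
    then show ?thesis by simp
  qed
  have on: "orthonormal (coord_basis J :: ('f, 'n) vec set)" by (rule orthonormal_coord_basis)
  have cardJ: "card J > 0" using j by (simp add: card_gt_0_iff) blast
  have c: "card (coord_basis J :: ('f^'n) set) = card J * DIM('f)" by (rule card_coord_basis)
  define \<kappa> where "\<kappa> = ennreal (pi powr (\<beta> * card J / 2) / Gamma (\<beta> * card J / 2))"
  have "(\<integral>\<^sup>+T. h (gram T) \<partial>lspan (mat_basis (insert k S) J :: ((('f, 'n) vec, 'm) vec) set)) =
    (\<integral>\<^sup>+v. \<integral>\<^sup>+T. h (gram (axis k v + T)) \<partial>lspan (mat_basis S J :: ((('f, 'n) vec, 'm) vec) set) \<partial>lspan (coord_basis J))"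
    by (rule nn_integral_mat_basis_row[OF kS]) measurable
  \<comment> \<open>After the rotation the inner integral depends on \<open>v\<close> only through
    its squared norm, so the radial law applies.\<close>
  also have "\<dots> = (\<integral>\<^sup>+v. G ((norm v)\<^sup>2) \<partial>lspan (coord_basis J :: ('f^'n) set))"
    by (rule nn_integral_lspan_cong) (measurable, simp add: G_def nn_integral_gram_row[OF h j])
  also have "\<dots> = (\<integral>\<^sup>+\<rho>. \<kappa> * (ennreal (indicator {0<..} \<rho> * \<rho> powr (\<beta> * card J / 2 - 1)) * G \<rho>) \<partial>lborel)"
    using nn_integral_lspan_norm_sq[of "coord_basis J :: ('f^'n) set" G] on cardJ
    unfolding c by (simp add: \<kappa>_def \<beta>_def mult.commute)
  also have "\<dots> = (\<integral>\<^sup>+\<rho>. \<kappa> * (C * (\<integral>\<^sup>+b. \<Psi> \<rho> b \<partial>lspan (coord_basis S))) \<partial>lborel)"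
  proof (rule nn_integral_cong)
    fix \<rho>
    have "ennreal (indicator {0<..} \<rho> * \<rho> powr (\<beta> * card J / 2 - 1)) * G \<rho> = C * (\<integral>\<^sup>+b. \<Psi> \<rho> b \<partial>lspan (coord_basis S))"
      using G[of \<rho>] \<Psi>0[of \<rho>] by (cases "\<rho> > 0") simp_all
    then show "\<kappa> * (ennreal (indicator {0<..} \<rho> * \<rho> powr (\<beta> * card J / 2 - 1)) * G \<rho>) =
        \<kappa> * (C * (\<integral>\<^sup>+b. \<Psi> \<rho> b \<partial>lspan (coord_basis S)))"
      by simp
  qed
  also have "\<dots> = \<kappa> * (C * (\<integral>\<^sup>+\<rho>. \<integral>\<^sup>+b. \<Psi> \<rho> b \<partial>lspan (coord_basis S) \<partial>lborel))"
    by (subst nn_integral_cmult, measurable, subst nn_integral_cmult, measurable)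
  also have "(\<integral>\<^sup>+\<rho>. \<integral>\<^sup>+b. \<Psi> \<rho> b \<partial>lspan (coord_basis S) \<partial>lborel) = (\<integral>\<^sup>+X. H X \<partial>lspan (herm_basis (insert k S)))"
    unfolding \<Psi>_def E_def by (rule nn_integral_herm_basis_insert[OF k, symmetric]) simp_all
  finally show ?thesis by (simp add: \<kappa>_def H_def)
qed

text \<open>\<open>J\<close> varies in the induction because every step uses up one column together
  with one row; \<open>card S \<le> card J\<close> guarantees that a column is left.\<close>

lemma nn_integral_gram:
  fixes S :: "'m::{finite,linorder} set" and J :: "'n::finite set" and h :: "(('f::conj_algebra, 'm) vec, 'm) vec \<Rightarrow> ennreal"
  assumes "card S \<le> card J" and "h \<in> borel_measurable borel"
  shows "(\<integral>\<^sup>+T. h (gram T) \<partial>lspan (mat_basis S J :: ((('f, 'n) vec, 'm) vec) set)) =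
     ennreal (gram_const DIM('f) (card S) (card J)) *
     (\<integral>\<^sup>+X. h X * block_power (DIM('f) * (real (card J) - real (card S) + 1) / 2 - 1) S X \<partial>lspan (herm_basis S))"
proof -
  have "finite S" by simp
  then show ?thesis using assms
  proof (induction S arbitrary: J h rule: finite_linorder_max_induct)
    case empty
    note [measurable] = empty.prems(2)
    have "pad {} = (mat 1 :: (('f, 'm) vec, 'm) vec)" by (simp add: pad_def mat_def vec_eq_iff)
    then have "block_power e {} (0 :: (('f, 'm) vec, 'm) vec) = 1" for e
      by (simp add: block_power_def pos_def_mat_1 hdet_mat_1)
    moreover have "gram (0 :: (('f, 'n) vec, 'm) vec) = 0" by (simp add: gram_def vec_eq_iff)
    ultimately show ?case
      by (simp add: mat_basis_def herm_basis_def nn_integral_lspan_empty gram_const_def)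
  next
    case (insert k S)
    have kS: "k \<notin> S" using insert.hyps(2) by blast
    then have cS: "card (insert k S) = Suc (card S)" by simp
    have "J \<noteq> {}" using insert.prems(1) cS by auto
    then obtain j where j: "j \<in> J" by blast
    then have cJ: "card (J - {j}) = card J - 1" "card J > 0" by (auto simp: card_gt_0_iff)
    define e where "e = DIM('f) * (real (card J) - real (card S)) / 2 - 1"
    \<comment> \<open>The exponent depends only on the difference of columns and rows, so removing
      one of each leaves it unchanged.\<close>
    have e1: "DIM('f) * (real (card (J - {j})) - real (card S) + 1) / 2 - 1 = e"
      and e2: "DIM('f) * (real (card J) - real (card (insert k S)) + 1) / 2 - 1 = e"
      using cJ cS by (simp_all add: e_def of_nat_diff algebra_simps)
    have "card S \<le> card (J - {j})" using insert.prems(1) cS cJ by simp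
    note IH = insert.IH[OF this, unfolded e1]
    have "gram_const DIM('f) (card (insert k S)) (card J) =
        pi powr (real DIM('f) * card J / 2) / Gamma (real DIM('f) * card J / 2) * gram_const DIM('f) (card S) (card (J - {j}))"
      using gram_const_Suc[OF cJ(2)] cS cJ by simp
    moreover have "pi powr (real DIM('f) * card J / 2) / Gamma (real DIM('f) * card J / 2) \<ge> 0"
      using cJ by (intro divide_nonneg_nonneg less_imp_le[OF Gamma_real_pos]) auto
    ultimately have C: "ennreal (gram_const DIM('f) (card (insert k S)) (card J)) =
        ennreal (pi powr (real DIM('f) * card J / 2) / Gamma (real DIM('f) * card J / 2)) * ennreal (gram_const DIM('f) (card S) (card (J - {j})))"
      by (metis ennreal_mult')
    show ?case
      unfolding e2 C mult.assoc
      by (rule nn_integral_gram_step[OF _ j insert.prems(2) _ IH]) (use insert.hyps in \<open>auto simp: e_def\<close>)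
  qed
qed

section \<open>The density of the Gram matrix\<close>

text \<open>The passage from products of Lebesgue measures on the scalars to real coordinates: each
  factor is \<open>lspan Basis\<close>, and \<open>\<phi> i\<close> carries its coordinates to their
  place in the sum.\<close>

lemma nn_integral_PiM_lborel:
  fixes \<phi> :: "'i \<Rightarrow> 'e::euclidean_space \<Rightarrow> 'v::euclidean_space"
  assumes "finite I" and lin: "\<And>i. linear (\<phi> i)" and "\<And>i. i \<in> I \<Longrightarrow> inj_on (\<phi> i) Basis"
    and "disjoint_family_on (\<lambda>i. \<phi> i ` Basis) I" and "h \<in> borel_measurable borel"
  shows "(\<integral>\<^sup>+u. h (\<Sum>i\<in>I. \<phi> i (u i)) \<partial>(\<Pi>\<^sub>M i\<in>I. lborel)) = (\<integral>\<^sup>+x. h x \<partial>lspan (\<Union>i\<in>I. \<phi> i ` Basis))"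
  using assms(1,3-5)
proof (induction I arbitrary: h)
  case empty
  then show ?case by (simp add: PiM_empty nn_integral_lspan_empty)
next
  case (insert i I)
  interpret product_sigma_finite "\<lambda>_::'i. lborel :: 'e measure" by standard
  note [measurable] = borel_measurable_linear[OF lin] insert.prems(3)
  let ?U = "\<Union>i\<in>I. \<phi> i ` Basis"
  have disj: "\<phi> i ` Basis \<inter> ?U = {}" "disjoint_family_on (\<lambda>i. \<phi> i ` Basis) I"
    using insert.prems(2) insert.hyps by (auto simp: disjoint_family_on_insert)
  have fin: "finite ?U" using insert.hyps by simp
  have m: "(\<lambda>u. \<Sum>j\<in>insert i I. \<phi> j (u j)) \<in> borel_measurable (\<Pi>\<^sub>M j\<in>insert i I. (lborel :: 'e measure))"
  proof (rule borel_measurable_sum)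
    fix j assume "j \<in> insert i I"
    then have "(\<lambda>u. u j) \<in> (\<Pi>\<^sub>M j\<in>insert i I. (lborel :: 'e measure)) \<rightarrow>\<^sub>M lborel"
      by (rule measurable_component_singleton)
    then show "(\<lambda>u. \<phi> j (u j)) \<in> borel_measurable (\<Pi>\<^sub>M j\<in>insert i I. (lborel :: 'e measure))"
      by (rule measurable_compose) simp
  qed
  have "(\<integral>\<^sup>+u. h (\<Sum>j\<in>insert i I. \<phi> j (u j)) \<partial>(\<Pi>\<^sub>M j\<in>insert i I. lborel)) =
    (\<integral>\<^sup>+y. \<integral>\<^sup>+u. h (\<Sum>j\<in>insert i I. \<phi> j ((u(i := y)) j)) \<partial>(\<Pi>\<^sub>M j\<in>I. lborel) \<partial>lborel)"
    by (rule product_nn_integral_insert_rev) (use insert.hyps measurable_compose[OF m insert.prems(3)] in simp_all)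
  also have "\<dots> = (\<integral>\<^sup>+y. \<integral>\<^sup>+u. h (\<phi> i y + (\<Sum>j\<in>I. \<phi> j (u j))) \<partial>(\<Pi>\<^sub>M j\<in>I. lborel) \<partial>lborel)"
  proof (intro nn_integral_cong arg_cong[where f=h])
    fix y u
    have "(\<Sum>j\<in>I. \<phi> j ((u(i := y)) j)) = (\<Sum>j\<in>I. \<phi> j (u j))"
      using insert.hyps by (intro sum.cong) auto
    then show "(\<Sum>j\<in>insert i I. \<phi> j ((u(i := y)) j)) = \<phi> i y + (\<Sum>j\<in>I. \<phi> j (u j))"
      using insert.hyps by simp
  qed
  also have "\<dots> = (\<integral>\<^sup>+y. \<integral>\<^sup>+x. h (\<phi> i y + x) \<partial>lspan ?U \<partial>lspan Basis)"
    unfolding lspan_Basis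
  proof (intro nn_integral_cong insert.IH disj(2))
    show "(\<lambda>x. h (\<phi> i y + x)) \<in> borel_measurable borel" for y by measurable
  qed (use insert.prems(1) in blast)
  also have "\<dots> = (\<integral>\<^sup>+z. \<integral>\<^sup>+x. h (z + x) \<partial>lspan ?U \<partial>lspan (\<phi> i ` Basis))"
    using insert.prems(1) fin
    by (intro nn_integral_lspan_image[symmetric] lin borel_measurable_nn_integral_lspan) auto
  also have "\<dots> = (\<integral>\<^sup>+x. h x \<partial>lspan (\<phi> i ` Basis \<union> ?U))"
    using disj fin by (intro nn_integral_lspan_Un[symmetric]) auto
  finally show ?case by simp
qed

lemma herm_of_eq_sum:
  fixes d :: "'m::{finite,linorder} \<Rightarrow> real" and u :: "'m \<times> 'm \<Rightarrow> 'f::conj_algebra"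
  shows "herm_of (d, u) = (\<Sum>i\<in>UNIV. d i *\<^sub>R axis i (axis i 1)) +
    (\<Sum>p\<in>{(i, j). i < j}. sym_col (snd p) (axis (fst p) (u p)))"
proof -
  have "(herm_of (d, u) :: (('f, 'm) vec, 'm) vec) $ a $ b = ((\<Sum>i\<in>UNIV. d i *\<^sub>R axis i (axis i 1)) +
    (\<Sum>p\<in>{(i, j). i < j}. sym_col (snd p) (axis (fst p) (u p)))) $ a $ b" for a b
  proof -
    have 1: "(\<Sum>i\<in>UNIV. d i *\<^sub>R axis i (axis i 1)) $ a $ b = (if a = b then of_real (d a) else (0 :: 'f))"
    proof -
      have "(\<Sum>i\<in>UNIV. d i *\<^sub>R axis i (axis i 1)) $ a $ b = (\<Sum>i\<in>UNIV. if i = a then (if a = b then of_real (d a) else (0 :: 'f)) else 0)"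
        unfolding sum_component by (intro sum.cong) (auto simp: axis_component of_real_def)
      then show ?thesis by simp
    qed
    have 2: "(\<Sum>p\<in>{(i, j). i < j}. sym_col (snd p) (axis (fst p) (u p))) $ a $ b =
      (if a < b then u (a, b) else 0) + (if b < a then hconj (u (b, a)) else 0)"
    proof -
      have "(\<Sum>p\<in>{(i, j). i < j}. sym_col (snd p) (axis (fst p) (u p))) $ a $ b =
        (\<Sum>p\<in>{(i, j). i < j}. if p = (a, b) then u (a, b) else 0) +
        (\<Sum>p\<in>{(i, j). i < j}. if p = (b, a) then hconj (u (b, a)) else 0)"
        unfolding sum_component sum.distrib[symmetric]
      proof (rule sum.cong[OF refl])
        fix p :: "'m \<times> 'm"
        obtain i j where p: "p = (i, j)" by (cases p)
        show "sym_col (snd p) (axis (fst p) (u p)) $ a $ b =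
            (if p = (a, b) then u (a, b) else 0) + (if p = (b, a) then hconj (u (b, a)) else 0)"
          unfolding p sym_col_def
          by (cases "i = a"; cases "j = b"; cases "j = a"; cases "i = b") (simp_all add: axis_component)
      qed
      moreover have "finite {(i, j). i < (j :: 'm)}" by (rule finite)
      ultimately show ?thesis by (simp only: sum.delta mem_Collect_eq case_prod_conv)
    qed
    show ?thesis
      unfolding vector_add_component 1 2
      by (cases a b rule: linorder_cases) (auto simp: herm_of_def)
  qed
  then show ?thesis by (subst vec_eq_iff, subst vec_eq_iff) blast
qed

text \<open>\<open>herm_of\<close> is the sum of linear images of its independent coordinates, and
  the images of the real unit vectors make up \<open>herm_basis UNIV\<close> without
  repetition.\<close>

lemma nn_integral_lborel_herm:
  fixes h :: "(('f::conj_algebra, 'm::{finite,linorder}) vec, 'm) vec \<Rightarrow> ennreal"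
  assumes [measurable]: "h \<in> borel_measurable borel"
  shows "(\<integral>\<^sup>+X. h X \<partial>lborel_herm) = (\<integral>\<^sup>+X. h X \<partial>lspan (herm_basis UNIV))"
proof -
  define P where "P = {(i, j). i < (j :: 'm)}"
  define \<phi> where "\<phi> i r = (r *\<^sub>R axis i (axis i 1) :: (('f, 'm) vec, 'm) vec)" for i :: 'm and r :: real
  define \<psi> where "\<psi> p u = sym_col (snd p) (axis (fst p) u)" for p :: "'m \<times> 'm" and u :: 'f
  let ?M1 = "\<Pi>\<^sub>M i\<in>(UNIV :: 'm set). (lborel :: real measure)"
  let ?M2 = "\<Pi>\<^sub>M p\<in>P. (lborel :: 'f measure)"
  have fin: "finite P" by simp
  interpret P: product_sigma_finite "\<lambda>_::'m \<times> 'm. lborel :: 'f measure" by standard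
  interpret finite_product_sigma_finite "\<lambda>_::'m \<times> 'm. lborel :: 'f measure" P by standard (rule fin)
  have herm [measurable]: "(herm_of :: _ \<Rightarrow> (('f, 'm) vec, 'm) vec) \<in> borel_measurable (?M1 \<Otimes>\<^sub>M ?M2)"
    unfolding P_def by (rule measurable_herm_of)
  define A where "A = (\<Union>i\<in>UNIV. \<phi> i ` Basis :: (('f, 'm) vec, 'm) vec set)"
  define B where "B = (\<Union>p\<in>P. \<psi> p ` Basis)"
  have lin\<phi>: "linear (\<phi> i :: _ \<Rightarrow> (('f, 'm) vec, 'm) vec)" for i
    by (rule linearI) (simp_all add: \<phi>_def algebra_simps)
  have lin\<psi>: "linear (\<psi> p)" for p
    by (rule linearI) (simp_all add: \<psi>_def linear_add[OF linear_sym_col] linear_add[OF linear_axis]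
      linear_scale[OF linear_sym_col] linear_scale[OF linear_axis])
  have \<phi>c: "(\<phi> i r :: (('f, 'm) vec, 'm) vec) $ j $ j = (if i = j then of_real r else 0)" for i j r
    by (simp add: \<phi>_def axis_component of_real_def)
  have \<psi>c: "\<psi> (i, j) u $ a $ b = (if a = i \<and> b = j then u else 0)" if "i < j" "a < b" for i j a b u
    using that by (auto simp: \<psi>_def sym_col_def axis_component)
  have \<psi>d: "\<psi> (i, j) u $ a $ a = 0" if "i < j" for i j a u
    using that by (auto simp: \<psi>_def sym_col_def axis_component)
  have inj\<phi>: "inj_on (\<phi> i :: _ \<Rightarrow> (('f, 'm) vec, 'm) vec) Basis" for i
    by (simp add: inj_on_def)
  have disj\<phi>: "disjoint_family_on (\<lambda>i. \<phi> i ` Basis :: (('f, 'm) vec, 'm) vec set) UNIV"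
  unfolding disjoint_family_on_def
  proof (intro ballI impI)
    fix i j :: 'm assume "i \<noteq> j"
    then have "(\<phi> i 1 :: (('f, 'm) vec, 'm) vec) $ i $ i \<noteq> \<phi> j 1 $ i $ i" by (simp add: \<phi>c)
    then show "\<phi> i ` Basis \<inter> \<phi> j ` Basis = ({} :: (('f, 'm) vec, 'm) vec set)" by auto
  qed
  have inj\<psi>: "inj_on (\<psi> p) Basis" if "p \<in> P" for p
  proof (rule inj_onI)
    fix u v assume eq: "\<psi> p u = \<psi> p v"
    obtain i j where p: "p = (i, j)" "i < j" using \<open>p \<in> P\<close> by (auto simp: P_def)
    show "u = v" using arg_cong[OF eq, of "\<lambda>X. X $ i $ j"] p by (simp add: \<psi>c)
  qed
  have disj\<psi>: "disjoint_family_on (\<lambda>p. \<psi> p ` Basis) P"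
  unfolding disjoint_family_on_def
  proof (intro ballI impI)
    fix p q assume pq: "p \<in> P" "q \<in> P" "p \<noteq> q"
    obtain i j a b where p: "p = (i, j)" "i < j" and q: "q = (a, b)" "a < b"
      using pq by (auto simp: P_def)
    have "\<psi> p u \<noteq> \<psi> q v" if "u \<in> Basis" for u v
    proof
      assume eq: "\<psi> p u = \<psi> q v"
      have "u = 0" using arg_cong[OF eq, of "\<lambda>X. X $ i $ j"] p q pq(3) by (auto simp: \<psi>c)
      then show False using that by simp
    qed
    then show "\<psi> p ` Basis \<inter> \<psi> q ` Basis = {}" by blast
  qed
  have AB: "A \<inter> B = {}"
  proof -
    have "\<phi> i 1 \<noteq> \<psi> p u" if "p \<in> P" for i p u
    proof
      assume eq: "\<phi> i 1 = \<psi> p u"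
      show False using arg_cong[OF eq, of "\<lambda>X. X $ i $ i"] that by (auto simp: \<phi>c \<psi>d P_def)
    qed
    then have "\<psi> p u \<noteq> \<phi> i 1" if "p \<in> P" for i p u using that by metis
    then show ?thesis by (auto simp: A_def B_def)
  qed
  have ABh: "A \<union> B = herm_basis UNIV"
    by (fastforce simp: A_def B_def P_def \<phi>_def \<psi>_def herm_basis_def coord_basis_def)
  have finAB: "finite A" "finite B" by (simp_all add: A_def B_def)
  have "(\<integral>\<^sup>+X. h X \<partial>lborel_herm) = (\<integral>\<^sup>+p. h (herm_of p) \<partial>(?M1 \<Otimes>\<^sub>M ?M2))"
    unfolding lborel_herm_def P_def[symmetric] by (rule nn_integral_distr) measurable
  also have "\<dots> = (\<integral>\<^sup>+d. \<integral>\<^sup>+u. h (herm_of (d, u)) \<partial>?M2 \<partial>?M1)"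
    by (rule nn_integral_fst[symmetric]) measurable
  also have "\<dots> = (\<integral>\<^sup>+d. \<integral>\<^sup>+u. h ((\<Sum>i\<in>UNIV. \<phi> i (d i)) + (\<Sum>p\<in>P. \<psi> p (u p))) \<partial>?M2 \<partial>?M1)"
    by (simp add: herm_of_eq_sum \<phi>_def \<psi>_def P_def)
  also have "\<dots> = (\<integral>\<^sup>+d. \<integral>\<^sup>+x. h ((\<Sum>i\<in>UNIV. \<phi> i (d i)) + x) \<partial>lspan B \<partial>?M1)"
    unfolding B_def
    by (intro nn_integral_cong nn_integral_PiM_lborel[OF fin lin\<psi> inj\<psi> disj\<psi>]) measurable
  also have "\<dots> = (\<integral>\<^sup>+y. \<integral>\<^sup>+x. h (y + x) \<partial>lspan B \<partial>lspan A)"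
    unfolding A_def
    by (rule nn_integral_PiM_lborel[OF _ lin\<phi> inj\<phi> disj\<phi>])
      (auto intro!: borel_measurable_nn_integral_lspan finAB)
  also have "\<dots> = (\<integral>\<^sup>+X. h X \<partial>lspan (herm_basis UNIV))"
    unfolding ABh[symmetric] by (rule nn_integral_lspan_Un[symmetric]) (use finAB AB in auto)
  finally show ?thesis .
qed

lemma sets_lborel_herm [simp, measurable_cong]: "sets lborel_herm = sets borel"
  by (simp add: lborel_herm_def)

section \<open>Constants and the density of the Gram matrix\<close>

text \<open>The Gamma factors agree one by one. The exponents \<open>\<beta> * (N - i) / 2\<close>
  of pi sum to \<open>\<beta> * s * N / 2 - \<beta> * s * (s - 1) / 4\<close>, and the subtracted
  part is the power of pi inside \<open>mv_gamma\<close>.\<close>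

lemma gram_const_eq:
  assumes "s \<le> N" "\<beta> > 0"
  shows "gram_const \<beta> s N = pi powr (real s * real N * \<beta> / 2) / mv_gamma \<beta> s (\<beta> * real N / 2)"
    and "mv_gamma \<beta> s (\<beta> * real N / 2) > 0"
  using assms(1)
proof (induction s)
  case 0
  case 1 show ?case by (simp add: gram_const_def mv_gamma_def)
  case 2 show ?case by (simp add: mv_gamma_def)
next
  case (Suc s)
  define g where "g = \<beta> * (real N - real s) / 2"
  have g: "g > 0" if "Suc s \<le> N" using that assms(2) by (simp add: g_def)
  have e: "real (Suc s) * (real (Suc s) - 1) * \<beta> / 4 = real s * (real s - 1) * \<beta> / 4 + \<beta> * real s / 2"
    by (simp add: field_simps)
  have mv: "mv_gamma \<beta> (Suc s) (\<beta> * real N / 2) = mv_gamma \<beta> s (\<beta> * real N / 2) * (pi powr (\<beta> * real s / 2) * Gamma g)"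
  proof -
    have "\<beta> * real N / 2 - real s * \<beta> / 2 = g"
      by (simp add: g_def field_simps)
    then have prod: "(\<Prod>i=1..Suc s. Gamma (\<beta> * real N / 2 - (real i - 1) * \<beta> / 2)) =
        (\<Prod>i=1..s. Gamma (\<beta> * real N / 2 - (real i - 1) * \<beta> / 2)) * Gamma g"
      by simp
    show ?thesis
      unfolding mv_gamma_def e powr_add prod by (simp only: mult_ac)
  qed
  have gc: "gram_const \<beta> (Suc s) N = gram_const \<beta> s N * (pi powr g / Gamma g)"
    by (simp add: gram_const_def g_def)
  have "real (Suc s) * real N * \<beta> / 2 = real s * real N * \<beta> / 2 + (\<beta> * real s / 2 + g)"
    by (simp add: g_def field_simps)
  then have p: "pi powr (real (Suc s) * real N * \<beta> / 2) = pi powr (real s * real N * \<beta> / 2) * (pi powr (\<beta> * real s / 2) * pi powr g)"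
    by (simp only: powr_add)
  {
    case 1
    show ?case
    proof -
      have I: "gram_const \<beta> s N = pi powr (real s * real N * \<beta> / 2) / mv_gamma \<beta> s (\<beta> * real N / 2)"
        by (rule Suc.IH(1)) (use 1 in simp)
      show ?thesis unfolding mv gc p I by simp
    qed
  next
    case 2
    show ?case
      unfolding mv using Suc.IH 2 g by simp
  }
qed

lemma pad_empty: "pad {} = mat 1"
  by (simp add: pad_def mat_def vec_eq_iff)

lemma pad_UNIV: "pad UNIV = 0"
  by (simp add: pad_def vec_eq_iff)

lemma inner_gram: "x \<bullet> (gram T *v x) \<ge> 0"
  for T :: "'f::conj_algebra^'n^'m"
proof -
  have "gram T *v x = T *v (adj T *v x)"
    by (simp add: gram_eq matrix_vector_mul_assoc)
  then have "x \<bullet> (gram T *v x) = (adj T *v x) \<bullet> (adj T *v x)"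
    using inner_adj[of T "adj T *v x" x] by (simp add: inner_commute)
  then show ?thesis by simp
qed

lemma pos_def_one_plus:
  fixes A :: "'f::conj_algebra^'m^'m"
  assumes "adj A = A" "\<And>x. x \<bullet> (A *v x) \<ge> 0"
  shows "mat 1 + A \<in> pos_def"
proof -
  have "x \<bullet> ((mat 1 + A) *v x) > 0" if "x \<noteq> 0" for x
    using that assms(2)[of x] by (simp add: matrix_vector_mult_add_rdistrib inner_add_right add_pos_nonneg)
  then show ?thesis
    by (simp add: pos_def_iff linear_add[OF linear_adj] assms(1))
qed

lemma adj_gram: "adj (gram T) = gram T"
  by (simp add: adj_def gram_def vec_eq_iff hconj_hform)

lemma distributed_gram:
  fixes T :: "'a \<Rightarrow> (('f::conj_algebra, 'n::finite) vec, 'm::{finite,linorder}) vec"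
  assumes card: "CARD('m) \<le> CARD('n)" and T: "mv_t_distributed M \<nu> T"
  shows "distributed M lborel_herm (\<lambda>\<omega>. T \<omega> ** adj (T \<omega>)) (\<lambda>F. ennreal (mv_beta2_density CARD('n) \<nu> F))"
proof -
  define \<beta> where "\<beta> = real DIM('f)"
  define q where "q = - \<beta> * (real CARD('n) + \<nu>) / 2"
  define e where "e = \<beta> * (real CARD('n) - real CARD('m) + 1) / 2 - 1"
  define K where "K = mv_gamma \<beta> CARD('m) (\<beta> * (real CARD('n) + \<nu>) / 2) /
    (pi powr (real CARD('m) * real CARD('n) * \<beta> / 2) * mv_gamma \<beta> CARD('m) (\<beta> * \<nu> / 2))"
  define c where "c = gram_const \<beta> CARD('m) CARD('n)"
  define D where "D = 1 / mv_beta \<beta> CARD('m) (\<beta> * \<nu> / 2) (\<beta> * real CARD('n) / 2)"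
  have \<beta>: "\<beta> > 0" by (simp add: \<beta>_def)
  note gc = gram_const_eq[OF card \<beta>]
  have c: "c \<ge> 0" using gc by (simp add: c_def)
  have ab: "\<beta> * real CARD('n) / 2 + \<beta> * \<nu> / 2 = \<beta> * (real CARD('n) + \<nu>) / 2"
    by (simp add: field_simps)
  \<comment> \<open>The powers of pi in \<open>K\<close> and \<open>c\<close> cancel, and the three
    multivariate Gamma values left are those of \<open>mv_beta\<close>.\<close>
  have "K * c = D"
    unfolding K_def c_def D_def gc(1) mv_beta_def ab by simp
  then have KcD: "ennreal K * ennreal c = ennreal D"
    using c by (simp flip: ennreal_mult'')
  have t: "ennreal (mv_t_density \<nu> t) = ennreal K * block_power q {} (gram t)" for t :: "(('f, 'n) vec, 'm) vec"
  proof -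
    have "mat 1 + gram t \<in> pos_def"
      by (rule pos_def_one_plus[OF adj_gram inner_gram])
    moreover have "mv_t_density \<nu> t = K * hdet (mat 1 + gram t) powr q"
      by (simp add: mv_t_density_def Let_def gram_eq K_def q_def \<beta>_def)
    ultimately show ?thesis
      by (simp add: block_power_def pad_empty add.commute[of _ "mat 1"] ennreal_mult'')
  qed
  \<comment> \<open>Off the cone \<open>block_power e UNIV\<close> is 0 by definition, which agrees
    with the extension of the density by 0.\<close>
  have F: "ennreal (mv_beta2_density CARD('n) \<nu> F) = ennreal D * (block_power q {} F * block_power e UNIV F)"
    for F :: "(('f, 'm) vec, 'm) vec"
  proof (cases "F \<in> pos_def")
    case True
    have "x \<bullet> (F *v x) \<ge> 0" for x
      using True by (cases "x = 0") (auto simp: pos_def_iff less_imp_le)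
    then have "mat 1 + F \<in> pos_def"
      using True by (intro pos_def_one_plus) (auto simp: pos_def_iff)
    moreover have "mv_beta2_density CARD('n) \<nu> F = D * (hdet (mat 1 + F) powr q * hdet F powr e)"
      using True by (simp add: mv_beta2_density_def Let_def D_def q_def e_def \<beta>_def)
    ultimately show ?thesis
      using True by (simp add: block_power_def pad_empty pad_UNIV add.commute[of _ "mat 1"] ennreal_mult'')
  qed (simp add: mv_beta2_density_def block_power_def pad_UNIV)
  have TM: "T \<in> borel_measurable M" and Td: "distr M lborel T = density lborel (\<lambda>t. ennreal (mv_t_density \<nu> t))"
    using T by (simp_all add: mv_t_distributed_def distributed_def)
  have dens: "(\<lambda>F. ennreal (mv_beta2_density CARD('n) \<nu> F)) \<in> borel_measurable (lborel_herm :: (('f, 'm) vec, 'm) vec measure)"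
    unfolding F by measurable
  have gT: "(\<lambda>\<omega>. gram (T \<omega>)) \<in> measurable M lborel_herm"
    using measurable_compose[OF TM borel_measurable_gram]
    by (subst measurable_cong_sets[OF refl sets_lborel_herm])
  have "distr M lborel_herm (\<lambda>\<omega>. gram (T \<omega>)) = density lborel_herm (\<lambda>F. ennreal (mv_beta2_density CARD('n) \<nu> F))"
  proof (rule measure_eqI)
    fix A assume "A \<in> sets (distr M lborel_herm (\<lambda>\<omega>. gram (T \<omega>)))"
    then have A [measurable]: "A \<in> sets borel" by simp
    have "emeasure (distr M lborel_herm (\<lambda>\<omega>. gram (T \<omega>))) A = emeasure (distr M lborel T) (gram -` A)"
      using gT TM measurable_sets[OF borel_measurable_gram A] A
      by (simp add: emeasure_distr vimage_def)
    also have "\<dots> = (\<integral>\<^sup>+t. ennreal K * (block_power q {} (gram t) * indicator A (gram t))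
        \<partial>(lborel :: (('f, 'n) vec, 'm) vec measure))"
    proof -
      have gA [measurable]: "(gram -` A :: (('f, 'n) vec, 'm) vec set) \<in> sets borel" using measurable_sets[OF borel_measurable_gram A] by simp
      have "emeasure (density lborel (\<lambda>t :: (('f, 'n) vec, 'm) vec. ennreal K * block_power q {} (gram t))) (gram -` A) =
          (\<integral>\<^sup>+t. ennreal K * block_power q {} (gram t) * indicator (gram -` A) t
            \<partial>(lborel :: (('f, 'n) vec, 'm) vec measure))"
        by (rule emeasure_density) (use gA in simp_all)
      then show ?thesis
        unfolding Td t by (simp add: mult.assoc indicator_def)
    qed
    also have "\<dots> = ennreal K * (\<integral>\<^sup>+t. block_power q {} (gram t) * indicator A (gram t)
        \<partial>(lborel :: (('f, 'n) vec, 'm) vec measure))"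
      by (rule nn_integral_cmult) measurable
    \<comment> \<open>The integrand is a function of the Gram matrix: the factor |I + F|^q of the t
      density times the indicator of \<open>A\<close>. The map contributes the power of |F|.\<close>
    also have "(\<integral>\<^sup>+t. block_power q {} (gram (t :: (('f, 'n) vec, 'm) vec)) * indicator A (gram t) \<partial>lborel) =
        ennreal c * (\<integral>\<^sup>+X. block_power q {} X * indicator A X * block_power e UNIV X \<partial>lspan (herm_basis UNIV))"
      using nn_integral_gram[of "UNIV :: 'm set" "UNIV :: 'n set" "\<lambda>X :: (('f, 'm) vec, 'm) vec. block_power q {} X * indicator A X"] card
      by (simp add: mat_basis_UNIV lspan_Basis c_def \<beta>_def e_def)
    also have "(\<integral>\<^sup>+X. block_power q {} X * indicator A X * block_power e UNIV X \<partial>lspan (herm_basis UNIV)) =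
        (\<integral>\<^sup>+X. block_power q {} X * indicator A X * block_power e UNIV X \<partial>lborel_herm)"
      by (rule nn_integral_lborel_herm[symmetric]) measurable
    also have "ennreal K * (ennreal c * \<dots>) =
        (\<integral>\<^sup>+X. ennreal D * (block_power q {} X * indicator A X * block_power e UNIV X) \<partial>lborel_herm)"
      by (subst nn_integral_cmult) (simp_all add: mult.assoc[symmetric] KcD)
    also have "\<dots> = emeasure (density lborel_herm (\<lambda>F. ennreal (mv_beta2_density CARD('n) \<nu> F))) A"
      by (subst emeasure_density[OF dens]) (simp_all add: F mult_ac)
    finally show "emeasure (distr M lborel_herm (\<lambda>\<omega>. gram (T \<omega>))) A =
        emeasure (density lborel_herm (\<lambda>F. ennreal (mv_beta2_density CARD('n) \<nu> F))) A" .
  qed simp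
  then show ?thesis
    using dens gT by (simp add: distributed_def gram_eq)
qed

theorem theorem2p2:
  fixes M :: "'a measure" and \<nu> :: real
    and T1 :: "'a \<Rightarrow> real^'n^'m::{finite,linorder}"
    and T2 :: "'a \<Rightarrow> complex^'n^'m::{finite,linorder}"
    and T4 :: "'a \<Rightarrow> quat^'n^'m::{finite,linorder}"
  assumes "prob_space M" and "CARD('m) \<le> CARD('n)"
  shows
   "(\<nu> > 1 * (real CARD('m) - 1) \<and> mv_t_distributed M \<nu> T1 \<longrightarrow>
       distributed M lborel_herm (\<lambda>\<omega>. T1 \<omega> ** adj (T1 \<omega>))
         (\<lambda>F. ennreal (mv_beta2_density CARD('n) \<nu> F)))
    \<and> (\<nu> > 2 * (real CARD('m) - 1) \<and> mv_t_distributed M \<nu> T2 \<longrightarrow>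
       distributed M lborel_herm (\<lambda>\<omega>. T2 \<omega> ** adj (T2 \<omega>))
         (\<lambda>F. ennreal (mv_beta2_density CARD('n) \<nu> F)))
    \<and> (\<nu> > 4 * (real CARD('m) - 1) \<and> mv_t_distributed M \<nu> T4 \<longrightarrow>
       distributed M lborel_herm (\<lambda>\<omega>. T4 \<omega> ** adj (T4 \<omega>))
         (\<lambda>F. ennreal (mv_beta2_density CARD('n) \<nu> F)))"
  using distributed_gram[OF assms(2), of M \<nu> T1] distributed_gram[OF assms(2), of M \<nu> T2]
    distributed_gram[OF assms(2), of M \<nu> T4]
  by blast

end
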